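(* Let $n$ be a positive smooth function on $[0,1]$ and consider the manifold $\mathcal M=[0,1]\times\mathbf S^1$ with the metric described in the context. Assume the standing assumptions in the context and let $u_1\in(0,c_* )$ be the unique number with $\rho(u_1)u_1 n(1)=\rho(u_0)u_0 n(0)$. Assume $\partial_1\phi\ge0$ on $\partial\Omega$. Then problem (P$_\mathcal M$) with exit data $c_1\in(0,c_* )$ admits a transonic shock solution (in the sense defined in the context) if and only if $c_1=u_1$. Moreover the solution is unique modulo a translation of the shock along the $x^1$-direction: every transonic shock solution has shock $\{x^1=x^1_b\}$ for a constant $x^1_b\in(0,1)$ and coincides (up to an additive constant) with the solution $\phi_b=\phi_b(x^1)$ depending only on $x^1$ with shock at $x^1_b$; conversely every $x^1_b\in(0,1)$ yields such a solution.
   Context: Constants: $\gamma>1$, $c_0>0$, $c_*:=\sqrt{2c_0^2/(\gamma+1)}$, $u_0\in\big(c_*,\sqrt{2c_0^2/(\gamma-1)}\big)$. For a speed $q\in[0,\sqrt{2c_0^2/(\gamma-1)})$, $\rho(q)=\big(\frac1\gamma(c_0^2-\frac{\gamma-1}{2}q^2)\big)^{1/(\gamma-1)}$, $c^2=c_0^2-\frac{\gamma-1}2q^2$. Standing assumption: $\rho(u_0)u_0 n(0)<\rho(c_* )c_*\min_{[0,1]}n$. Setting: $\mathcal M=\Omega=\{(x^1,x^2):x^1\in[0,1],x^2\in\mathbf S^1\cong[0,2\pi]\}$ with metric $\mathrm dx^1\otimes\mathrm dx^1+n(x^1)^2\,\mathrm dx^2\otimes\mathrm dx^2$; entry $\Sigma_0=\{x^1=0\}$,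 exit $\Sigma_1=\{x^1=1\}$. For a potential $\phi$, $\nabla\phi=(\partial_1\phi,\frac1{n}\partial_2\phi)$ in an orthonormal frame, $|\nabla\phi|^2=(\partial_1\phi)^2+\frac{(\partial_2\phi)^2}{n(x^1)^2}$; potential flow equation $\mathrm{div}(\rho(|\nabla\phi|)\nabla\phi)=\frac1{n}\big(\partial_1(n\rho\,\partial_1\phi)+\partial_2(\frac{\rho}{n}\partial_2\phi)\big)=0$. Supersonic: $|\nabla\phi|>c_*$; subsonic: $|\nabla\phi|<c_*$. Problem (P$_\mathcal M$): the equation in $\Omega$, $\nabla\phi=(u_0,0)$ on $\Sigma_0$, $|\nabla\phi|=c_1$ on $\Sigma_1$. Transonic shock solution: $\phi\in C^{0,1}(\Omega)\cap C^2(\Omega^-\cup\Omega^+)$, where for a $C^1$ function $x^1_s(x^2)$ with values in $(0,1)$, $S=\{x^1=x^1_s(x^2)\}$, $\Omega^-=\{x^1<x^1_s(x^2)\}$, $\Omega^+=\{x^1>x^1_s(x^2)\}$, such that $\phi$ is supersonic in $\Omega^-$, subsonic in $\Omega^+$, solves the equation in $\Omega^-\cup\Omega^+$, satisfies the boundary conditions pointwise, and on $S$ satisfies $(\rho(|\nabla\phi_-|)\nabla\phi_--\rho(|\nabla\phi_+|)\nabla\phi_+)\cdot\mathbf n_s=0$ and $\frac12|\nabla\phi_-|^2+\frac{c_-^2}{\gamma-1}=\frac12|\nabla\phi_+|^2+\frac{c_+^2}{\gamma-1}$ ($\phi_\mp$ one-sided limits, $c_\mp$ corresponding sonic speeds,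 $\mathbf n_s$ unit normal of $S$ in $\mathcal M$). The solution $\phi_b(x^1)$ with shock at $x^1_b$: $u=\phi_b'$ solves $u'=\frac{n'(x^1)}{n(x^1)}\frac{c^2u}{u^2-c^2}$ on $(0,x^1_b)$ with $u(0)=u_0$ (supersonic), jumps at $x^1_b$ to the subsonic $u_+<c_*$ with $\rho(u_+)u_+=\rho(u_-)u_-$, and solves the same ODE subsonically on $(x^1_b,1]$; $\phi_b$ is continuous. *)

theory Defs
  imports "HOL-Analysis.Analysis"
begin

definition cstar :: "real \<Rightarrow> real \<Rightarrow> real" where
  "cstar \<gamma> c0 = sqrt (2 * c0^2 / (\<gamma> + 1))"

definition qmax :: "real \<Rightarrow> real \<Rightarrow> real" where
  "qmax \<gamma> c0 = sqrt (2 * c0^2 / (\<gamma> - 1))"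

definition csq :: "real \<Rightarrow> real \<Rightarrow> real \<Rightarrow> real" where
  "csq \<gamma> c0 q = c0^2 - (\<gamma> - 1) / 2 * q^2"

definition rho :: "real \<Rightarrow> real \<Rightarrow> real \<Rightarrow> real" where
  "rho \<gamma> c0 q = ((1 / \<gamma>) * (c0^2 - (\<gamma> - 1) / 2 * q^2)) powr (1 / (\<gamma> - 1))"

definition smooth_on_01 :: "(real \<Rightarrow> real) \<Rightarrow> bool" where
  "smooth_on_01 f \<longleftrightarrow> (\<forall>k. \<forall>x\<in>{0..1}. ((deriv ^^ k) f) differentiable (at x))"

text \<open>Points are pairs (x1, x2); x2 is the angle on S^1, functions are 2pi-periodic in x2.\<close>
definition Omega :: "(real \<times> real) set" where
  "Omega = {0..1} \<times> UNIV"

definition Omega_minus :: "(real \<Rightarrow> real) \<Rightarrow> (real \<times> real) set" where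
  "Omega_minus xs = {x \<in> Omega. fst x < xs (snd x)}"

definition Omega_plus :: "(real \<Rightarrow> real) \<Rightarrow> (real \<times> real) set" where
  "Omega_plus xs = {x \<in> Omega. fst x > xs (snd x)}"

text \<open>C^2 on a (relatively open) set S, derivatives taken within S (up to the parts of the
  boundary of Omega that belong to S), with continuous second derivative.\<close>
definition C2_on :: "(real \<times> real) set \<Rightarrow> (real \<times> real \<Rightarrow> real) \<Rightarrow> bool" where
  "C2_on S f \<longleftrightarrow> (\<exists>Df D2f.
      (\<forall>x\<in>S. (f has_derivative blinfun_apply (Df x)) (at x within S)) \<and>
      (\<forall>x\<in>S. (Df has_derivative blinfun_apply (D2f x)) (at x within S)) \<and>
      continuous_on S D2f)"

text \<open>Gradient in the orthonormal frame, given coordinate partials g = (d1 phi, d2 phi).\<close>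
definition gradON :: "(real \<Rightarrow> real) \<Rightarrow> real \<Rightarrow> real \<times> real \<Rightarrow> real \<times> real" where
  "gradON n x1 g = (fst g, snd g / n x1)"

definition speed :: "(real \<Rightarrow> real) \<Rightarrow> real \<Rightarrow> real \<times> real \<Rightarrow> real" where
  "speed n x1 g = sqrt ((fst g)^2 + (snd g)^2 / (n x1)^2)"

text \<open>Unit normal of S = {x1 = xs(x2)} at (xs x2, x2), in the orthonormal frame.\<close>
definition shock_normal :: "(real \<Rightarrow> real) \<Rightarrow> (real \<Rightarrow> real) \<Rightarrow> real \<Rightarrow> real \<times> real" where
  "shock_normal n xs x2 =
     (let v = (1, - deriv xs x2 / n (xs x2)) in (1 / norm v) *\<^sub>R v)"

definition transonic_shock_solution ::
  "real \<Rightarrow> real \<Rightarrow> real \<Rightarrow> (real \<Rightarrow> real) \<Rightarrow> real \<Rightarrow>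
   (real \<times> real \<Rightarrow> real) \<Rightarrow> (real \<Rightarrow> real) \<Rightarrow> bool" where
  "transonic_shock_solution \<gamma> c0 u0 n c1 \<phi> xs \<longleftrightarrow>
    \<comment> \<open>shock curve: C^1, 2pi-periodic, values in (0,1)\<close>
    xs C1_differentiable_on UNIV \<and>
    (\<forall>t. xs (t + 2 * pi) = xs t) \<and>
    (\<forall>t. 0 < xs t \<and> xs t < 1) \<and>
    \<comment> \<open>phi is a function on [0,1] x S^1\<close>
    (\<forall>x1 x2. \<phi> (x1, x2 + 2 * pi) = \<phi> (x1, x2)) \<and>
    \<comment> \<open>phi in C^{0,1}(Omega) cap C^2(Omega^- cup Omega^+)\<close>
    (\<exists>L. L-lipschitz_on Omega \<phi>) \<and>
    C2_on (Omega_minus xs) \<phi> \<and> C2_on (Omega_plus xs) \<phi> \<and>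
    (\<exists>G :: real \<times> real \<Rightarrow> real \<times> real.
      \<comment> \<open>G x = (d1 phi x, d2 phi x)\<close>
      (\<forall>x\<in>Omega_minus xs. (\<phi> has_derivative (\<lambda>h. fst (G x) * fst h + snd (G x) * snd h))
                              (at x within Omega_minus xs)) \<and>
      (\<forall>x\<in>Omega_plus xs. (\<phi> has_derivative (\<lambda>h. fst (G x) * fst h + snd (G x) * snd h))
                              (at x within Omega_plus xs)) \<and>
      \<comment> \<open>supersonic in Omega^- (within the range where rho is defined), subsonic in Omega^+\<close>
      (\<forall>x\<in>Omega_minus xs. cstar \<gamma> c0 < speed n (fst x) (G x) \<and>
                            speed n (fst x) (G x) < qmax \<gamma> c0) \<and>
      (\<forall>x\<in>Omega_plus xs. speed n (fst x) (G x) < cstar \<gamma> c0) \<and>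
      \<comment> \<open>the potential flow equation in Omega^- cup Omega^+\<close>
      (\<forall>x\<in>Omega_minus xs \<union> Omega_plus xs. 0 < fst x \<and> fst x < 1 \<longrightarrow>
         (\<exists>d1 d2.
           ((\<lambda>t. n t * rho \<gamma> c0 (speed n t (G (t, snd x))) * fst (G (t, snd x)))
               has_real_derivative d1) (at (fst x)) \<and>
           ((\<lambda>s. rho \<gamma> c0 (speed n (fst x) (G (fst x, s))) / n (fst x) * snd (G (fst x, s)))
               has_real_derivative d2) (at (snd x)) \<and>
           (d1 + d2) / n (fst x) = 0)) \<and>
      \<comment> \<open>boundary conditions\<close>
      (\<forall>x2. G (0, x2) = (u0, 0)) \<and>
      (\<forall>x2. speed n 1 (G (1, x2)) = c1) \<and>
      \<comment> \<open>assumption d1 phi >= 0 on the boundary of Omega\<close>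
      (\<forall>x2. fst (G (0, x2)) \<ge> 0 \<and> fst (G (1, x2)) \<ge> 0) \<and>
      \<comment> \<open>Rankine-Hugoniot conditions on S, with one-sided limits of the gradient\<close>
      (\<forall>x2. \<exists>gm gp.
         (G \<longlongrightarrow> gm) (at (xs x2, x2) within Omega_minus xs) \<and>
         (G \<longlongrightarrow> gp) (at (xs x2, x2) within Omega_plus xs) \<and>
         (rho \<gamma> c0 (speed n (xs x2) gm) *\<^sub>R gradON n (xs x2) gm
            - rho \<gamma> c0 (speed n (xs x2) gp) *\<^sub>R gradON n (xs x2) gp) \<bullet> shock_normal n xs x2 = 0 \<and>
         (speed n (xs x2) gm)^2 / 2 + csq \<gamma> c0 (speed n (xs x2) gm) / (\<gamma> - 1)
           = (speed n (xs x2) gp)^2 / 2 + csq \<gamma> c0 (speed n (xs x2) gp) / (\<gamma> - 1)))"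

definition background_solution ::
  "real \<Rightarrow> real \<Rightarrow> real \<Rightarrow> (real \<Rightarrow> real) \<Rightarrow> real \<Rightarrow> (real \<Rightarrow> real) \<Rightarrow> bool" where
  "background_solution \<gamma> c0 u0 n xb \<psi> \<longleftrightarrow>
    continuous_on {0..1} \<psi> \<and>
    (\<exists>u um up.
      (\<forall>x\<in>{0..1} - {xb}. (\<psi> has_real_derivative u x) (at x within {0..1})) \<and>
      u 0 = u0 \<and>
      (\<forall>x\<in>{0..<xb}. cstar \<gamma> c0 < \<bar>u x\<bar> \<and> \<bar>u x\<bar> < qmax \<gamma> c0) \<and>
      (\<forall>x\<in>{xb<..1}. \<bar>u x\<bar> < cstar \<gamma> c0) \<and>
      (\<forall>x\<in>{0<..<xb}. (u has_real_derivative
          (deriv n x / n x * (csq \<gamma> c0 (u x) * u x / ((u x)^2 - csq \<gamma> c0 (u x))))) (at x)) \<and>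
      (\<forall>x\<in>{xb<..1}. (u has_real_derivative
          (deriv n x / n x * (csq \<gamma> c0 (u x) * u x / ((u x)^2 - csq \<gamma> c0 (u x)))))
          (at x within {xb<..1})) \<and>
      (u \<longlongrightarrow> um) (at_left xb) \<and>
      (u \<longlongrightarrow> up) (at_right xb) \<and>
      \<bar>up\<bar> < cstar \<gamma> c0 \<and>
      rho \<gamma> c0 up * up = rho \<gamma> c0 um * um)"

end

theory Submission
  imports Defs
begin

text \<open>Upstream, the difference between the solution and the background flow satisfies, because the
  second derivatives are bounded on compact sets, a linear differential inequality along the
  characteristics of the background flow; hence the two flows agree at every point whose backward
  characteristic cone does not meet the shock. A shock point that is the apex of such a cone has a
  known upstream velocity, and the jump conditions with a downstream speed at most sonic force the
  shock to be strictly flatter there than the characteristics. If some backward cone left the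
  upstream region, a minimum argument would produce a shock point contradicting this, so the
  upstream flow is the background flow.

  Downstream, the mass flux of the background flow is the same vector field on the supersonic and on
  the subsonic branch, wherever the shock is placed. So the difference between the mass flux of the
  solution and that of the subsonic background flow is divergence free and has vanishing normal
  component on the shock. Testing it with functions of the difference of the potentials and using
  the monotonicity of the flux below the sonic speed gives first \<open>c1 = u1\<close> and then that the
  two flows agree. No regularity of the shock beyond \<open>C\<^sup>1\<close> is needed for this. Finally the two
  background potentials differ by a strictly increasing function of \<open>x\<^sup>1\<close>, so continuity of the
  potential makes the shock straight.\<close>

section \<open>Polytropic gas\<close>

text \<open>The exit condition prescribes a speed, neither a flux nor a direction, so the boundary
  term of the downstream energy identity has no sign at first. This is why \<open>c1\<close> must be
  found before the flows can be compared. Constant test functions give zero total flux difference at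
  the exit, hence \<open>usub 1 \<le> c1\<close>. The opposite inequality needs a truncated test
  function, and there the sign of the axial velocity at the exit decides between \<open>c1\<close>
  and \<open>- c1\<close>. Upstream the difficulty is a circle: the flow is known only in cones that
  avoid the shock, and the shock is known to be flat only where the flow in front of it is known.
  The minimum argument breaks the circle because the cone condition holds automatically at a
  minimiser. On either side the second derivatives are merely continuous in the region, without a
  bound up to the shock. Hence the cones have their apex strictly before the shock, and the
  divergence theorem is applied above curves strictly behind it.\<close>

lemma monotone_branch_inverse:
  fixes f f' :: "real \<Rightarrow> real"
  assumes ab: "a < b" and cont: "continuous_on {a..b} f"
    and der: "\<And>q. a < q \<Longrightarrow> q < b \<Longrightarrow> (f has_real_derivative f' q) (at q)"
    and pos: "\<And>q. a < q \<Longrightarrow> q < b \<Longrightarrow> f' q > 0"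
  shows "\<exists>g. \<forall>v. f a < v \<and> v < f b \<longrightarrow> a < g v \<and> g v < b \<and> f (g v) = v \<and>
           (g has_real_derivative inverse (f' (g v))) (at v)"
proof -
  have mono: "f x < f y" if "a \<le> x" "x < y" "y \<le> b" for x y
  proof (rule DERIV_pos_imp_increasing_open[OF \<open>x < y\<close>])
    show "\<exists>d. (f has_real_derivative d) (at z) \<and> 0 < d" if "x < z" "z < y" for z
      using der[of z] pos[of z] that \<open>a \<le> x\<close> \<open>y \<le> b\<close> by auto
  qed (use that in \<open>auto intro: continuous_on_subset[OF cont]\<close>)
  define g where "g v = (SOME q. a < q \<and> q < b \<and> f q = v)" for v
  have g: "a < g v \<and> g v < b \<and> f (g v) = v" if v: "f a < v" "v < f b" for v
  proof -
    obtain q where q: "a \<le> q" "q \<le> b" "f q = v"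
      using IVT'[of f a v b] v ab cont by auto
    with v have "a < q \<and> q < b \<and> f q = v"
      by (metis order_le_less order_less_irrefl)
    then show ?thesis unfolding g_def by (rule someI)
  qed
  \<comment> \<open>The derivative may vanish or fail to exist at \<open>a\<close> and
    \<open>b\<close> (the mass flux is critical at the sonic speed), so continuity of the inverse is
    taken from compactness of the closed interval. For this purpose \<open>h\<close> adds the two
    endpoint values to \<open>g\<close>.\<close>
  define h where "h v = (if v = f a then a else if v = f b then b else g v)" for v
  have inj: "x = y" if "x \<in> {a..b}" "y \<in> {a..b}" "f x = f y" for x y
    using mono[of x y] mono[of y x] that by (cases x y rule: linorder_cases) auto
  have h: "h (f x) = x" if x: "x \<in> {a..b}" for x
  proof (cases "x = a \<or> x = b")
    case True
    with mono[of a b] ab show ?thesis by (auto simp: h_def)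
  next
    case False
    with x have "f a < f x" "f x < f b" by (auto intro!: mono)
    with g[of "f x"] inj[of "g (f x)" x] x show ?thesis by (auto simp: h_def)
  qed
  have "continuous_on (f ` {a..b}) h"
    by (rule continuous_on_inv[OF cont]) (auto simp: h)
  moreover have "{f a<..<f b} \<subseteq> f ` {a..b}"
  proof
    fix v assume "v \<in> {f a<..<f b}"
    then show "v \<in> f ` {a..b}" using g[of v] by (intro image_eqI[of v f "g v"]) auto
  qed
  ultimately have "continuous_on {f a<..<f b} h"
    using continuous_on_subset by blast
  then have cg: "continuous_on {f a<..<f b} g"
    by (rule continuous_on_eq) (auto simp: h_def)
  have "(g has_real_derivative inverse (f' (g v))) (at v)" if v: "f a < v" "v < f b" for v
  proof (rule DERIV_inverse_function[of f])
    show "(f has_real_derivative f' (g v)) (at (g v))" using g[OF v] der by auto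
    show "f' (g v) \<noteq> 0" using g[OF v] pos[of "g v"] by auto
    show "isCont g v"
      using cg v by (auto simp: continuous_on_eq_continuous_at)
  qed (use v g in auto)
  with g show ?thesis by (intro exI[of _ g]) auto
qed

text \<open>\<open>ssq\<close> and \<open>dens\<close> are the squared sound speed and the density as functions of the squared flow
  speed; unlike \<open>rho\<close>, they are differentiable along flows without a case distinction at speed 0.\<close>

locale polytropic_gas =
  fixes \<gamma> c0 :: real
  assumes gamma: "\<gamma> > 1" and c0: "c0 > 0"
begin

definition ssq :: "real \<Rightarrow> real" where
  "ssq e = c0\<^sup>2 - (\<gamma> - 1) / 2 * e"

definition dens :: "real \<Rightarrow> real" where
  "dens e = (1 / \<gamma> * ssq e) powr (1 / (\<gamma> - 1))"

abbreviation "cs \<equiv> cstar \<gamma> c0"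
abbreviation "qm \<equiv> qmax \<gamma> c0"

definition mflux :: "real \<Rightarrow> real" where
  "mflux q = dens (q\<^sup>2) * q"

lemma rho_eq: "rho \<gamma> c0 q = dens (q\<^sup>2)"
  by (simp add: rho_def dens_def ssq_def)

lemma csq_eq: "csq \<gamma> c0 q = ssq (q\<^sup>2)"
  by (simp add: csq_def ssq_def)

lemma cs_pos: "0 < cs" and qm_pos: "0 < qm"
  using gamma c0 by (auto simp: cstar_def qmax_def)

lemma cs_sq: "cs\<^sup>2 = 2 * c0\<^sup>2 / (\<gamma> + 1)" and qm_sq: "qm\<^sup>2 = 2 * c0\<^sup>2 / (\<gamma> - 1)"
  using gamma c0 by (auto simp: cstar_def qmax_def)

lemma cs_less_qm: "cs < qm"
  using gamma c0 by (auto simp: cstar_def qmax_def intro!: divide_strict_left_mono mult_pos_pos)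

lemma ssq_pos_iff: "0 < ssq e \<longleftrightarrow> e < qm\<^sup>2"
  using gamma by (auto simp: ssq_def qm_sq field_simps)

text \<open>Origin of \<open>cstar\<close>: squared speed and squared sound speed coincide exactly
  at \<open>cs\<^sup>2\<close>, so comparing a speed with the fixed number \<open>cs\<close> amounts
  to comparing it with the local speed of sound.\<close>

lemma less_ssq_iff: "e < ssq e \<longleftrightarrow> e < cs\<^sup>2"
  using gamma by (auto simp: ssq_def cs_sq field_simps)

lemma ssq_less_iff: "ssq e < e \<longleftrightarrow> cs\<^sup>2 < e"
  using gamma by (auto simp: ssq_def cs_sq field_simps)

lemma ssq_antimono: "a \<le> b \<Longrightarrow> ssq b \<le> ssq a"
  using gamma by (auto simp: ssq_def intro!: mult_left_mono)

lemma dens_pos: "e < qm\<^sup>2 \<Longrightarrow> 0 < dens e"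
  using ssq_pos_iff[of e] gamma by (simp add: dens_def)

lemma dens_nonneg: "0 \<le> dens e"
  by (simp add: dens_def)

lemma dens_antimono:
  assumes "a \<le> b" "b < qm\<^sup>2" shows "dens b \<le> dens a"
  unfolding dens_def
  using assms ssq_pos_iff[of b] gamma ssq_antimono[of a b]
  by (intro powr_mono2) (auto intro: divide_right_mono)

lemma dens_deriv:
  assumes "e < qm\<^sup>2"
  shows "(dens has_real_derivative - dens e / (2 * ssq e)) (at e)"
proof -
  have s: "0 < ssq e" using assms ssq_pos_iff by simp
  have d: "((\<lambda>e. 1 / \<gamma> * ssq e) has_real_derivative (- (\<gamma> - 1) / (2 * \<gamma>))) (at e)"
    unfolding ssq_def using gamma by (auto intro!: derivative_eq_intros simp: field_simps)
  have "((\<lambda>e. (1 / \<gamma> * ssq e) powr (1 / (\<gamma> - 1))) has_real_derivative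
     (1 / (\<gamma> - 1)) * (1 / \<gamma> * ssq e) powr (1 / (\<gamma> - 1) - 1) * (- (\<gamma> - 1) / (2 * \<gamma>))) (at e)"
    using DERIV_chain2[OF has_real_derivative_powr[of "1 / \<gamma> * ssq e" "1 / (\<gamma> - 1)"] d] s gamma
    by simp
  also have "(1 / (\<gamma> - 1)) * (1 / \<gamma> * ssq e) powr (1 / (\<gamma> - 1) - 1) * (- (\<gamma> - 1) / (2 * \<gamma>))
     = - dens e / (2 * ssq e)"
  proof -
    have "(1 / \<gamma> * ssq e) powr (1 / (\<gamma> - 1) - 1) = dens e / (1 / \<gamma> * ssq e)"
      using s gamma by (simp add: dens_def powr_diff del: times_divide_eq_left)
    then show ?thesis using s gamma by (simp add: field_simps)
  qed
  finally show ?thesis by (simp add: dens_def[abs_def])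
qed

text \<open>The quotient is the squared Mach number. It decides the sign, so the flux density rises
  up to \<open>cs\<close> and falls beyond it; this is the reason for two branches.\<close>

lemma mflux_deriv:
  assumes "\<bar>q\<bar> < qm"
  shows "(mflux has_real_derivative dens (q\<^sup>2) * (1 - q\<^sup>2 / ssq (q\<^sup>2))) (at q)"
proof -
  have q: "q\<^sup>2 < qm\<^sup>2" using assms abs_le_square_iff[of qm q] qm_pos by force
  have "((\<lambda>q. dens (q\<^sup>2)) has_real_derivative - dens (q\<^sup>2) / (2 * ssq (q\<^sup>2)) * (2 * q)) (at q)"
    by (rule DERIV_chain2[where f = dens and g = "\<lambda>q. q\<^sup>2", OF dens_deriv[OF q]]) (auto intro!: derivative_eq_intros)
  then have "((\<lambda>q. dens (q\<^sup>2) * q) has_real_derivative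
       - dens (q\<^sup>2) / (2 * ssq (q\<^sup>2)) * (2 * q) * q + dens (q\<^sup>2)) (at q)"
    by (auto intro!: derivative_eq_intros)
  moreover have "- dens (q\<^sup>2) / (2 * ssq (q\<^sup>2)) * (2 * q) * q + dens (q\<^sup>2) = dens (q\<^sup>2) * (1 - q\<^sup>2 / ssq (q\<^sup>2))"
    using ssq_pos_iff[of "q\<^sup>2"] q by (simp add: field_simps power2_eq_square)
  ultimately show ?thesis unfolding mflux_def[abs_def] by simp
qed

text \<open>The endpoint \<open>qm\<close> is the vacuum speed, where \<open>ssq\<close> vanishes
  and \<open>dens\<close> need not be differentiable. Continuity survives since the exponent
  \<open>1 / (\<gamma> - 1)\<close> is positive, and strict monotonicity on the closed supersonic
  range rests on it.\<close>

lemma mflux_cont: "continuous_on {-qm..qm} mflux"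
proof -
  have "continuous_on {-qm..qm} (\<lambda>q. (1 / \<gamma> * ssq (q\<^sup>2)) powr (1 / (\<gamma> - 1)) * q)"
  proof (intro continuous_on_mult continuous_on_powr' continuous_on_const continuous_on_id)
    show "continuous_on {-qm..qm} (\<lambda>q. ssq (q\<^sup>2))"
      unfolding ssq_def by (intro continuous_intros)
    have "0 \<le> ssq (q\<^sup>2)" if "q \<in> {-qm..qm}" for q
    proof -
      have "q\<^sup>2 \<le> qm\<^sup>2" using that by (auto simp: abs_le_square_iff[symmetric])
      then show ?thesis using gamma by (simp add: ssq_def qm_sq field_simps)
    qed
    then show "\<forall>x\<in>{-qm..qm}. 0 \<le> 1 / \<gamma> * ssq (x\<^sup>2) \<and> (1 / \<gamma> * ssq (x\<^sup>2) = 0 \<longrightarrow> 0 < 1 / (\<gamma> - 1))"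
      using gamma by auto
  qed
  then show ?thesis by (simp add: mflux_def[abs_def] dens_def)
qed

lemma mflux_qm: "mflux qm = 0"
  using gamma by (simp add: mflux_def dens_def ssq_def qm_sq)

lemma mflux_deriv_pos:
  assumes "\<bar>q\<bar> < cs" shows "0 < dens (q\<^sup>2) * (1 - q\<^sup>2 / ssq (q\<^sup>2))"
proof -
  have q: "q\<^sup>2 < cs\<^sup>2" using assms abs_le_square_iff[of cs q] cs_pos by force
  have "cs\<^sup>2 < qm\<^sup>2" using cs_less_qm cs_pos by (simp add: power_strict_mono)
  with q less_ssq_iff[of "q\<^sup>2"] dens_pos[of "q\<^sup>2"] ssq_pos_iff[of "q\<^sup>2"] show ?thesis
    by (intro mult_pos_pos) (auto simp: field_simps)
qed

lemma mflux_deriv_neg: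
  assumes "cs < q" "q < qm" shows "dens (q\<^sup>2) * (1 - q\<^sup>2 / ssq (q\<^sup>2)) < 0"
proof -
  have q: "cs\<^sup>2 < q\<^sup>2" "q\<^sup>2 < qm\<^sup>2" using assms cs_pos by (auto intro!: power_strict_mono)
  with ssq_less_iff[of "q\<^sup>2"] dens_pos[of "q\<^sup>2"] ssq_pos_iff[of "q\<^sup>2"] show ?thesis
    by (intro mult_pos_neg) (auto simp: field_simps)
qed

lemma mflux_strict_mono:
  assumes "0 \<le> a" "a < b" "b \<le> cs" shows "mflux a < mflux b"
proof (rule DERIV_pos_imp_increasing_open[OF \<open>a < b\<close>])
  show "continuous_on {a..b} mflux"
    using assms cs_less_qm qm_pos by (intro continuous_on_subset[OF mflux_cont]) auto
qed (use assms cs_less_qm mflux_deriv mflux_deriv_pos in force)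

lemma mflux_strict_antimono:
  assumes "cs \<le> a" "a < b" "b \<le> qm" shows "mflux b < mflux a"
proof (rule DERIV_neg_imp_decreasing_open[OF \<open>a < b\<close>])
  show "continuous_on {a..b} mflux"
    using assms cs_pos qm_pos by (intro continuous_on_subset[OF mflux_cont]) auto
  show "\<exists>y. (mflux has_real_derivative y) (at x) \<and> y < 0" if "a < x" "x < b" for x
    using that assms cs_pos
    by (intro exI[of _ "dens (x\<^sup>2) * (1 - x\<^sup>2 / ssq (x\<^sup>2))"] conjI mflux_deriv mflux_deriv_neg) auto
qed

lemma subsonic_inverse:
  "\<exists>g. \<forall>v. 0 < v \<and> v < mflux cs \<longrightarrow> 0 < g v \<and> g v < cs \<and> mflux (g v) = v \<and>
     (g has_real_derivative inverse (dens ((g v)\<^sup>2) * (1 - (g v)\<^sup>2 / ssq ((g v)\<^sup>2)))) (at v)"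
proof -
  have "mflux 0 = 0" by (simp add: mflux_def)
  moreover have "continuous_on {0..cs} mflux"
    using cs_less_qm qm_pos by (intro continuous_on_subset[OF mflux_cont]) auto
  ultimately show ?thesis
    using monotone_branch_inverse[of 0 cs mflux "\<lambda>q. dens (q\<^sup>2) * (1 - q\<^sup>2 / ssq (q\<^sup>2))"]
      cs_pos cs_less_qm mflux_deriv mflux_deriv_pos by simp
qed

text \<open>\<open>monotone_branch_inverse\<close> wants an increasing function, whereas
  \<open>mflux\<close> decreases to 0 at \<open>qm\<close>. It is therefore applied to
  \<open>- mflux\<close>, and the argument of the inverse is reflected.\<close>

lemma supersonic_inverse:
  "\<exists>g. \<forall>v. 0 < v \<and> v < mflux cs \<longrightarrow> cs < g v \<and> g v < qm \<and> mflux (g v) = v \<and>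
     (g has_real_derivative inverse (dens ((g v)\<^sup>2) * (1 - (g v)\<^sup>2 / ssq ((g v)\<^sup>2)))) (at v)"
proof -
  let ?d = "\<lambda>q. dens (q\<^sup>2) * (1 - q\<^sup>2 / ssq (q\<^sup>2))"
  have "continuous_on {cs..qm} (\<lambda>q. - mflux q)"
    using cs_pos qm_pos by (intro continuous_intros continuous_on_subset[OF mflux_cont]) auto
  moreover have "((\<lambda>q. - mflux q) has_real_derivative - ?d q) (at q)" if "cs < q" "q < qm" for q
    using mflux_deriv[of q] that cs_pos by (intro DERIV_minus) auto
  ultimately obtain g where g: "\<And>v. - mflux cs < v \<Longrightarrow> v < 0 \<Longrightarrow> cs < g v \<and> g v < qm \<and> - mflux (g v) = v \<and>
     (g has_real_derivative inverse (- ?d (g v))) (at v)"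
    using monotone_branch_inverse[of cs qm "\<lambda>q. - mflux q" "\<lambda>q. - ?d q"]
      cs_less_qm mflux_deriv_neg by (fastforce simp: mflux_qm)
  show ?thesis
  proof (intro exI[of _ "\<lambda>v. g (-v)"] allI impI conjI)
    fix v assume v: "0 < v \<and> v < mflux cs"
    note gv = g[of "-v"]
    show "cs < g (-v)" "g (-v) < qm" "mflux (g (-v)) = v" using gv v by auto
    have "((\<lambda>v. g (-v)) has_real_derivative inverse (- ?d (g (-v))) * (-1)) (at v)"
      by (rule DERIV_chain2[of g]) (use gv v in \<open>auto intro!: derivative_eq_intros\<close>)
    then show "((\<lambda>v. g (-v)) has_real_derivative inverse (?d (g (-v)))) (at v)"
      by (metis (no_types, lifting) inverse_minus_eq minus_mult_minus mult.right_neutral)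
  qed
qed

end

section \<open>The two branches of the background flow\<close>

locale nozzle_flow = polytropic_gas +
  fixes u0 :: real and n :: "real \<Rightarrow> real"
  assumes u0: "cstar \<gamma> c0 < u0" "u0 < qmax \<gamma> c0"
    and n_pos: "\<And>x. x \<in> {0..1} \<Longrightarrow> n x > 0"
    and n_smooth: "smooth_on_01 n"
    and unchoked: "rho \<gamma> c0 u0 * u0 * n 0 < rho \<gamma> c0 (cstar \<gamma> c0) * cstar \<gamma> c0 * (INF x\<in>{0..1}. n x)"
begin

text \<open>The conserved mass flux per unit angle. Both branches carry it at every
  \<open>x\<close>, which is what makes the downstream comparison independent of the position of the
  shock.\<close>

definition j :: real where
  "j = n 0 * mflux u0"

text \<open>The branch is obtained by inverting the conserved flux, not by solving the differential
  equation, so existence on all of [0,1] is immediate. The whole inverse function is chosen, not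
  just one value, so that its derivative is available.\<close>

definition usub :: "real \<Rightarrow> real" where
  "usub x = (SOME g. \<forall>v. 0 < v \<and> v < mflux cs \<longrightarrow> 0 < g v \<and> g v < cs \<and> mflux (g v) = v \<and>
     (g has_real_derivative inverse (dens ((g v)\<^sup>2) * (1 - (g v)\<^sup>2 / ssq ((g v)\<^sup>2)))) (at v)) (j / n x)"

definition usup :: "real \<Rightarrow> real" where
  "usup x = (SOME g. \<forall>v. 0 < v \<and> v < mflux cs \<longrightarrow> cs < g v \<and> g v < qm \<and> mflux (g v) = v \<and>
     (g has_real_derivative inverse (dens ((g v)\<^sup>2) * (1 - (g v)\<^sup>2 / ssq ((g v)\<^sup>2)))) (at v)) (j / n x)"

definition ode_rhs :: "real \<Rightarrow> real \<Rightarrow> real" where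
  "ode_rhs x q = deriv n x / n x * (csq \<gamma> c0 q * q / (q\<^sup>2 - csq \<gamma> c0 q))"

lemma n_deriv: "x \<in> {0..1} \<Longrightarrow> (n has_real_derivative deriv n x) (at x)"
  using n_smooth[unfolded smooth_on_01_def, rule_format, of x 0]
  by (simp add: DERIV_deriv_iff_real_differentiable)

lemma deriv_n_cont: "continuous_on {0..1} (deriv n)"
  using n_smooth[unfolded smooth_on_01_def, rule_format, of _ 1]
  by (intro continuous_at_imp_continuous_on) (auto intro: differentiable_imp_continuous_within)

lemma n_cont: "continuous_on {0..1} n"
  using n_deriv DERIV_isCont by (intro continuous_at_imp_continuous_on) blast

lemma j_pos: "0 < j"
  using u0 cs_pos n_pos[of 0] dens_pos[of "u0\<^sup>2"] power_strict_mono[of u0 qm 2]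
  by (auto simp: j_def mflux_def intro!: mult_pos_pos)

text \<open>\<open>mflux cs\<close> is the largest possible flux density. The standing assumption
  says that the nozzle is not choked at its narrowest section, so both branches exist along its full
  length.\<close>

lemma flux_bounds:
  assumes "x \<in> {0..1}" shows "0 < j / n x" "j / n x < mflux cs"
proof -
  have m: "0 < mflux cs"
    using mflux_strict_mono[of 0 cs] cs_pos by (simp add: mflux_def)
  have "bdd_below (n ` {0..1})"
    using compact_imp_bounded[OF compact_continuous_image[OF n_cont]] bounded_imp_bdd_below by auto
  then have "(INF x\<in>{0..1}. n x) \<le> n x" using assms by (rule cINF_lower)
  then have "mflux cs * (INF x\<in>{0..1}. n x) \<le> mflux cs * n x"
    using m by (intro mult_left_mono) auto
  moreover have "j < mflux cs * (INF x\<in>{0..1}. n x)"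
    using unchoked unfolding j_def mflux_def rho_eq by (simp only: mult_ac)
  ultimately show "j / n x < mflux cs" using n_pos[OF assms] by (simp add: field_simps)
  show "0 < j / n x" using j_pos n_pos[OF assms] by simp
qed

text \<open>Differentiating the conserved flux recovers the background equation: the derivative of
  the inverse contributes the factor with the Mach number, and substituting
  \<open>j = D * Q * n x\<close> cancels the density.\<close>

lemma branch_ode:
  assumes x: "x \<in> {0..1}"
    and g: "(g has_real_derivative inverse (dens ((g v)\<^sup>2) * (1 - (g v)\<^sup>2 / ssq ((g v)\<^sup>2)))) (at v)"
    and v: "v = j / n x" "mflux (g v) = v"
    and q: "(g v)\<^sup>2 < qm\<^sup>2" "(g v)\<^sup>2 \<noteq> ssq ((g v)\<^sup>2)"
  shows "((\<lambda>x. g (j / n x)) has_real_derivative ode_rhs x (g v)) (at x within {0..1})"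
proof -
  have nx: "0 < n x" using n_pos x by simp
  have "((\<lambda>x. j / n x) has_real_derivative - (j * deriv n x) / (n x)\<^sup>2) (at x within {0..1})"
    using nx by (auto intro!: derivative_eq_intros has_field_derivative_at_within[OF n_deriv[OF x]]
        simp: power2_eq_square)
  then have "((\<lambda>x. g (j / n x)) has_real_derivative
     inverse (dens ((g v)\<^sup>2) * (1 - (g v)\<^sup>2 / ssq ((g v)\<^sup>2))) * (- (j * deriv n x) / (n x)\<^sup>2)) (at x within {0..1})"
    by (rule DERIV_chain2[of g, rotated]) (use g v(1) in simp)
  moreover have "inverse (dens ((g v)\<^sup>2) * (1 - (g v)\<^sup>2 / ssq ((g v)\<^sup>2))) * (- (j * deriv n x) / (n x)\<^sup>2)
      = ode_rhs x (g v)"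
  proof -
    define D S Q where "D = dens ((g v)\<^sup>2)" and "S = ssq ((g v)\<^sup>2)" and "Q = g v"
    have pos: "0 < D" "0 < S" "Q\<^sup>2 \<noteq> S"
      using dens_pos[of "(g v)\<^sup>2"] ssq_pos_iff[of "(g v)\<^sup>2"] q by (auto simp: D_def S_def Q_def)
    have jj: "j = D * Q * n x"
    proof -
      have "D * Q = j / n x" using v by (simp add: mflux_def D_def Q_def)
      then show ?thesis using nx by simp
    qed
    have "inverse (D * (1 - Q\<^sup>2 / S)) * (- (j * deriv n x) / (n x)\<^sup>2) = deriv n x / n x * (S * Q / (Q\<^sup>2 - S))"
    proof -
      have "D * (1 - Q\<^sup>2 / S) = - (D * (Q\<^sup>2 - S) / S)" using pos by (simp add: field_simps)
      then have i1: "inverse (D * (1 - Q\<^sup>2 / S)) = - (S / (D * (Q\<^sup>2 - S)))" by simp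
      have i2: "- (j * deriv n x) / (n x)\<^sup>2 = - (D * Q * deriv n x / n x)"
        using nx by (simp add: jj power2_eq_square)
      have "- (S / (D * E)) * - (D * Q * d / m) = d / m * (S * Q / E)" if "E \<noteq> 0" "m \<noteq> 0" for E d m
        using that pos by (simp add: mult_ac)
      from this[of "Q\<^sup>2 - S" "n x" "deriv n x"]
      have i3: "- (S / (D * (Q\<^sup>2 - S))) * - (D * Q * deriv n x / n x) = deriv n x / n x * (S * Q / (Q\<^sup>2 - S))"
        using pos nx by force
      show ?thesis unfolding i1 i2 by (rule i3)
    qed
    then have "inverse (dens ((g v)\<^sup>2) * (1 - (g v)\<^sup>2 / ssq ((g v)\<^sup>2))) * (- (j * deriv n x) / (n x)\<^sup>2) = deriv n x / n x * (ssq ((g v)\<^sup>2) * g v / ((g v)\<^sup>2 - ssq ((g v)\<^sup>2)))" by (simp only: D_def S_def Q_def)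
 then show ?thesis by (simp only: ode_rhs_def csq_eq)

  qed
  ultimately show ?thesis by (simp only:)
qed

lemma usub:
  assumes x: "x \<in> {0..1}"
  shows "0 < usub x" "usub x < cs" "n x * mflux (usub x) = j"
    "(usub has_real_derivative ode_rhs x (usub x)) (at x within {0..1})"
proof -
  obtain g where gx: "\<And>x. usub x = g (j / n x)" and
    g: "\<And>v. 0 < v \<Longrightarrow> v < mflux cs \<Longrightarrow> 0 < g v \<and> g v < cs \<and> mflux (g v) = v \<and>
     (g has_real_derivative inverse (dens ((g v)\<^sup>2) * (1 - (g v)\<^sup>2 / ssq ((g v)\<^sup>2)))) (at v)"
    using someI_ex[OF subsonic_inverse] usub_def by blast
  note gj = g[OF flux_bounds[OF x]]
  show "0 < usub x" "usub x < cs" "n x * mflux (usub x) = j"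
    using gj n_pos[OF x] by (auto simp: gx)
  have sq: "(g (j / n x))\<^sup>2 < cs\<^sup>2" "(g (j / n x))\<^sup>2 < qm\<^sup>2"
    using gj cs_less_qm by (auto intro!: power_strict_mono)
  have "((\<lambda>x. g (j / n x)) has_real_derivative ode_rhs x (g (j / n x))) (at x within {0..1})"
    using sq less_ssq_iff[of "(g (j / n x))\<^sup>2"] gj by (intro branch_ode[OF x]) auto
  then show "(usub has_real_derivative ode_rhs x (usub x)) (at x within {0..1})"
    by (simp add: gx[abs_def])
qed

lemma usup:
  assumes x: "x \<in> {0..1}"
  shows "cs < usup x" "usup x < qm" "n x * mflux (usup x) = j"
    "(usup has_real_derivative ode_rhs x (usup x)) (at x within {0..1})"
proof -
  obtain g where gx: "\<And>x. usup x = g (j / n x)" and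
    g: "\<And>v. 0 < v \<Longrightarrow> v < mflux cs \<Longrightarrow> cs < g v \<and> g v < qm \<and> mflux (g v) = v \<and>
     (g has_real_derivative inverse (dens ((g v)\<^sup>2) * (1 - (g v)\<^sup>2 / ssq ((g v)\<^sup>2)))) (at v)"
    using someI_ex[OF supersonic_inverse] usup_def by blast
  note gj = g[OF flux_bounds[OF x]]
  show "cs < usup x" "usup x < qm" "n x * mflux (usup x) = j"
    using gj n_pos[OF x] by (auto simp: gx)
  have sq: "cs\<^sup>2 < (g (j / n x))\<^sup>2" "(g (j / n x))\<^sup>2 < qm\<^sup>2"
    using gj cs_pos by (auto intro!: power_strict_mono)
  have "((\<lambda>x. g (j / n x)) has_real_derivative ode_rhs x (g (j / n x))) (at x within {0..1})"
    using sq ssq_less_iff[of "(g (j / n x))\<^sup>2"] gj by (intro branch_ode[OF x]) auto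
  then show "(usup has_real_derivative ode_rhs x (usup x)) (at x within {0..1})"
    by (simp add: gx[abs_def])
qed

lemma mflux_inj_sub: "0 \<le> a \<Longrightarrow> a \<le> cs \<Longrightarrow> 0 \<le> b \<Longrightarrow> b \<le> cs \<Longrightarrow> mflux a = mflux b \<Longrightarrow> a = b"
  using mflux_strict_mono[of a b] mflux_strict_mono[of b a] by (cases a b rule: linorder_cases) auto

lemma mflux_inj_sup: "cs \<le> a \<Longrightarrow> a \<le> qm \<Longrightarrow> cs \<le> b \<Longrightarrow> b \<le> qm \<Longrightarrow> mflux a = mflux b \<Longrightarrow> a = b"
  using mflux_strict_antimono[of a b] mflux_strict_antimono[of b a] by (cases a b rule: linorder_cases) auto

lemma usup_0: "usup 0 = u0"
proof (rule mflux_inj_sup)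
  show "mflux (usup 0) = mflux u0" using usup(3)[of 0] n_pos[of 0] by (simp add: j_def)
qed (use usup(1,2)[of 0] u0 in auto)

lemma usub_less_usup: "x \<in> {0..1} \<Longrightarrow> usub x < usup x"
  by (rule order.strict_trans[OF usub(2) usup(1)])

lemma usub_cont: "continuous_on {0..1} usub" and usup_cont: "continuous_on {0..1} usup"
  by (rule DERIV_continuous_on, erule usub usup)+

text \<open>Along a branch the right-hand side is the second derivative of the background potential.
  Its denominator vanishes only at the sonic speed, which neither branch meets.\<close>

lemma ode_rhs_cont:
  assumes "continuous_on {0..1} u"
    "\<And>x. x \<in> {0..1} \<Longrightarrow> (u x)\<^sup>2 \<noteq> csq \<gamma> c0 (u x)"
  shows "continuous_on {0..1} (\<lambda>x. ode_rhs x (u x))"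
proof -
  have "\<forall>x\<in>{0..1}. n x \<noteq> 0" using n_pos by (metis less_irrefl)
  moreover have "\<forall>x\<in>{0..1}. (u x)\<^sup>2 - (c0\<^sup>2 - (\<gamma> - 1) / 2 * (u x)\<^sup>2) \<noteq> 0"
    using assms(2) unfolding csq_def by (metis eq_iff_diff_eq_0)
  ultimately show ?thesis
    unfolding ode_rhs_def csq_def
    by (intro continuous_on_mult continuous_on_divide continuous_on_diff continuous_on_power
        continuous_on_const deriv_n_cont n_cont assms(1))
qed

lemma usub_not_sonic: "x \<in> {0..1} \<Longrightarrow> (usub x)\<^sup>2 < csq \<gamma> c0 (usub x)"
  using usub(1,2)[of x] less_ssq_iff[of "(usub x)\<^sup>2"] by (auto simp: csq_eq intro!: power_strict_mono)

lemma usup_not_sonic: "x \<in> {0..1} \<Longrightarrow> csq \<gamma> c0 (usup x) < (usup x)\<^sup>2"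
  using usup(1,2)[of x] ssq_less_iff[of "(usup x)\<^sup>2"] cs_pos by (auto simp: csq_eq intro!: power_strict_mono)

lemma usub_deriv_cont: "continuous_on {0..1} (\<lambda>x. ode_rhs x (usub x))"
  using usub_not_sonic by (intro ode_rhs_cont usub_cont) fastforce

lemma usup_deriv_cont: "continuous_on {0..1} (\<lambda>x. ode_rhs x (usup x))"
  using usup_not_sonic by (intro ode_rhs_cont usup_cont) fastforce

definition Psub :: "real \<Rightarrow> real" where
  "Psub x = integral {0..x} usub"

definition Psup :: "real \<Rightarrow> real" where
  "Psup x = integral {0..x} usup"

lemma Psub_deriv: "x \<in> {0..1} \<Longrightarrow> (Psub has_real_derivative usub x) (at x within {0..1})"
  unfolding Psub_def[abs_def] by (rule integral_has_real_derivative[OF usub_cont])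

lemma Psup_deriv: "x \<in> {0..1} \<Longrightarrow> (Psup has_real_derivative usup x) (at x within {0..1})"
  unfolding Psup_def[abs_def] by (rule integral_has_real_derivative[OF usup_cont])

end

section \<open>Uniqueness on backward characteristic cones\<close>

text \<open>With \<open>K\<close> a primitive of the characteristic speed, the bounding curves are
  the two characteristics through \<open>(X, t)\<close>, so this is the domain of dependence of that
  point on the data at the entry.\<close>

definition backward_cone :: "(real \<Rightarrow> real) \<Rightarrow> real \<Rightarrow> real \<Rightarrow> (real \<times> real) set" where
  "backward_cone K X t = {z. 0 \<le> fst z \<and> fst z \<le> X \<and> \<bar>snd z - t\<bar> \<le> K X - K (fst z)}"

lemma mono_of_positive_derivative:
  fixes K k :: "real \<Rightarrow> real"
  assumes k_pos: "\<And>x. x \<in> {0..X} \<Longrightarrow> 0 < k x"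
    and K_der: "\<And>x. x \<in> {0..X} \<Longrightarrow> (K has_real_derivative k x) (at x within {0..X})"
    and xy: "0 \<le> x" "x < y" "y \<le> X"
  shows "K x < K y"
proof -
  have K_cont: "continuous_on {0..X} K"
    by (rule DERIV_continuous_on, erule K_der)
  have cont: "continuous_on {x..y} K"
    by (rule continuous_on_subset[OF K_cont]) (use xy in auto)
  have der: "(K has_derivative (\<lambda>h. k c * h)) (at c)" if "x < c" "c < y" for c
    using K_der[of c] that xy by (simp add: has_field_derivative_def at_within_Icc_at)
  from mvt[OF \<open>x < y\<close> cont der]
  obtain c where "x < c" "c < y" "K y - K x = k c * (y - x)" by blast
  with k_pos[of c] xy have "0 < K y - K x" by simp
  then show ?thesis by simp
qed

text \<open>Compactness supplies the constant \<open>B\<close> of the differential inequality: the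
  coefficients contain second derivatives of the flow, of which only continuity is known.\<close>

lemma compact_backward_cone:
  assumes K_cont: "continuous_on {0..X} K"
  shows "compact (backward_cone K X t)"
proof -
  have "bounded (K ` {0..X})"
    using compact_imp_bounded compact_continuous_image[OF K_cont] by blast
  then obtain b where b: "\<And>x. x \<in> {0..X} \<Longrightarrow> \<bar>K x\<bar> \<le> b"
    unfolding bounded_iff by (metis image_eqI real_norm_def)
  let ?Q = "{0..X} \<times> {t - 2 * b..t + 2 * b}"
  have "continuous_on ?Q (\<lambda>z. K (fst z))"
    by (rule continuous_on_compose2[OF K_cont]) (auto intro!: continuous_intros)
  then have "closed {z \<in> ?Q. \<bar>snd z - t\<bar> - (K X - K (fst z)) \<le> 0}"
    by (intro continuous_on_closed_Collect_le) (auto intro!: closed_Times continuous_intros)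
  moreover have "backward_cone K X t = {z \<in> ?Q. \<bar>snd z - t\<bar> - (K X - K (fst z)) \<le> 0}"
  proof (intro set_eqI iffI)
    fix z assume z: "z \<in> backward_cone K X t"
    then have "\<bar>K X\<bar> \<le> b" "\<bar>K (fst z)\<bar> \<le> b" by (auto intro!: b simp: backward_cone_def)
    moreover have "\<bar>snd z - t\<bar> \<le> K X - K (fst z)" using z by (simp add: backward_cone_def)
    ultimately have "\<bar>snd z - t\<bar> \<le> 2 * b" by linarith
    with z show "z \<in> {z \<in> ?Q. \<bar>snd z - t\<bar> - (K X - K (fst z)) \<le> 0}"
      by (auto simp: backward_cone_def mem_Times_iff abs_le_iff)
  qed (auto simp: backward_cone_def)
  moreover have "bounded ?Q" by (intro bounded_Times) auto
  ultimately show ?thesis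
    by (metis (no_types, lifting) bounded_subset compact_eq_bounded_closed mem_Collect_eq subsetI)
qed

text \<open>\<open>R d = V + d k W\<close> (\<open>d = \<plusminus>1\<close>) are the Riemann invariants. If one of them is not below
  \<open>e exp (L x)\<close>, consider a first point \<open>P\<close> where this happens: going back from \<open>P\<close> along the
  characteristic \<open>c\<close> through \<open>P\<close> stays in the cone, and the derivative along \<open>c\<close> contradicts
  the choice of \<open>L\<close>.\<close>

lemma cone_uniqueness:
  fixes V W V1 V2 W2 :: "real \<times> real \<Rightarrow> real" and k k' K :: "real \<Rightarrow> real"
  defines "D \<equiv> backward_cone K"
  assumes k_pos: "\<And>x. x \<in> {0..X} \<Longrightarrow> 0 < k x"
    and k_der: "\<And>x. x \<in> {0..X} \<Longrightarrow> (k has_real_derivative k' x) (at x within {0..X})"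
    and k'_cont: "continuous_on {0..X} k'"
    and K_der: "\<And>x. x \<in> {0..X} \<Longrightarrow> (K has_real_derivative k x) (at x within {0..X})"
    and V_cont: "continuous_on (D X t) V" and W_cont: "continuous_on (D X t) W"
    and V_der: "\<And>z. z \<in> D X t \<Longrightarrow> 0 < fst z \<Longrightarrow>
          (V has_derivative (\<lambda>h. V1 z * fst h + V2 z * snd h)) (at z within D X t)"
    and W_der: "\<And>z. z \<in> D X t \<Longrightarrow> 0 < fst z \<Longrightarrow>
          (W has_derivative (\<lambda>h. V2 z * fst h + W2 z * snd h)) (at z within D X t)"
    and ineq: "\<And>z. z \<in> D X t \<Longrightarrow> 0 < fst z \<Longrightarrow>
          \<bar>V1 z - (k (fst z))\<^sup>2 * W2 z\<bar> \<le> B * (\<bar>V z\<bar> + \<bar>W z\<bar>)"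
    and init: "\<And>z. z \<in> D X t \<Longrightarrow> fst z = 0 \<Longrightarrow> V z = 0 \<and> W z = 0"
    and z: "z \<in> D X t"
  shows "V z = 0 \<and> W z = 0"
proof -
  define C where "C = D X t"
  have X: "0 \<le> X" using z by (auto simp: D_def backward_cone_def)
  have k_cont: "continuous_on {0..X} k" and K_cont: "continuous_on {0..X} K"
    by (rule DERIV_continuous_on, erule k_der K_der)+
  have K_mono: "K x \<le> K y" if "0 \<le> x" "x \<le> y" "y \<le> X" for x y
    using mono_of_positive_derivative[OF k_pos K_der, of x y] that by (cases "x = y") auto
  obtain x0 where x0: "x0 \<in> {0..X}" "\<And>x. x \<in> {0..X} \<Longrightarrow> k x0 \<le> k x"
    using continuous_attains_inf[of "{0..X}" k] k_cont X by auto
  define k0 where "k0 = k x0"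
  have k0: "0 < k0" "\<And>x. x \<in> {0..X} \<Longrightarrow> k0 \<le> k x" using x0 k_pos by (auto simp: k0_def)
  obtain k1 where k1: "0 < k1" "\<And>x. x \<in> {0..X} \<Longrightarrow> \<bar>k' x\<bar> \<le> k1"
  proof -
    have "bounded (k' ` {0..X})"
      using compact_imp_bounded compact_continuous_image[OF k'_cont] by blast
    then obtain b where "\<And>x. x \<in> {0..X} \<Longrightarrow> \<bar>k' x\<bar> \<le> b"
      unfolding bounded_iff by (metis image_eqI real_norm_def)
    then have "\<bar>k' x\<bar> \<le> \<bar>b\<bar> + 1" if "x \<in> {0..X}" for x using that by (smt (verit))
    then show ?thesis using that[of "\<bar>b\<bar> + 1"] by simp
  qed
  define B' where "B' = \<bar>B\<bar>"
  have ineq': "\<bar>V1 z - (k (fst z))\<^sup>2 * W2 z\<bar> \<le> B' * (\<bar>V z\<bar> + \<bar>W z\<bar>)"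
    if "z \<in> C" "0 < fst z" for z
  proof -
    have "B * (\<bar>V z\<bar> + \<bar>W z\<bar>) \<le> B' * (\<bar>V z\<bar> + \<bar>W z\<bar>)"
      unfolding B'_def by (intro mult_right_mono) auto
    then show ?thesis using ineq[of z] that by (auto simp: C_def)
  qed
  define R where "R d z = V z + d * k (fst z) * W z" for d :: real and z
  define M where "M z = max \<bar>R 1 z\<bar> \<bar>R (-1) z\<bar>" for z
  have fst_C: "fst z \<in> {0..X}" if "z \<in> C" for z using that by (auto simp: C_def D_def backward_cone_def)
  have V_M: "\<bar>V z\<bar> \<le> M z" and W_M: "\<bar>W z\<bar> \<le> M z / k0" if "z \<in> C" for z
  proof -
    have e: "2 * V z = R 1 z + R (-1) z" "2 * (k (fst z) * W z) = R 1 z - R (-1) z"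
      by (auto simp: R_def)
    then show "\<bar>V z\<bar> \<le> M z" unfolding M_def by linarith
    have kz: "k0 \<le> k (fst z)" using k0(2) fst_C[OF that] by auto
    have "k0 * \<bar>W z\<bar> \<le> k (fst z) * \<bar>W z\<bar>" using kz by (intro mult_right_mono) auto
    also have "\<dots> = \<bar>k (fst z) * W z\<bar>" using kz k0(1) by (simp add: abs_mult)
    also have "\<dots> \<le> M z" using e unfolding M_def by linarith
    finally show "\<bar>W z\<bar> \<le> M z / k0" using k0(1) by (simp add: field_simps)
  qed
  have M_nonneg: "0 \<le> M z" for z by (simp add: M_def)
  \<comment> \<open>\<open>L0\<close> bounds the relative growth of a Riemann invariant along its
    characteristic: the first summand comes from \<open>ineq\<close> with
    \<open>\<bar>W\<bar>\<close> at most \<open>M / k0\<close>, the second from differentiating the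
    factor \<open>k\<close>. The extra 1 in \<open>L\<close> makes the comparison with the
    exponential strict.\<close>
  define L0 where "L0 = B' * (1 + 1 / k0) + k1 / k0"
  define L where "L = L0 + 1"
  have C_compact: "compact C" unfolding C_def D_def by (rule compact_backward_cone[OF K_cont])
  have R_cont: "continuous_on C (R d)" for d
  proof -
    have "continuous_on C (\<lambda>z. k (fst z))"
      by (rule continuous_on_compose2[OF k_cont]) (use fst_C in \<open>auto intro!: continuous_intros\<close>)
    then show ?thesis
      unfolding R_def[abs_def] using V_cont W_cont by (intro continuous_intros) (auto simp: C_def)
  qed
  have small: "M z < e * exp (L * fst z)" if e: "0 < e" and zC: "z \<in> C" for e z
  proof (rule ccontr)
    assume "\<not> M z < e * exp (L * fst z)"
    define Bad where "Bad = {z \<in> C. e * exp (L * fst z) - M z \<le> 0}"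
    have "continuous_on C (\<lambda>z. e * exp (L * fst z) - M z)"
      unfolding M_def by (intro continuous_intros R_cont)
    then have "closed Bad" unfolding Bad_def
      using C_compact by (intro continuous_on_closed_Collect_le) (auto intro: compact_imp_closed)
    then have "compact Bad"
      using C_compact unfolding Bad_def
      by (metis (no_types, lifting) closed_Int_compact inf.absorb_iff2 inf_commute mem_Collect_eq subsetI)
    moreover have "z \<in> Bad" using zC \<open>\<not> M z < _\<close> by (simp add: Bad_def)
    then have "Bad \<noteq> {}" by blast
    ultimately obtain P where P: "P \<in> Bad" and P_min: "\<And>z. z \<in> Bad \<Longrightarrow> fst P \<le> fst z"
      using continuous_attains_inf[of Bad fst] continuous_on_fst[OF continuous_on_id] by blast
    define x y where "x = fst P" and "y = snd P"
    have PC: "P \<in> C" and PM: "e * exp (L * x) \<le> M P" using P by (auto simp: Bad_def x_def)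
    have x: "0 < x" "x \<le> X"
    proof -
      have "x \<noteq> 0"
      proof
        assume "x = 0"
        then have "M P = 0" using init[of P] PC by (auto simp: x_def M_def R_def C_def)
        with PM e show False by (simp add: \<open>x = 0\<close>)
      qed
      then show "0 < x" "x \<le> X" using fst_C[OF PC] by (auto simp: x_def)
    qed
    obtain s d :: real where sd: "s = 1 \<or> s = -1" "d = 1 \<or> d = -1" "M P = s * R d P"
    proof -
      have "M P = 1 * R 1 P \<or> M P = 1 * R (-1) P \<or> M P = -1 * R 1 P \<or> M P = -1 * R (-1) P"
        unfolding M_def by linarith
      then show ?thesis using that by blast
    qed
    \<comment> \<open>The sign pairs each invariant with its own family of characteristics: in the
      derivative of \<open>R d\<close> along \<open>c\<close> the two \<open>V2\<close> terms
      cancel, and what remains is the combination bounded by \<open>ineq\<close> plus a term with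
      \<open>k'\<close>.\<close>
    define c where "c r = (r, y - d * (K r - K x))" for r
    have cx: "c x = P" by (simp add: c_def x_def y_def)
    have cC: "c r \<in> C" if "0 \<le> r" "r \<le> x" for r
    proof -
      have "\<bar>d * (K r - K x)\<bar> = K x - K r" using K_mono[of r x] that x sd(2) by auto
      moreover have "\<bar>y - t\<bar> \<le> K X - K x" using PC by (auto simp: C_def D_def backward_cone_def x_def y_def)
      ultimately show ?thesis using that x by (auto simp: C_def D_def backward_cone_def c_def)
    qed
    define f where "f r = s * R d (c r) - e * exp (L * r)" for r
    have f_neg: "f r < 0" if "0 \<le> r" "r < x" for r
    proof -
      have "c r \<notin> Bad" using P_min[of "c r"] that by (auto simp: c_def x_def)
      then have "M (c r) < e * exp (L * r)" using cC[of r] that by (auto simp: Bad_def c_def)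
      moreover have "s * R d (c r) \<le> M (c r)" using sd unfolding M_def by auto
      ultimately show ?thesis by (simp add: f_def)
    qed
    let ?I = "{0..x}"
    have c_der: "(c has_derivative (\<lambda>h. (h, - d * k x * h))) (at x within ?I)"
    proof -
      have "(K has_derivative (\<lambda>h. k x * h)) (at x within ?I)"
        using K_der[of x] x by (auto simp: has_field_derivative_def intro: has_derivative_subset)
      then show ?thesis unfolding c_def by (auto intro!: derivative_eq_intros)
    qed
    have along: "((\<lambda>r. F (c r)) has_real_derivative (a - d * k x * b)) (at x within ?I)"
      if "(F has_derivative (\<lambda>h. a * fst h + b * snd h)) (at P within C)" for F a b
    proof -
      have "(F has_derivative (\<lambda>h. a * fst h + b * snd h)) (at (c x) within c ` ?I)"
        using that cC by (auto simp: cx intro: has_derivative_subset)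
      from has_derivative_in_compose[OF c_der this] show ?thesis
        unfolding has_field_derivative_def
        by (rule has_derivative_eq_rhs) (simp add: fun_eq_iff algebra_simps)
    qed
    have "((\<lambda>r. k (fst (c r))) has_real_derivative k' x) (at x within ?I)"
      using k_der[of x] x by (auto simp: c_def intro: has_field_derivative_subset)
    moreover have "((\<lambda>r. V (c r)) has_real_derivative (V1 P - d * k x * V2 P)) (at x within ?I)"
      using along[of V "V1 P" "V2 P"] V_der[of P] PC x by (simp add: C_def x_def)
    moreover have "((\<lambda>r. W (c r)) has_real_derivative (V2 P - d * k x * W2 P)) (at x within ?I)"
      using along[of W "V2 P" "W2 P"] W_der[of P] PC x by (simp add: C_def x_def)
    ultimately have f_der: "(f has_real_derivative
        s * ((V1 P - d * k x * V2 P) + d * (k' x * W P + k x * (V2 P - d * k x * W2 P))) - L * (e * exp (L * x)))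
        (at x within ?I)"
      unfolding f_def R_def
      by (auto simp: cx x_def[symmetric] algebra_simps intro!: derivative_eq_intros)
    have f_x: "f x \<le> 0"
    proof (rule tendsto_upperbound)
      show "(f \<longlongrightarrow> f x) (at_left x)"
        using DERIV_continuous[OF f_der] x by (simp add: continuous_within at_within_Icc_at_left)
      show "\<forall>\<^sub>F r in at_left x. f r \<le> 0"
        using eventually_at_left_real[OF \<open>0 < x\<close>] by eventually_elim (auto intro!: less_imp_le f_neg)
    qed auto
    with PM sd(3) have fx: "f x = 0" and MP: "M P = e * exp (L * x)"
      by (auto simp: f_def cx)
    have dd: "d * d = 1" "s * s = 1" using sd by auto
    have "(V1 P - d * k x * V2 P) + d * (k' x * W P + k x * (V2 P - d * k x * W2 P))
       = (V1 P - (k x)\<^sup>2 * W2 P) + d * (k' x * W P)"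
      using dd by (simp add: algebra_simps power2_eq_square)
    moreover have "\<bar>V1 P - (k x)\<^sup>2 * W2 P\<bar> \<le> B' * (M P + M P / k0)"
    proof -
      have "\<bar>V1 P - (k x)\<^sup>2 * W2 P\<bar> \<le> B' * (\<bar>V P\<bar> + \<bar>W P\<bar>)"
        using ineq'[OF PC] x by (auto simp: x_def)
      also have "\<dots> \<le> B' * (M P + M P / k0)"
        using V_M[OF PC] W_M[OF PC] by (intro mult_left_mono) (auto simp: B'_def)
      finally show ?thesis .
    qed
    moreover have "\<bar>d * (k' x * W P)\<bar> \<le> k1 * (M P / k0)"
    proof -
      have "\<bar>d * (k' x * W P)\<bar> = \<bar>k' x\<bar> * \<bar>W P\<bar>" using sd(2) by (auto simp: abs_mult)
      also have "\<dots> \<le> k1 * (M P / k0)"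
        using k1 x W_M[OF PC] by (intro mult_mono) auto
      finally show ?thesis .
    qed
    moreover have "B' * (M P + M P / k0) + k1 * (M P / k0) = L0 * M P"
      by (simp add: L0_def algebra_simps)
    moreover have "\<bar>s * q\<bar> = \<bar>q\<bar>" for q using sd(1) by auto
    ultimately have "s * ((V1 P - d * k x * V2 P) + d * (k' x * W P + k x * (V2 P - d * k x * W2 P))) \<le> L0 * M P"
      by (smt (verit))
    moreover have "0 < M P" using MP e by simp
    ultimately have "s * ((V1 P - d * k x * V2 P) + d * (k' x * W P + k x * (V2 P - d * k x * W2 P)))
       - L * (e * exp (L * x)) < 0"
    proof -
      have "L * (e * exp (L * x)) = L0 * M P + M P"
        unfolding MP[symmetric] by (simp add: L_def distrib_right)
      with \<open>0 < M P\<close> \<open>s * _ \<le> L0 * M P\<close> show ?thesis by linarith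
    qed
    from has_real_derivative_neg_dec_left[OF f_der this]
    obtain h0 where h0: "h0 > 0" "\<And>h. 0 < h \<Longrightarrow> x - h \<in> ?I \<Longrightarrow> h < h0 \<Longrightarrow> f x < f (x - h)" by auto
    define h where "h = min (h0 / 2) x"
    have "f x < f (x - h)" using h0 x by (auto simp: h_def)
    moreover have "f (x - h) < 0" using h0 x by (intro f_neg) (auto simp: h_def)
    ultimately show False using fx by simp
  qed
  have zC: "z \<in> C" using z by (simp add: C_def)
  have "M z \<le> 0"
  proof (rule field_le_epsilon)
    fix e :: real assume "0 < e"
    then have "M z < e / exp (L * fst z) * exp (L * fst z)" using zC by (intro small) auto
    then show "M z \<le> 0 + e" by simp
  qed
  with M_nonneg[of z] have "M z = 0" by simp
  with V_M[OF zC] W_M[OF zC] show ?thesis by simp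
qed

text \<open>A minimiser \<open>s\<close> of \<open>Y r + \<bar>r - t\<bar>\<close> satisfies the cone condition by the triangle inequality,
  but if \<open>s \<noteq> t\<close>, then \<open>Y\<close> has slope at least 1 at \<open>s\<close> towards \<open>t\<close>.\<close>

lemma cone_condition_from_slope:
  fixes Y :: "real \<Rightarrow> real"
  assumes cont: "continuous_on UNIV Y" and nonneg: "\<And>r. 0 \<le> Y r"
    and slope: "\<And>s. (\<And>r. Y s - \<bar>r - s\<bar> \<le> Y r) \<Longrightarrow> \<exists>d. (Y has_real_derivative d) (at s) \<and> \<bar>d\<bar> < 1"
  shows "Y t - \<bar>r - t\<bar> \<le> Y r"
proof -
  have "\<exists>s. \<forall>r. Y s + \<bar>s - t\<bar> \<le> Y r + \<bar>r - t\<bar>"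
  proof -
    \<comment> \<open>Outside this interval \<open>\<bar>r - t\<bar>\<close> alone already exceeds
      \<open>Y t\<close>, the value at \<open>r = t\<close>. So a minimum over the interval is a
      global one.\<close>
    have "\<exists>s\<in>{t - Y t..t + Y t}. \<forall>r\<in>{t - Y t..t + Y t}. Y s + \<bar>s - t\<bar> \<le> Y r + \<bar>r - t\<bar>"
      using nonneg[of t] by (intro continuous_attains_inf continuous_intros continuous_on_subset[OF cont]) auto
    then obtain s where s: "\<And>r. \<bar>r - t\<bar> \<le> Y t \<Longrightarrow> Y s + \<bar>s - t\<bar> \<le> Y r + \<bar>r - t\<bar>"
      by (force simp: abs_le_iff)
    have "Y s + \<bar>s - t\<bar> \<le> Y r + \<bar>r - t\<bar>" for r
      using s[of r] s[of t] nonneg[of r] nonneg[of t] by fastforce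
    then show ?thesis by blast
  qed
  then obtain s where s: "\<And>r. Y s + \<bar>s - t\<bar> \<le> Y r + \<bar>r - t\<bar>" by blast
  have "Y s - \<bar>r - s\<bar> \<le> Y r" for r using s[of r] by linarith
  then obtain d where d: "(Y has_real_derivative d) (at s)" "\<bar>d\<bar> < 1" using slope by blast
  have "s = t"
  proof (rule ccontr)
    assume "s \<noteq> t"
    then consider "s < t" | "t < s" by linarith
    then show False
    proof cases
      case 1
      have "((\<lambda>r. Y r - r) has_real_derivative d - 1) (at s)"
        using d by (auto intro!: derivative_eq_intros)
      moreover have "d - 1 < 0" using d(2) by linarith
      ultimately obtain e where e: "e > 0"
        "\<And>h. 0 < h \<Longrightarrow> h < e \<Longrightarrow> Y (s + h) - (s + h) < Y s - s"
        using DERIV_neg_dec_right by blast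
      define h where "h = min (e / 2) (t - s)"
      have h: "0 < h" "h < e" "h \<le> t - s" using e(1) 1 by (auto simp: h_def)
      show False using e(2)[OF h(1,2)] s[of "s + h"] h by linarith
    next
      case 2
      have "((\<lambda>r. Y r + r) has_real_derivative d + 1) (at s)"
        using d by (auto intro!: derivative_eq_intros)
      moreover have "0 < d + 1" using d(2) by linarith
      ultimately obtain e where e: "e > 0"
        "\<And>h. 0 < h \<Longrightarrow> h < e \<Longrightarrow> Y (s - h) + (s - h) < Y s + s"
        using DERIV_pos_inc_left by blast
      define h where "h = min (e / 2) (s - t)"
      have h: "0 < h" "h < e" "h \<le> s - t" using e(1) 2 by (auto simp: h_def)
      show False using e(2)[OF h(1,2)] s[of "s - h"] h by linarith
    qed
  qed
  with s[of r] show ?thesis by simp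
qed

text \<open>The function need not be differentiable on the curve itself; only a one-sided limit of
  its gradient is known there. It is differentiated along the curves shifted by
  \<open>\<sigma> * d\<close> into \<open>A\<close>, where the derivative is within \<open>e\<close>
  of the claimed value uniformly for small \<open>d\<close>; the resulting mean value estimate
  survives the limit \<open>d\<close> to 0. Applied from both sides of the shock, this yields
  equality of the tangential velocities.\<close>

lemma curve_derivative_from_side:
  fixes \<phi> :: "real \<times> real \<Rightarrow> real" and G :: "real \<times> real \<Rightarrow> real \<times> real" and xs xs' :: "real \<Rightarrow> real"
  assumes xs: "\<And>s. (xs has_real_derivative xs' s) (at s)" and xs': "isCont xs' t"
    and A: "0 < \<delta>" "\<And>s d. \<bar>s - t\<bar> < 1 \<Longrightarrow> 0 < d \<Longrightarrow> d < \<delta> \<Longrightarrow> (xs s + \<sigma> * d, s) \<in> A"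
      "(xs t, t) \<notin> A"
    and der: "\<And>z. z \<in> A \<Longrightarrow> (\<phi> has_derivative (\<lambda>h. fst (G z) * fst h + snd (G z) * snd h)) (at z within A)"
    and lim: "(G \<longlongrightarrow> g) (at (xs t, t) within A)"
    and cont: "\<And>s. ((\<lambda>d. \<phi> (xs s + \<sigma> * d, s)) \<longlongrightarrow> \<phi> (xs s, s)) (at_right 0)"
  shows "((\<lambda>s. \<phi> (xs s, s)) has_real_derivative fst g * xs' t + snd g) (at t)"
proof -
  define D where "D = fst g * xs' t + snd g"
  define U where "U = {w :: real \<times> real. 0 < fst w \<and> fst w < \<delta> \<and> \<bar>snd w - t\<bar> < 1}"
  define c where "c w = (xs (snd w) + \<sigma> * fst w, snd w)" for w :: "real \<times> real"
  define T where "T w = fst (G (c w)) * xs' (snd w) + snd (G (c w))" for w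
  have xs_cont: "isCont xs s" for s using DERIV_isCont[OF xs] .
  have "((\<lambda>w. xs (snd w)) \<longlongrightarrow> xs t) (at (0, t) within U)"
    by (rule isCont_tendsto_compose[OF xs_cont]) (auto intro!: tendsto_eq_intros)
  then have "(c \<longlongrightarrow> (xs t, t)) (at (0, t) within U)"
    unfolding c_def by (auto intro!: tendsto_eq_intros)
  moreover have "\<forall>\<^sub>F w in at (0, t) within U. c w \<in> A \<and> c w \<noteq> (xs t, t)"
    unfolding eventually_at_filter
  proof (intro always_eventually allI impI)
    fix w :: "real \<times> real" assume "w \<in> U"
    then have "c w \<in> A" using A(2) by (auto simp: U_def c_def)
    with A(3) show "c w \<in> A \<and> c w \<noteq> (xs t, t)" by metis
  qed
  ultimately have "filterlim c (at (xs t, t) within A) (at (0, t) within U)"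
    by (auto simp: filterlim_at)
  from filterlim_compose[OF lim this]
  have G_lim: "((\<lambda>w. G (c w)) \<longlongrightarrow> g) (at (0, t) within U)" .
  have xs'_lim: "((\<lambda>w. xs' (snd w)) \<longlongrightarrow> xs' t) (at (0, t) within U)"
    by (rule isCont_tendsto_compose[OF xs']) (auto intro!: tendsto_eq_intros)
  have T_lim: "(T \<longlongrightarrow> D) (at (0, t) within U)"
    unfolding T_def D_def by (intro tendsto_intros G_lim xs'_lim)
  have f_der: "((\<lambda>s. \<phi> (c (d, s))) has_real_derivative T (d, s)) (at s)"
    if d: "0 < d" "d < \<delta>" and s: "\<bar>s - t\<bar> < 1" for d s
  proof -
    let ?I = "{t - 1<..<t + 1}"
    have "((\<lambda>s. c (d, s)) has_derivative (\<lambda>h. (xs' s * h, h))) (at s within ?I)"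
      unfolding c_def using xs[of s]
      by (auto simp: has_field_derivative_def intro!: derivative_eq_intros intro: has_derivative_at_withinI)
    moreover have "(\<phi> has_derivative (\<lambda>h. fst (G (c (d, s))) * fst h + snd (G (c (d, s))) * snd h))
        (at (c (d, s)) within (\<lambda>s. c (d, s)) ` ?I)"
      using A(2) d s by (intro has_derivative_subset[OF der]) (auto simp: c_def)
    ultimately have "((\<lambda>s. \<phi> (c (d, s))) has_derivative
        (\<lambda>h. fst (G (c (d, s))) * (xs' s * h) + snd (G (c (d, s))) * h)) (at s within ?I)"
      using has_derivative_in_compose by fastforce
    moreover have "at s within ?I = at s" using s by (intro at_within_open) auto
    moreover have "(\<lambda>h. fst (G (c (d, s))) * (xs' s * h) + snd (G (c (d, s))) * h) = (*) (T (d, s))"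
      by (auto simp: T_def fun_eq_iff algebra_simps)
    ultimately show ?thesis by (simp add: has_field_derivative_def)
  qed
  have key: "\<exists>r>0. \<forall>s. \<bar>s - t\<bar> < r \<longrightarrow> \<bar>\<phi> (xs s, s) - \<phi> (xs t, t) - D * (s - t)\<bar> \<le> e * \<bar>s - t\<bar>" if e: "0 < e" for e
  proof -
    from tendstoD[OF T_lim e] obtain r where r: "r > 0"
      "\<And>w. w \<in> U \<Longrightarrow> w \<noteq> (0, t) \<Longrightarrow> dist w (0, t) < r \<Longrightarrow> \<bar>T w - D\<bar> < e"
      by (auto simp: eventually_at dist_real_def)
    define r' where "r' = min (r / 2) (min \<delta> 1)"
    have r': "0 < r'" "r' \<le> r / 2" "r' \<le> \<delta>" "r' \<le> 1" using r A by (auto simp: r'_def)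
    have T_bd: "\<bar>T (d, s) - D\<bar> \<le> e" if "0 < d" "d < r'" "\<bar>s - t\<bar> < r'" for d s
    proof -
      have "dist (d, s) (0, t) \<le> \<bar>d\<bar> + \<bar>s - t\<bar>"
        unfolding dist_Pair_Pair dist_real_def using sqrt_sum_squares_le_sum_abs[of "\<bar>d\<bar>" "\<bar>s - t\<bar>"] by simp
      also have "\<dots> < r" using that r' by auto
      finally show ?thesis using r(2)[of "(d, s)"] that r' by (fastforce simp: U_def)
    qed
    have "\<bar>\<phi> (xs s, s) - \<phi> (xs t, t) - D * (s - t)\<bar> \<le> e * \<bar>s - t\<bar>" if s: "\<bar>s - t\<bar> < r'" for s
    proof (rule tendsto_upperbound)
      show "((\<lambda>d. \<bar>\<phi> (xs s + \<sigma> * d, s) - \<phi> (xs t + \<sigma> * d, t) - D * (s - t)\<bar>)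
         \<longlongrightarrow> \<bar>\<phi> (xs s, s) - \<phi> (xs t, t) - D * (s - t)\<bar>) (at_right 0)"
        by (intro tendsto_intros cont)
      show "\<forall>\<^sub>F d in at_right 0. \<bar>\<phi> (xs s + \<sigma> * d, s) - \<phi> (xs t + \<sigma> * d, t) - D * (s - t)\<bar> \<le> e * \<bar>s - t\<bar>"
        using eventually_at_right_real[OF r'(1)]
      proof eventually_elim
        case (elim d)
        let ?S = "{t - r'<..<t + r'}"
        have "norm ((\<phi> (c (d, s)) - D * s) - (\<phi> (c (d, t)) - D * t)) \<le> e * norm (s - t)"
        proof (rule field_differentiable_bound[where S = ?S])
          fix q assume q: "q \<in> ?S"
          have "((\<lambda>s. \<phi> (c (d, s))) has_real_derivative T (d, q)) (at q within ?S)"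
            using elim r' q by (intro has_field_derivative_at_within[OF f_der]) auto
          then show "((\<lambda>s. \<phi> (c (d, s)) - D * s) has_real_derivative T (d, q) - D) (at q within ?S)"
            by (auto intro!: derivative_eq_intros)
          show "norm (T (d, q) - D) \<le> e" using T_bd[of d q] elim q by auto
        qed (use s r' in auto)
        then show ?case by (simp add: c_def algebra_simps)
      qed
    qed auto
    with r' show ?thesis by blast
  qed
  show ?thesis unfolding D_def[symmetric] has_field_derivative_iff
  proof (rule LIM_I)
    fix e :: real assume "0 < e"
    then obtain r where r: "r > 0"
      "\<And>s. \<bar>s - t\<bar> < r \<Longrightarrow> \<bar>\<phi> (xs s, s) - \<phi> (xs t, t) - D * (s - t)\<bar> \<le> e / 2 * \<bar>s - t\<bar>"
      using key[of "e / 2"] by auto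
    have "\<bar>(\<phi> (xs s, s) - \<phi> (xs t, t)) / (s - t) - D\<bar> < e" if s: "s \<noteq> t" "\<bar>s - t\<bar> < r" for s
    proof -
      have "(\<phi> (xs s, s) - \<phi> (xs t, t)) / (s - t) - D = (\<phi> (xs s, s) - \<phi> (xs t, t) - D * (s - t)) / (s - t)"
        using s by (simp add: field_simps)
      then have "\<bar>(\<phi> (xs s, s) - \<phi> (xs t, t)) / (s - t) - D\<bar> \<le> e / 2"
        using r(2)[OF s(2)] s(1) by (simp add: abs_divide divide_le_eq)
      with \<open>0 < e\<close> show ?thesis by simp
    qed
    with r(1) show "\<exists>r>0. \<forall>s. s \<noteq> t \<and> norm (s - t) < r \<longrightarrow>
       norm ((\<phi> (xs s, s) - \<phi> (xs t, t)) / (s - t) - D) < e" by (auto intro!: exI[of _ r])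
  qed
qed

text \<open>Integrating \<open>p\<close> along horizontal lines recovers \<open>\<phi>\<close>;
  differentiation under the integral sign expresses increments of \<open>q\<close> as integrals of
  \<open>P2\<close>, and differentiating in the first variable gives the claim. For the flow this is
  irrotationality, which closes the first-order system in \<open>cone_uniqueness\<close>.\<close>

lemma mixed_partials_eq:
  fixes \<phi> p q :: "real \<times> real \<Rightarrow> real"
  assumes U: "open U" "U \<subseteq> A" and z: "z \<in> U"
    and \<phi>: "\<And>w. w \<in> U \<Longrightarrow> (\<phi> has_derivative (\<lambda>h. p w * fst h + q w * snd h)) (at w)"
    and p: "\<And>w. w \<in> U \<Longrightarrow> (p has_derivative (\<lambda>h. P1 w * fst h + P2 w * snd h)) (at w)"
    and q: "\<And>w. w \<in> U \<Longrightarrow> (q has_derivative (\<lambda>h. Q1 w * fst h + Q2 w * snd h)) (at w)"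
    and P2: "continuous_on U P2"
  shows "P2 z = Q1 z"
proof -
  obtain a b where zab: "z = (a, b)" by (cases z)
  obtain R where R: "R > 0" "cball z R \<subseteq> U" using U(1) z open_contains_cball by blast
  define r where "r = R / 2"
  define X where "X = {a - r..a + r}"
  define Y where "Y = {b - r..b + r}"
  have r: "0 < r" using R by (simp add: r_def)
  have box: "(x, y) \<in> U" if "x \<in> X" "y \<in> Y" for x y
  proof -
    have "dist (a, b) (x, y) \<le> \<bar>a - x\<bar> + \<bar>b - y\<bar>"
      unfolding dist_Pair_Pair dist_real_def using sqrt_sum_squares_le_sum_abs[of "\<bar>a - x\<bar>" "\<bar>b - y\<bar>"] by simp
    also have "\<dots> \<le> r + r" using that by (intro add_mono) (auto simp: X_def Y_def abs_le_iff)
    also have "\<dots> = R" by (simp add: r_def)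
    finally show ?thesis using R by (auto simp: zab)
  qed
  have part1: "((\<lambda>x. f (x, y)) has_real_derivative g (x, y)) (at x within S)"
    and part2: "((\<lambda>y. f (x, y)) has_real_derivative k (x, y)) (at y within S)"
    if f: "(f has_derivative (\<lambda>h. g (x, y) * fst h + k (x, y) * snd h)) (at (x, y))"
    for f g k :: "real \<times> real \<Rightarrow> real" and x y S
  proof -
    have f': "(f has_derivative (\<lambda>h. g (x, y) * fst h + k (x, y) * snd h)) (at (x, y) within T)" for T
      using f by (rule has_derivative_at_withinI)
    have "((\<lambda>x. (x, y)) has_derivative (\<lambda>h. (h, 0))) (at x within S)"
      "((\<lambda>y. (x, y)) has_derivative (\<lambda>h. (0, h))) (at y within S)"
      by (auto intro!: derivative_eq_intros)
    from has_derivative_in_compose[OF this(1) f'] has_derivative_in_compose[OF this(2) f']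
    show "((\<lambda>x. f (x, y)) has_real_derivative g (x, y)) (at x within S)"
      "((\<lambda>y. f (x, y)) has_real_derivative k (x, y)) (at y within S)"
      by (simp_all add: has_field_derivative_def)
  qed
  have p_cont: "continuous_on U p" and P2_cont: "continuous_on U P2"
    using p P2 U(1) by (auto intro!: continuous_at_imp_continuous_on has_derivative_continuous)
  have line: "\<phi> (x, y) - \<phi> (a - r, y) = integral {a - r..x} (\<lambda>s. p (s, y))" if "x \<in> X" "y \<in> Y" for x y
  proof -
    have "((\<lambda>s. p (s, y)) has_integral (\<phi> (x, y) - \<phi> (a - r, y))) {a - r..x}"
    proof (rule fundamental_theorem_of_calculus)
      show "a - r \<le> x" using that by (auto simp: X_def)
      show "((\<lambda>s. \<phi> (s, y)) has_vector_derivative p (s, y)) (at s within {a - r..x})" if "s \<in> {a - r..x}" for s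
        using part1[where f = \<phi> and g = p and k = q, OF \<phi>[of "(s, y)"]] box[of s y] that \<open>x \<in> X\<close> \<open>y \<in> Y\<close>
        by (auto simp: has_real_derivative_iff_has_vector_derivative[symmetric] X_def)
    qed
    then show ?thesis by (simp add: integral_unique)
  qed
  have q_line: "q (x, b) - q (a - r, b) = integral {a - r..x} (\<lambda>s. P2 (s, b))" if x: "x \<in> X" for x
  proof -
    let ?Y = "{b - r<..<b + r}"
    have "((\<lambda>y. integral (cbox (a - r) x) (\<lambda>s. p (s, y))) has_field_derivative
        integral (cbox (a - r) x) (\<lambda>s. P2 (s, b))) (at b within ?Y)"
    proof (rule leibniz_rule_field_derivative)
      show "((\<lambda>y. p (s, y)) has_field_derivative P2 (s, y)) (at y within ?Y)"
        if "y \<in> ?Y" "s \<in> cbox (a - r) x" for y s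
        using that x box[of s y] by (intro part2[where f = p and g = P1 and k = P2, OF p]) (auto simp: X_def Y_def)
      show "(\<lambda>s. p (s, y)) integrable_on cbox (a - r) x" if "y \<in> ?Y" for y
      proof (intro integrable_continuous continuous_on_compose2[OF p_cont] continuous_intros)
        show "(\<lambda>s. (s, y)) ` cbox (a - r) x \<subseteq> U"
          using that x box by (auto simp: X_def Y_def)
      qed
      show "continuous_on (?Y \<times> cbox (a - r) x) (\<lambda>(y, s). P2 (s, y))"
        unfolding split_beta
      proof (intro continuous_on_compose2[OF P2_cont] continuous_intros)
        show "(\<lambda>w. (snd w, fst w)) ` (?Y \<times> cbox (a - r) x) \<subseteq> U"
          using x box by (auto simp: X_def Y_def)
      qed
    qed (use r in auto)
    moreover have "at b within ?Y = at b" using r by (intro at_within_open) auto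
    ultimately have 1: "((\<lambda>y. integral {a - r..x} (\<lambda>s. p (s, y))) has_real_derivative
        integral {a - r..x} (\<lambda>s. P2 (s, b))) (at b)" by simp
    have 2: "((\<lambda>y. \<phi> (x, y) - \<phi> (a - r, y)) has_real_derivative (q (x, b) - q (a - r, b))) (at b)"
      using x r box by (intro DERIV_diff part2[where f = \<phi> and g = p and k = q, OF \<phi>]) (auto simp: X_def Y_def)
    have "((\<lambda>y. integral {a - r..x} (\<lambda>s. p (s, y))) has_real_derivative (q (x, b) - q (a - r, b))) (at b)"
    proof (rule has_field_derivative_transform_within_open[OF 2, of ?Y])
      show "\<phi> (x, y) - \<phi> (a - r, y) = integral {a - r..x} (\<lambda>s. p (s, y))" if "y \<in> ?Y" for y
        using that x by (intro line) (auto simp: Y_def)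
    qed (use r in auto)
    from DERIV_unique[OF this 1] show ?thesis .
  qed
  have 1: "((\<lambda>x. q (x, b) - q (a - r, b)) has_real_derivative Q1 (a, b)) (at a within X)"
    using part1[where f = q and g = Q1 and k = Q2, OF q[of "(a, b)"], of X] z by (auto simp: zab intro!: derivative_eq_intros)
  have 2: "((\<lambda>x. integral {a - r..x} (\<lambda>s. P2 (s, b))) has_real_derivative P2 (a, b)) (at a within {a - r..a + r})"
  proof (rule integral_has_real_derivative)
    show "continuous_on {a - r..a + r} (\<lambda>s. P2 (s, b))"
      using r box by (intro continuous_on_compose2[OF P2_cont] continuous_intros) (auto simp: X_def Y_def)
  qed (use r in auto)
  have "((\<lambda>x. q (x, b) - q (a - r, b)) has_real_derivative P2 (a, b)) (at a within X)"
    unfolding X_def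
    by (rule has_field_derivative_transform_within[OF 2 zero_less_one]) (use r q_line in \<open>auto simp: X_def\<close>)
  then have d2: "((\<lambda>x. q (x, b) - q (a - r, b)) has_real_derivative P2 (a, b)) (at a)"
    and d1: "((\<lambda>x. q (x, b) - q (a - r, b)) has_real_derivative Q1 (a, b)) (at a)"
    using 1 r by (simp_all add: X_def at_within_Icc_at)
  show ?thesis using DERIV_unique[OF d2 d1] by (simp add: zab)
qed

text \<open>The regions contain boundary points, so all derivatives are taken within
  \<open>A\<close>. The hypothesis \<open>dir\<close> makes such derivatives unique, which
  identifies the abstract \<open>Df\<close> of \<open>C2_on\<close> with the given gradient
  \<open>G\<close>.\<close>

lemma C2_on_partials:
  assumes C2: "C2_on A \<phi>"
    and dir: "\<And>z i e. z \<in> A \<Longrightarrow> i \<in> Basis \<Longrightarrow> 0 < e \<Longrightarrow> \<exists>d. 0 < \<bar>d\<bar> \<and> \<bar>d\<bar> < e \<and> z + d *\<^sub>R i \<in> A"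
    and G: "\<And>z. z \<in> A \<Longrightarrow> (\<phi> has_derivative (\<lambda>h. fst (G z) * fst h + snd (G z) * snd h)) (at z within A)"
  obtains P1 P2 Q1 Q2 :: "real \<times> real \<Rightarrow> real" where
    "continuous_on A P1" "continuous_on A P2" "continuous_on A Q1" "continuous_on A Q2"
    "\<And>z. z \<in> A \<Longrightarrow> ((\<lambda>z. fst (G z)) has_derivative (\<lambda>h. P1 z * fst h + P2 z * snd h)) (at z within A)"
    "\<And>z. z \<in> A \<Longrightarrow> ((\<lambda>z. snd (G z)) has_derivative (\<lambda>h. Q1 z * fst h + Q2 z * snd h)) (at z within A)"
proof -
  obtain Df D2f where Df: "\<And>x. x \<in> A \<Longrightarrow> (\<phi> has_derivative blinfun_apply (Df x)) (at x within A)"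
    and D2f: "\<And>x. x \<in> A \<Longrightarrow> (Df has_derivative blinfun_apply (D2f x)) (at x within A)"
    and cont: "continuous_on A D2f"
    using C2 unfolding C2_on_def by blast
  have eq: "blinfun_apply (Df x) = (\<lambda>h. fst (G x) * fst h + snd (G x) * snd h)" if "x \<in> A" for x
    using frechet_derivative_unique_within[OF Df[OF that] G[OF that]] dir[OF that] by blast
  have fstG: "fst (G x) = blinfun_apply (Df x) (1, 0)" and sndG: "snd (G x) = blinfun_apply (Df x) (0, 1)"
    if "x \<in> A" for x using eq[OF that] by auto
  define H where "H v x h = blinfun_apply (blinfun_apply (D2f x) h) v" for v x h
  have der: "((\<lambda>x. blinfun_apply (Df x) v) has_derivative
     (\<lambda>h. H v x (1, 0) * fst h + H v x (0, 1) * snd h)) (at x within A)" if "x \<in> A" for v x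
  proof -
    have 1: "((\<lambda>x. blinfun_apply (Df x) v) has_derivative H v x) (at x within A)"
      unfolding H_def
      by (rule bounded_linear.has_derivative[OF blinfun.bounded_linear_left D2f[OF that]])
    have 2: "H v x h = H v x (1, 0) * fst h + H v x (0, 1) * snd h" for h
    proof -
      have "h = fst h *\<^sub>R (1, 0) + snd h *\<^sub>R (0, 1)" by (cases h) simp
      then have "blinfun_apply (D2f x) h = fst h *\<^sub>R blinfun_apply (D2f x) (1, 0) + snd h *\<^sub>R blinfun_apply (D2f x) (0, 1)"
        by (metis blinfun.add_right blinfun.scaleR_right)
      then show ?thesis by (simp add: H_def blinfun.add_left blinfun.scaleR_left)
    qed
    show ?thesis by (rule has_derivative_eq_rhs[OF 1]) (rule ext, rule 2)
  qed
  have cH: "continuous_on A (\<lambda>x. H v x h)" for v h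
    unfolding H_def by (intro continuous_intros cont)
  show ?thesis
  proof (rule that)
    show "((\<lambda>z. fst (G z)) has_derivative (\<lambda>h. H (1, 0) z (1, 0) * fst h + H (1, 0) z (0, 1) * snd h)) (at z within A)"
      if "z \<in> A" for z
      by (rule has_derivative_transform[OF that _ der[OF that]]) (rule fstG)
    show "((\<lambda>z. snd (G z)) has_derivative (\<lambda>h. H (0, 1) z (1, 0) * fst h + H (0, 1) z (0, 1) * snd h)) (at z within A)"
      if "z \<in> A" for z
      by (rule has_derivative_transform[OF that _ der[OF that]]) (rule sndG)
  qed (rule cH)+
qed

section \<open>Partial derivatives of the flow\<close>

definition grad_within :: "(real \<times> real \<Rightarrow> real) \<Rightarrow> real \<Rightarrow> real \<Rightarrow> real \<times> real \<Rightarrow> (real \<times> real) set \<Rightarrow> bool" where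
  "grad_within f a b z A \<longleftrightarrow> (f has_derivative (\<lambda>h. a * fst h + b * snd h)) (at z within A)"

lemma grad_within_mult:
  assumes "grad_within f a b z A" "grad_within g c d z A"
  shows "grad_within (\<lambda>z. f z * g z) (a * g z + f z * c) (b * g z + f z * d) z A"
  using assms unfolding grad_within_def
  by (auto intro!: derivative_eq_intros simp: algebra_simps)

lemma grad_within_add:
  assumes "grad_within f a b z A" "grad_within g c d z A"
  shows "grad_within (\<lambda>z. f z + g z) (a + c) (b + d) z A"
  using assms unfolding grad_within_def
  by (auto intro!: derivative_eq_intros simp: algebra_simps)

lemma grad_within_chain:
  assumes f: "grad_within f a b z A" and F: "(F has_real_derivative d) (at (f z) within S)" and S: "f ` A \<subseteq> S"
  shows "grad_within (\<lambda>z. F (f z)) (d * a) (d * b) z A"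
proof -
  have "(F has_derivative (\<lambda>h. d * h)) (at (f z) within f ` A)"
    using F S unfolding has_field_derivative_def by (rule has_derivative_subset)
  from has_derivative_in_compose[OF f[unfolded grad_within_def] this] show ?thesis
    unfolding grad_within_def by (rule has_derivative_eq_rhs) (simp add: fun_eq_iff algebra_simps)
qed

lemma grad_within_fst:
  assumes F: "(F has_real_derivative d) (at (fst z) within S)" and S: "fst ` A \<subseteq> S"
  shows "grad_within (\<lambda>z. F (fst z)) d 0 z A"
proof -
  have "grad_within fst 1 0 z A" unfolding grad_within_def by (auto intro!: derivative_eq_intros)
  from grad_within_chain[OF this F S] show ?thesis by simp
qed

lemma grad_within_const: "grad_within (\<lambda>z. c) 0 0 z A"
  by (simp add: grad_within_def)

lemma grad_within_along:
  assumes f: "grad_within f a b (c t) A" and c: "((\<lambda>s. fst (c s)) has_real_derivative d1) (at t within S)"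
     "((\<lambda>s. snd (c s)) has_real_derivative d2) (at t within S)" and S: "\<And>s. s \<in> S \<Longrightarrow> c s \<in> A"
  shows "((\<lambda>s. f (c s)) has_real_derivative a * d1 + b * d2) (at t within S)"
proof -
  have "((\<lambda>s. (fst (c s), snd (c s))) has_derivative (\<lambda>h. (d1 * h, d2 * h))) (at t within S)"
    using c unfolding has_field_derivative_def by (intro has_derivative_Pair)
  then have cd: "(c has_derivative (\<lambda>h. (d1 * h, d2 * h))) (at t within S)" by simp
  have "(f has_derivative (\<lambda>h. a * fst h + b * snd h)) (at (c t) within c ` S)"
    using f S unfolding grad_within_def by (auto intro: has_derivative_subset)
  from has_derivative_in_compose[OF cd this] show ?thesis
    unfolding has_field_derivative_def by (rule has_derivative_eq_rhs) (simp add: fun_eq_iff algebra_simps)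
qed

lemma grad_within_imp_continuous_on:
  "(\<And>z. z \<in> A \<Longrightarrow> grad_within f (a z) (b z) z A) \<Longrightarrow> continuous_on A f"
  unfolding grad_within_def continuous_on_eq_continuous_within
  using has_derivative_continuous by blast

section \<open>Jump conditions at a shock and monotonicity of the subsonic flux\<close>

context polytropic_gas
begin

lemma cs_sq_less_qm_sq: "cs\<^sup>2 < qm\<^sup>2"
  using cs_less_qm cs_pos by (simp add: power_strict_mono)

text \<open>For a fixed tangential velocity, the normal mass flux \<open>dens (e Y) * Y\<close> increases in the normal
  velocity \<open>Y\<close> up to the sound speed, so the upstream normal velocity must be supersonic. Here
  \<open>\<kappa>\<close> is the slope of the shock and \<open>(P, Q)\<close> the downstream velocity.\<close>

lemma shock_slope_bound:
  assumes u: "cs < u" "u < qm"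
    and tangential: "P * \<kappa> + Q = u * \<kappa>"
    and normal: "dens (P\<^sup>2 + Q\<^sup>2) * (P - \<kappa> * Q) = dens (u\<^sup>2) * u"
    and subsonic: "P\<^sup>2 + Q\<^sup>2 \<le> cs\<^sup>2"
  shows "ssq (u\<^sup>2) * (1 + \<kappa>\<^sup>2) < u\<^sup>2"
proof (rule ccontr)
  assume "\<not> ?thesis"
  then have contra: "u\<^sup>2 \<le> ssq (u\<^sup>2) * (1 + \<kappa>\<^sup>2)" by simp
  define N where "N = 1 + \<kappa>\<^sup>2"
  have N: "1 \<le> N" by (simp add: N_def)
  define X where "X = P - \<kappa> * Q"
  \<comment> \<open>\<open>e Y\<close> is the squared speed of the state with normal component
    \<open>Y\<close> and the tangential component of the upstream flow. The normal
    \<open>(1, - \<kappa>)\<close> and the tangent \<open>(\<kappa>, 1)\<close> are not normalised,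
    hence the division by their squared length \<open>N\<close>.\<close>
  define e where "e Y = (Y\<^sup>2 + u\<^sup>2 * \<kappa>\<^sup>2) / N" for Y
  have u_sq: "cs\<^sup>2 < u\<^sup>2" "u\<^sup>2 < qm\<^sup>2" using u cs_pos by (auto intro!: power_strict_mono)
  have u_pos: "0 < u" using u cs_pos by simp
  have "(P - \<kappa> * Q)\<^sup>2 + (P * \<kappa> + Q)\<^sup>2 = N * (P\<^sup>2 + Q\<^sup>2)"
    by (simp add: N_def power2_eq_square algebra_simps)
  then have eX: "e X = P\<^sup>2 + Q\<^sup>2"
    using N unfolding tangential by (simp add: e_def X_def power_mult_distrib)
  have eu: "e u = u\<^sup>2"
  proof -
    have "u\<^sup>2 + u\<^sup>2 * \<kappa>\<^sup>2 = N * u\<^sup>2" by (simp add: N_def algebra_simps)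
    then show ?thesis using N by (simp add: e_def)
  qed
  have hX: "dens (e X) * X = dens (e u) * u" using normal unfolding eX eu by (simp add: X_def)
  have "0 < dens (e X) * X" unfolding hX eu using dens_pos[OF u_sq(2)] u_pos by simp
  then have X_pos: "0 < X" using dens_nonneg[of "e X"] by (simp add: zero_less_mult_iff)
  have "e X < e u" using subsonic u_sq by (simp add: eX eu)
  then have "X\<^sup>2 < u\<^sup>2" using N by (simp add: e_def divide_less_cancel)
  then have "X < u" using u_pos by (simp add: power2_less_imp_less)
  have e_less: "e Y < u\<^sup>2" if "0 < Y" "Y < u" for Y
  proof -
    have "Y\<^sup>2 < u\<^sup>2" using that by (intro power_strict_mono) auto
    then have "e Y < e u" using N by (simp add: e_def divide_strict_right_mono)
    then show ?thesis by (simp add: eu)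
  qed
  have e_der: "(e has_real_derivative 2 * Y / N) (at Y)" for Y
    unfolding e_def using N by (auto intro!: derivative_eq_intros)
  have e_le: "e Y < qm\<^sup>2" if "0 < Y" "Y \<le> u" for Y
    using e_less[of Y] eu that u_sq by (cases "Y = u") auto
  have h_der: "((\<lambda>Y. dens (e Y) * Y) has_real_derivative dens (e Y) * (1 - Y\<^sup>2 / (N * ssq (e Y)))) (at Y)"
    if "0 < Y" "Y \<le> u" for Y
  proof -
    have "((\<lambda>Y. dens (e Y)) has_real_derivative - dens (e Y) / (2 * ssq (e Y)) * (2 * Y / N)) (at Y)"
      by (rule DERIV_chain2[where f = dens and g = e, OF dens_deriv[OF e_le[OF that]] e_der])
    then have "((\<lambda>Y. dens (e Y) * Y) has_real_derivative
        - dens (e Y) / (2 * ssq (e Y)) * (2 * Y / N) * Y + dens (e Y)) (at Y)"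
      by (auto intro!: derivative_eq_intros)
    moreover have "- dens (e Y) / (2 * ssq (e Y)) * (2 * Y / N) * Y + dens (e Y)
        = dens (e Y) * (1 - Y\<^sup>2 / (N * ssq (e Y)))"
      using ssq_pos_iff[of "e Y"] e_le[OF that] N by (simp add: field_simps power2_eq_square)
    ultimately show ?thesis by (simp only:)
  qed
  have "dens (e X) * X < dens (e u) * u"
  proof (rule DERIV_pos_imp_increasing_open[OF \<open>X < u\<close>])
    show "\<exists>d. ((\<lambda>Y. dens (e Y) * Y) has_real_derivative d) (at Y) \<and> 0 < d" if "X < Y" "Y < u" for Y
    proof (intro exI conjI)
      have Y: "0 < Y" "Y \<le> u" using that X_pos by auto
      show "((\<lambda>Y. dens (e Y) * Y) has_real_derivative dens (e Y) * (1 - Y\<^sup>2 / (N * ssq (e Y)))) (at Y)"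
        by (rule h_der[OF Y])
      have s: "0 < ssq (e Y)" using e_le[OF Y] ssq_pos_iff by simp
      have "Y\<^sup>2 < u\<^sup>2" using that Y by (intro power_strict_mono) auto
      also have "u\<^sup>2 \<le> ssq (u\<^sup>2) * N" using contra by (simp add: N_def)
      also have "\<dots> \<le> ssq (e Y) * N"
        using e_less[of Y] Y that N by (intro mult_right_mono ssq_antimono) auto
      finally have "Y\<^sup>2 / (N * ssq (e Y)) < 1" using s N by (simp add: field_simps)
      then show "0 < dens (e Y) * (1 - Y\<^sup>2 / (N * ssq (e Y)))"
        using dens_pos[OF e_le[OF Y]] by simp
    qed
    show "continuous_on {X..u} (\<lambda>Y. dens (e Y) * Y)"
    proof (intro continuous_at_imp_continuous_on ballI)
      fix Y assume "Y \<in> {X..u}"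
      then show "isCont (\<lambda>Y. dens (e Y) * Y) Y" using X_pos by (intro DERIV_isCont[OF h_der]) auto
    qed
  qed
  with hX show False by simp
qed

text \<open>\<open>\<Phi>\<close> pairs the difference of the velocities \<open>(p, q)\<close> and
  \<open>(u, 0)\<close> with the difference of their mass fluxes. With \<open>s\<close> the speed of
  \<open>(p, q)\<close>, the bound \<open>p \<le> s\<close> reduces it to the scalar expression
  \<open>(mflux s - mflux u) * (s - u)\<close>, which is positive unless \<open>s = u\<close>; in
  that case only \<open>p = u\<close> makes \<open>\<Phi>\<close> vanish.\<close>

lemma subsonic_flux_monotone:
  assumes sub: "p\<^sup>2 + q\<^sup>2 < cs\<^sup>2" and u: "0 < u" "u < cs"
  defines "\<Phi> \<equiv> (p - u) * (dens (p\<^sup>2 + q\<^sup>2) * p - dens (u\<^sup>2) * u) + dens (p\<^sup>2 + q\<^sup>2) * q\<^sup>2"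
  shows "0 \<le> \<Phi>" "\<Phi> = 0 \<Longrightarrow> p = u \<and> q = 0"
proof -
  define s where "s = sqrt (p\<^sup>2 + q\<^sup>2)"
  define a b where "a = dens (s\<^sup>2)" and "b = dens (u\<^sup>2)"
  have s2: "s\<^sup>2 = p\<^sup>2 + q\<^sup>2" by (simp add: s_def)
  have s: "0 \<le> s" "s < cs" "p \<le> s"
    using sub cs_pos by (auto simp: s_def real_less_lsqrt real_le_rsqrt)
  have "u\<^sup>2 < cs\<^sup>2" using u by (intro power_strict_mono) auto
  then have ab: "0 < a" "0 < b"
    using sub cs_sq_less_qm_sq by (auto simp: a_def b_def s2 intro!: dens_pos)
  have \<Phi>: "\<Phi> = a * s\<^sup>2 + b * u\<^sup>2 - (a + b) * (p * u)"
    unfolding \<Phi>_def s2[symmetric] a_def[symmetric] b_def[symmetric]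
    using s2 by (simp add: algebra_simps power2_eq_square)
  have "(a + b) * (p * u) \<le> (a + b) * (s * u)"
    using ab s u by (intro mult_left_mono mult_right_mono) auto
  then have ge: "(mflux s - mflux u) * (s - u) \<le> \<Phi>"
    unfolding \<Phi> mflux_def a_def[symmetric] b_def[symmetric] by (simp add: algebra_simps power2_eq_square)
  have sgn: "0 < (mflux s - mflux u) * (s - u)" if "s \<noteq> u"
    using that mflux_strict_mono[of s u] mflux_strict_mono[of u s] s u
    by (cases s u rule: linorder_cases) (auto intro: mult_pos_pos mult_neg_neg)
  show "0 \<le> \<Phi>" using ge sgn by (cases "s = u") auto
  assume z: "\<Phi> = 0"
  with ge sgn have su: "s = u" by force
  then have "a = b" by (simp add: a_def b_def)
  with z su have "2 * a * u * (u - p) = 0" unfolding \<Phi> by (simp add: algebra_simps power2_eq_square)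
  then have "p = u" using ab u by simp
  moreover from this have "q = 0" using s2 su by simp
  ultimately show "p = u \<and> q = 0" by simp
qed

end

section \<open>Nondivergence form of the equation and characteristics of the background flow\<close>

context nozzle_flow
begin

text \<open>The potential flow equation in nondivergence form, that is, divided by the density and
  multiplied by the squared sound speed.\<close>

definition flow_op :: "real \<Rightarrow> real \<Rightarrow> real \<Rightarrow> real \<Rightarrow> real \<Rightarrow> real \<Rightarrow> real \<Rightarrow> real" where
  "flow_op x p q P1 P2 Q1 Q2 = (let e = p\<^sup>2 + q\<^sup>2 / (n x)\<^sup>2 in
     (ssq e - p\<^sup>2) * P1 - p * q / (n x)\<^sup>2 * (Q1 + P2) + (ssq e / (n x)\<^sup>2 - q\<^sup>2 / (n x)^4) * Q2
     + deriv n x / n x * (ssq e * p + p * q\<^sup>2 / (n x)\<^sup>2))"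

text \<open>The bridge between the two forms of the equation: the divergence form is tested
  downstream, the nondivergence form is linearised upstream. Continuity of the flux derivatives is
  recorded for the divergence theorem.\<close>

lemma flux_partials:
  fixes p q P1 P2 Q1 Q2 :: "real \<times> real \<Rightarrow> real"
  defines "e \<equiv> \<lambda>z. (p z)\<^sup>2 + (q z)\<^sup>2 / (n (fst z))\<^sup>2"
  assumes A: "A \<subseteq> Omega"
    and p: "\<And>z. z \<in> A \<Longrightarrow> grad_within p (P1 z) (P2 z) z A"
    and q: "\<And>z. z \<in> A \<Longrightarrow> grad_within q (Q1 z) (Q2 z) z A"
    and cont: "continuous_on A P1" "continuous_on A P2" "continuous_on A Q1" "continuous_on A Q2"
    and e: "\<And>z. z \<in> A \<Longrightarrow> e z < qm\<^sup>2"
  obtains F11 F12 F21 F22 where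
    "continuous_on A F11" "continuous_on A F12" "continuous_on A F21" "continuous_on A F22"
    "\<And>z. z \<in> A \<Longrightarrow> grad_within (\<lambda>z. n (fst z) * dens (e z) * p z) (F11 z) (F12 z) z A"
    "\<And>z. z \<in> A \<Longrightarrow> grad_within (\<lambda>z. dens (e z) / n (fst z) * q z) (F21 z) (F22 z) z A"
    "\<And>z. z \<in> A \<Longrightarrow> F11 z + F22 z = n (fst z) * dens (e z) / ssq (e z) *
       flow_op (fst z) (p z) (q z) (P1 z) (P2 z) (Q1 z) (Q2 z)"
proof -
  define N where "N z = n (fst z)" for z :: "real \<times> real"
  define N' where "N' z = deriv n (fst z)" for z :: "real \<times> real"
  define I where "I z = 1 / N z" for z
  define R where "R z = dens (e z)" for z
  define S where "S z = ssq (e z)" for z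
  have fstA: "fst ` A \<subseteq> {0..1}" using A by (auto simp: Omega_def)
  have N_pos: "0 < N z" if "z \<in> A" for z using fstA that n_pos by (auto simp: N_def)
  have S_pos: "0 < S z" if "z \<in> A" for z using e[OF that] ssq_pos_iff by (simp add: S_def)
  have N_grad: "grad_within N (N' z) 0 z A" if "z \<in> A" for z
    unfolding N_def[abs_def] N'_def using that fstA
    by (intro grad_within_fst[where S = UNIV] n_deriv) auto
  have I_grad: "grad_within I (- N' z / (N z)\<^sup>2) 0 z A" if z: "z \<in> A" for z
  proof -
    have "((\<lambda>x. 1 / x) has_real_derivative - 1 / (N z)\<^sup>2) (at (N z) within UNIV)"
      using N_pos[OF z] by (auto intro!: derivative_eq_intros simp: power2_eq_square)
    from grad_within_chain[OF N_grad[OF z] this] show ?thesis by (simp add: I_def[abs_def])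
  qed
  define e1 where "e1 z = 2 * p z * P1 z + 2 * q z * I z * (Q1 z * I z - q z * N' z / (N z)\<^sup>2)" for z
  define e2 where "e2 z = 2 * p z * P2 z + 2 * q z * I z * (Q2 z * I z)" for z
  have e_grad: "grad_within e (e1 z) (e2 z) z A" if z: "z \<in> A" for z
  proof -
    have "e = (\<lambda>z. p z * p z + (q z * I z) * (q z * I z))"
      by (simp add: e_def I_def N_def power2_eq_square fun_eq_iff)
    moreover have "grad_within (\<lambda>z. p z * p z + (q z * I z) * (q z * I z)) (e1 z) (e2 z) z A"
      using grad_within_add[OF grad_within_mult[OF p[OF z] p[OF z]]
          grad_within_mult[OF grad_within_mult[OF q[OF z] I_grad[OF z]] grad_within_mult[OF q[OF z] I_grad[OF z]]]]
      by (simp add: e1_def e2_def algebra_simps)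
    ultimately show ?thesis by simp
  qed
  define D where "D z = - R z / (2 * S z)" for z
  have R_grad: "grad_within R (D z * e1 z) (D z * e2 z) z A" if z: "z \<in> A" for z
    unfolding R_def[abs_def] D_def S_def
    by (rule grad_within_chain[OF e_grad[OF z], where S = UNIV]) (use dens_deriv[OF e[OF z]] in simp_all)
  define F11 where "F11 z = (N' z * R z + N z * (D z * e1 z)) * p z + N z * R z * P1 z" for z
  define F12 where "F12 z = (0 * R z + N z * (D z * e2 z)) * p z + N z * R z * P2 z" for z
  define F21 where "F21 z = (D z * e1 z * I z + R z * (- N' z / (N z)\<^sup>2)) * q z + R z * I z * Q1 z" for z
  define F22 where "F22 z = (D z * e2 z * I z + R z * 0) * q z + R z * I z * Q2 z" for z
  have pq_cont: "continuous_on A p" "continuous_on A q"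
    by (rule grad_within_imp_continuous_on, erule p q)+
  have N_cont: "continuous_on A N" and I_cont: "continuous_on A I" and R_cont: "continuous_on A R"
    by (rule grad_within_imp_continuous_on, erule N_grad I_grad R_grad)+
  have N'_cont: "continuous_on A N'"
    unfolding N'_def[abs_def]
    by (rule continuous_on_compose2[OF deriv_n_cont _ fstA]) (intro continuous_intros)
  have S_cont: "continuous_on A S"
    unfolding S_def[abs_def] ssq_def
    by (intro continuous_intros grad_within_imp_continuous_on[of A e e1 e2] e_grad)
  have D_cont: "continuous_on A D"
    unfolding D_def[abs_def] using S_pos
    by (intro continuous_intros R_cont S_cont) force
  have e_cont: "continuous_on A e1" "continuous_on A e2"
    unfolding e1_def[abs_def] e2_def[abs_def] using N_pos
    by (intro continuous_intros pq_cont cont N_cont N'_cont I_cont; force)+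
  show ?thesis
  proof (rule that)
    show "continuous_on A F11" "continuous_on A F12"
      unfolding F11_def[abs_def] F12_def[abs_def]
      by (intro continuous_intros pq_cont cont N_cont N'_cont I_cont D_cont R_cont e_cont)+
    show "continuous_on A F21"
      unfolding F21_def[abs_def] using N_pos
      by (intro continuous_intros pq_cont cont N_cont N'_cont I_cont D_cont R_cont e_cont) force
    show "continuous_on A F22"
      unfolding F22_def[abs_def]
      by (intro continuous_intros pq_cont cont N_cont N'_cont I_cont D_cont R_cont e_cont)
    fix z assume z: "z \<in> A"
    show "grad_within (\<lambda>z. n (fst z) * dens (e z) * p z) (F11 z) (F12 z) z A"
      using grad_within_mult[OF grad_within_mult[OF N_grad[OF z] R_grad[OF z]] p[OF z]]
      by (simp only: F11_def F12_def N_def R_def)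
    show "grad_within (\<lambda>z. dens (e z) / n (fst z) * q z) (F21 z) (F22 z) z A"
      using grad_within_mult[OF grad_within_mult[OF R_grad[OF z] I_grad[OF z]] q[OF z]]
      by (simp add: F21_def F22_def N_def R_def I_def[abs_def])
    define m s r p' q' where "m = N z" and "s = S z" and "r = R z" and "p' = p z" and "q' = q z"
    have ms: "m \<noteq> 0" "s \<noteq> 0" using N_pos[OF z] S_pos[OF z] by (auto simp: m_def s_def)
    have "F11 z + F22 z = m * r / s *
       ((s - p'\<^sup>2) * P1 z - p' * q' / m\<^sup>2 * (Q1 z + P2 z)
        + (s / m\<^sup>2 - q'\<^sup>2 / m^4) * Q2 z + N' z / m * (s * p' + p' * q'\<^sup>2 / m\<^sup>2))"
      unfolding F11_def F22_def e1_def e2_def D_def I_def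
        m_def[symmetric] s_def[symmetric] r_def[symmetric] p'_def[symmetric] q'_def[symmetric]
      using ms by (simp add: field_simps power2_eq_square power4_eq_xxxx)
    then show "F11 z + F22 z = n (fst z) * dens (e z) / ssq (e z) *
       flow_op (fst z) (p z) (q z) (P1 z) (P2 z) (Q1 z) (Q2 z)"
      by (simp only: flow_op_def Let_def e_def m_def s_def r_def p'_def q'_def N_def S_def R_def N'_def)
  qed
qed

lemma usup_ode: "x \<in> {0..1} \<Longrightarrow>
   (ssq ((usup x)\<^sup>2) - (usup x)\<^sup>2) * ode_rhs x (usup x) + deriv n x / n x * (ssq ((usup x)\<^sup>2) * usup x) = 0"
proof -
  assume x: "x \<in> {0..1}"
  have "(s - w) * (a * (b / (w - s))) + a * b = 0" if "s \<noteq> w" for s w a b :: real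
    using that by (simp add: divide_simps) (simp add: algebra_simps)
  moreover have "ssq ((usup x)\<^sup>2) \<noteq> (usup x)\<^sup>2"
    using usup_not_sonic[OF x] by (simp add: csq_eq)
  ultimately show ?thesis unfolding ode_rhs_def csq_eq .
qed

text \<open>The principal part on the left has the coefficients of the background flow; every error term
  on the right contains the factor \<open>p - u\<close> or \<open>q\<close>.\<close>

lemma perturbation_identity:
  fixes p q P1 P2 Q1 Q2 x :: real
  assumes x: "x \<in> {0..1}"
  defines "e \<equiv> p\<^sup>2 + q\<^sup>2 / (n x)\<^sup>2" and "u \<equiv> usup x" and "u' \<equiv> ode_rhs x (usup x)" and "g \<equiv> (\<gamma> - 1) / 2"
  assumes pde: "flow_op x p q P1 P2 Q1 Q2 = 0"
  shows "(u\<^sup>2 - ssq (u\<^sup>2)) * (P1 - u') - ssq (u\<^sup>2) / (n x)\<^sup>2 * Q2 =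
     - ((g + 1) * (p + u) * P1 + g * (p + u) / (n x)\<^sup>2 * Q2 - deriv n x / n x * (ssq e - g * (p + u) * u)) * (p - u)
     - (g * q / (n x)\<^sup>2 * P1 + p / (n x)\<^sup>2 * (Q1 + P2) + (g + 1) * q / (n x)^4 * Q2
          + deriv n x / n x * (g * u * q / (n x)\<^sup>2 - p * q / (n x)\<^sup>2)) * q"
proof -
  define d i where "d = deriv n x / n x" and "i = 1 / (n x)\<^sup>2"
  have i4: "a / (n x)^4 = a * i * i" for a by (simp add: i_def power2_eq_square power4_eq_xxxx)
  have i2: "a / (n x)\<^sup>2 = a * i" for a by (simp add: i_def)
  have s: "ssq e = c0\<^sup>2 - g * (p\<^sup>2 + q\<^sup>2 * i)" "ssq (u\<^sup>2) = c0\<^sup>2 - g * u\<^sup>2"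
    by (simp_all add: ssq_def e_def g_def i_def)
  have "(ssq (u\<^sup>2) - u\<^sup>2) * u' + d * (ssq (u\<^sup>2) * u) = 0"
    using usup_ode[OF x] by (simp add: u_def u'_def d_def)
  with pde[unfolded flow_op_def Let_def, folded e_def] show ?thesis
    unfolding i4 i2 d_def[symmetric] s by algebra
qed

text \<open>The square is the ratio of the two coefficients on the left of
  \<open>perturbation_identity\<close>, so this is the angular slope of the characteristics as
  graphs over the axial coordinate: the tangent of the Mach angle divided by
  \<open>n x\<close>.\<close>

definition char_speed :: "real \<Rightarrow> real" where
  "char_speed x = sqrt (ssq ((usup x)\<^sup>2) / ((n x)\<^sup>2 * ((usup x)\<^sup>2 - ssq ((usup x)\<^sup>2))))"

text \<open>In this coordinate the characteristics of the supersonic background flow have slope 1.\<close>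

definition char_coord :: "real \<Rightarrow> real" where
  "char_coord x = integral {0..x} char_speed"

lemma usup_sq:
  assumes "x \<in> {0..1}"
  shows "0 < ssq ((usup x)\<^sup>2)" "0 < (usup x)\<^sup>2 - ssq ((usup x)\<^sup>2)" "(usup x)\<^sup>2 < qm\<^sup>2" "0 < usup x"
proof -
  show "0 < usup x" using usup(1)[OF assms] cs_pos by simp
  then show "(usup x)\<^sup>2 < qm\<^sup>2" using usup(2)[OF assms] by (intro power_strict_mono) auto
  then show "0 < ssq ((usup x)\<^sup>2)" using ssq_pos_iff by simp
  show "0 < (usup x)\<^sup>2 - ssq ((usup x)\<^sup>2)" using usup_not_sonic[OF assms] by (simp add: csq_eq)
qed

lemma char_speed_sq:
  assumes "x \<in> {0..1}"
  shows "(char_speed x)\<^sup>2 = ssq ((usup x)\<^sup>2) / ((n x)\<^sup>2 * ((usup x)\<^sup>2 - ssq ((usup x)\<^sup>2)))"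
    and "0 < char_speed x"
  using usup_sq[OF assms] n_pos[OF assms] by (simp_all add: char_speed_def)

text \<open>The Riemann invariants contain the characteristic speed as a factor, so
  \<open>cone_uniqueness\<close> needs its derivative, bounded up to the entry.\<close>

lemma char_speed_deriv:
  obtains k' where "continuous_on {0..1} k'"
    "\<And>x. x \<in> {0..1} \<Longrightarrow> (char_speed has_real_derivative k' x) (at x within {0..1})"
proof -
  define a where "a x = ssq ((usup x)\<^sup>2)" for x
  define a' where "a' x = - (\<gamma> - 1) * usup x * ode_rhs x (usup x)" for x
  define b where "b x = (n x)\<^sup>2 * ((usup x)\<^sup>2 - a x)" for x
  define b' where "b' x = 2 * n x * deriv n x * ((usup x)\<^sup>2 - a x) +
     (n x)\<^sup>2 * (2 * usup x * ode_rhs x (usup x) - a' x)" for x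
  have cont: "continuous_on {0..1} a" "continuous_on {0..1} a'"
    unfolding a_def[abs_def] a'_def[abs_def] ssq_def
    by (intro continuous_intros usup_cont usup_deriv_cont)+
  have contb: "continuous_on {0..1} b" "continuous_on {0..1} b'"
    unfolding b_def[abs_def] b'_def[abs_def]
    by (intro continuous_intros usup_cont usup_deriv_cont cont n_cont deriv_n_cont)+
  have pos: "0 < a x" "0 < b x" "0 < a x / b x" if "x \<in> {0..1}" for x
    using usup_sq[OF that] n_pos[OF that] by (auto simp: a_def b_def)
  have a_der: "(a has_real_derivative a' x) (at x within {0..1})" if x: "x \<in> {0..1}" for x
    unfolding a_def[abs_def] a'_def ssq_def
    by (rule derivative_eq_intros usup(4)[OF x] refl)+ (simp add: field_simps)
  have b_der: "(b has_real_derivative b' x) (at x within {0..1})" if x: "x \<in> {0..1}" for x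
    unfolding b_def[abs_def] b'_def
    by (rule derivative_eq_intros usup(4)[OF x] a_der[OF x] has_field_derivative_at_within[OF n_deriv[OF x]] refl)+
      (simp add: algebra_simps)
  define k' where "k' x = inverse (sqrt (a x / b x)) / 2 * ((a' x * b x - a x * b' x) / (b x * b x))" for x
  show ?thesis
  proof (rule that)
    show "continuous_on {0..1} k'"
      unfolding k'_def[abs_def]
    proof (intro continuous_intros cont contb)
      show "\<forall>x\<in>{0..1}. b x \<noteq> 0" "\<forall>x\<in>{0..1}. b x * b x \<noteq> 0" "\<forall>x\<in>{0..1}. sqrt (a x / b x) \<noteq> 0"
        using pos by (metis less_irrefl mult_eq_0_iff real_sqrt_eq_0_iff)+
    qed auto
    fix x :: real assume x: "x \<in> {0..1}"
    have "((\<lambda>x. a x / b x) has_real_derivative (a' x * b x - a x * b' x) / (b x * b x)) (at x within {0..1})"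
      using pos(2)[OF x] by (intro DERIV_divide a_der b_der x) auto
    from DERIV_chain2[OF DERIV_real_sqrt[OF pos(3)[OF x]] this]
    show "(char_speed has_real_derivative k' x) (at x within {0..1})"
      by (simp add: char_speed_def[abs_def] k'_def a_def b_def)
  qed
qed

lemma char_coord_deriv:
  assumes "x \<in> {0..1}"
  shows "(char_coord has_real_derivative char_speed x) (at x within {0..1})"
proof -
  obtain k' where "\<And>x. x \<in> {0..1} \<Longrightarrow> (char_speed has_real_derivative k' x) (at x within {0..1})"
    using char_speed_deriv by blast
  then have "continuous_on {0..1} char_speed" by (rule DERIV_continuous_on)
  then show ?thesis unfolding char_coord_def[abs_def] using assms by (rule integral_has_real_derivative)
qed

lemma char_coord_strict_mono:
  assumes "0 \<le> x" "x < y" "y \<le> 1" shows "char_coord x < char_coord y"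
  by (rule mono_of_positive_derivative[OF char_speed_sq(2) char_coord_deriv assms])

lemma char_coord_less_iff:
  assumes "x \<in> {0..1}" "y \<in> {0..1}" shows "char_coord x < char_coord y \<longleftrightarrow> x < y"
  using assms char_coord_strict_mono[of x y] char_coord_strict_mono[of y x]
  by (cases x y rule: linorder_cases) auto

lemma rho_speed: "rho \<gamma> c0 (speed n x g) = dens ((fst g)\<^sup>2 + (snd g)\<^sup>2 / (n x)\<^sup>2)"
  by (simp add: rho_eq speed_def)

lemma speed_sq: "(speed n x g)\<^sup>2 = (fst g)\<^sup>2 + (snd g)\<^sup>2 / (n x)\<^sup>2"
  by (simp add: speed_def)

lemma speed_nonneg: "0 \<le> speed n x g"
  by (simp add: speed_def)

end

section \<open>The supersonic region\<close>

text \<open>One gradient field \<open>G\<close> is fixed throughout. It is tied to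
  \<open>\<phi>\<close> off the shock; on the shock curve its values are arbitrary and only the
  one-sided limits carry information.\<close>

locale shock_solution = nozzle_flow +
  fixes c1 :: real and \<phi> :: "real \<times> real \<Rightarrow> real" and xs :: "real \<Rightarrow> real" and G :: "real \<times> real \<Rightarrow> real \<times> real"
  assumes c1: "0 < c1" "c1 < cstar \<gamma> c0"
    and xs_C1: "xs C1_differentiable_on UNIV"
    and xs_periodic: "\<And>t. xs (t + 2 * pi) = xs t"
    and xs_bounds: "\<And>t. 0 < xs t" "\<And>t. xs t < 1"
    and \<phi>_periodic: "\<And>x y. \<phi> (x, y + 2 * pi) = \<phi> (x, y)"
    and lipschitz: "\<exists>L. L-lipschitz_on Omega \<phi>"
    and C2_minus: "C2_on (Omega_minus xs) \<phi>" and C2_plus: "C2_on (Omega_plus xs) \<phi>"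
    and G_minus: "\<And>z. z \<in> Omega_minus xs \<Longrightarrow>
       (\<phi> has_derivative (\<lambda>h. fst (G z) * fst h + snd (G z) * snd h)) (at z within Omega_minus xs)"
    and G_plus: "\<And>z. z \<in> Omega_plus xs \<Longrightarrow>
       (\<phi> has_derivative (\<lambda>h. fst (G z) * fst h + snd (G z) * snd h)) (at z within Omega_plus xs)"
    and supersonic: "\<And>z. z \<in> Omega_minus xs \<Longrightarrow> cs < speed n (fst z) (G z) \<and> speed n (fst z) (G z) < qm"
    and subsonic: "\<And>z. z \<in> Omega_plus xs \<Longrightarrow> speed n (fst z) (G z) < cs"
    and pde: "\<And>z. z \<in> Omega_minus xs \<union> Omega_plus xs \<Longrightarrow> 0 < fst z \<Longrightarrow> fst z < 1 \<Longrightarrow>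
         (\<exists>d1 d2.
           ((\<lambda>t. n t * rho \<gamma> c0 (speed n t (G (t, snd z))) * fst (G (t, snd z)))
               has_real_derivative d1) (at (fst z)) \<and>
           ((\<lambda>s. rho \<gamma> c0 (speed n (fst z) (G (fst z, s))) / n (fst z) * snd (G (fst z, s)))
               has_real_derivative d2) (at (snd z)) \<and>
           (d1 + d2) / n (fst z) = 0)"
    and G_entry: "\<And>y. G (0, y) = (u0, 0)"
    and G_exit: "\<And>y. speed n 1 (G (1, y)) = c1" "\<And>y. 0 \<le> fst (G (1, y))"
    and shock: "\<And>y. \<exists>gm gp.
         (G \<longlongrightarrow> gm) (at (xs y, y) within Omega_minus xs) \<and>
         (G \<longlongrightarrow> gp) (at (xs y, y) within Omega_plus xs) \<and>
         (rho \<gamma> c0 (speed n (xs y) gm) *\<^sub>R gradON n (xs y) gm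
            - rho \<gamma> c0 (speed n (xs y) gp) *\<^sub>R gradON n (xs y) gp) \<bullet> shock_normal n xs y = 0"
begin

abbreviation "OM \<equiv> Omega_minus xs"
abbreviation "OP \<equiv> Omega_plus xs"

definition en :: "real \<times> real \<Rightarrow> real" where
  "en z = (fst (G z))\<^sup>2 + (snd (G z))\<^sup>2 / (n (fst z))\<^sup>2"

lemma mem_OM: "z \<in> OM \<longleftrightarrow> 0 \<le> fst z \<and> fst z < xs (snd z)"
  using xs_bounds[of "snd z"] by (auto simp: Omega_minus_def Omega_def mem_Times_iff)

lemma mem_OP: "z \<in> OP \<longleftrightarrow> xs (snd z) < fst z \<and> fst z \<le> 1"
  using xs_bounds[of "snd z"] by (auto simp: Omega_plus_def Omega_def mem_Times_iff)

lemma OM_Omega: "OM \<subseteq> Omega" and OP_Omega: "OP \<subseteq> Omega"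
  by (auto simp: Omega_minus_def Omega_plus_def)

lemma xs_deriv: "(xs has_real_derivative deriv xs t) (at t)"
  and deriv_xs_cont: "continuous_on UNIV (deriv xs)"
proof -
  obtain D where D: "\<And>x. (xs has_vector_derivative D x) (at x)" "continuous_on UNIV D"
    using xs_C1 unfolding C1_differentiable_on_def by auto
  then have der: "(xs has_real_derivative D t) (at t)" for t
    by (simp add: has_real_derivative_iff_has_vector_derivative)
  then have "deriv xs = D" by (intro ext DERIV_imp_deriv)
  with der D show "(xs has_real_derivative deriv xs t) (at t)" "continuous_on UNIV (deriv xs)" by auto
qed

lemma xs_isCont: "isCont xs t"
  by (rule DERIV_isCont[OF xs_deriv])

lemma xs_cont: "continuous_on S xs"
  using xs_isCont by (intro continuous_at_imp_continuous_on) auto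

lemma xs_snd_cont: "continuous_on S (\<lambda>z::real\<times>real. xs (snd z))"
  by (rule continuous_on_compose2[OF xs_cont[of UNIV]]) (auto intro!: continuous_intros)

lemma xs_shift_tendsto: "((\<lambda>d. xs (y + d)) \<longlongrightarrow> xs y) (at_right 0)"
  by (rule isCont_tendsto_compose[OF xs_isCont]) (auto intro!: tendsto_eq_intros)

text \<open>At the entry one can move only to the right and at the exit only to the left, whence the
  sign \<open>s\<close>. A single nearby point in each coordinate direction suffices for uniqueness
  of derivatives within the region.\<close>

lemma Basis_directions:
  fixes z :: "real \<times> real"
  assumes "i \<in> Basis" "0 < e"
    and "\<forall>\<^sub>F d in at_right 0. z + d *\<^sub>R (s, 0) \<in> A" "\<forall>\<^sub>F d in at_right 0. z + d *\<^sub>R (0, 1) \<in> A"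
    and "s = 1 \<or> s = -1"
  shows "\<exists>d. 0 < \<bar>d\<bar> \<and> \<bar>d\<bar> < e \<and> z + d *\<^sub>R i \<in> A"
proof -
  have e: "\<forall>\<^sub>F d in at_right 0. 0 < d \<and> d < e"
    using eventually_at_right_real[OF \<open>0 < e\<close>] by eventually_elim auto
  have "\<exists>d. (0 < d \<and> d < e) \<and> z + d *\<^sub>R (s, 0) \<in> A" "\<exists>d. (0 < d \<and> d < e) \<and> z + d *\<^sub>R (0, 1) \<in> A"
    by (rule eventually_happens'[OF _ eventually_conj[OF e assms(3)]]
        eventually_happens'[OF _ eventually_conj[OF e assms(4)]]; simp)+
  then obtain d1 d2 where d: "0 < d1" "d1 < e" "z + d1 *\<^sub>R (s, 0) \<in> A" "0 < d2" "d2 < e" "z + d2 *\<^sub>R (0, 1) \<in> A"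
    by blast
  have "i = (1, 0) \<or> i = (0, 1)" using assms(1) by (auto simp: Basis_prod_def)
  then show ?thesis
  proof
    assume "i = (1, 0)"
    moreover have "d1 *\<^sub>R (s, 0) = (s * d1) *\<^sub>R (1::real, 0::real)" by simp
    ultimately show ?thesis using d assms(5) by (intro exI[of _ "s * d1"]) auto
  qed (use d in \<open>auto intro!: exI[of _ d2]\<close>)
qed

lemma OM_directions:
  assumes z: "z \<in> OM" and i: "i \<in> Basis" "0 < e"
  shows "\<exists>d. 0 < \<bar>d\<bar> \<and> \<bar>d\<bar> < e \<and> z + d *\<^sub>R i \<in> OM"
proof (rule Basis_directions[OF i, where s = 1])
  have zm: "0 \<le> fst z" "fst z < xs (snd z)" using z by (auto simp: mem_OM)
  show "\<forall>\<^sub>F d in at_right 0. z + d *\<^sub>R (1, 0) \<in> OM"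
    using eventually_at_right_real[of 0 "xs (snd z) - fst z"] zm
    by (auto simp: mem_OM elim!: eventually_mono)
  show "\<forall>\<^sub>F d in at_right 0. z + d *\<^sub>R (0, 1) \<in> OM"
    using order_tendstoD(1)[OF xs_shift_tendsto zm(2)] by eventually_elim (use zm in \<open>auto simp: mem_OM\<close>)
qed simp

lemma OP_directions:
  assumes z: "z \<in> OP" and i: "i \<in> Basis" "0 < e"
  shows "\<exists>d. 0 < \<bar>d\<bar> \<and> \<bar>d\<bar> < e \<and> z + d *\<^sub>R i \<in> OP"
proof (rule Basis_directions[OF i, where s = "-1"])
  have zm: "fst z \<le> 1" "xs (snd z) < fst z" using z by (auto simp: mem_OP)
  show "\<forall>\<^sub>F d in at_right 0. z + d *\<^sub>R (-1, 0) \<in> OP"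
    using eventually_at_right_real[of 0 "fst z - xs (snd z)"] zm
    by (auto simp: mem_OP elim!: eventually_mono)
  show "\<forall>\<^sub>F d in at_right 0. z + d *\<^sub>R (0, 1) \<in> OP"
    using order_tendstoD(2)[OF xs_shift_tendsto zm(2)] by eventually_elim (use zm in \<open>auto simp: mem_OP\<close>)
qed simp

definition interior_minus :: "(real \<times> real) set" where
  "interior_minus = {z. 0 < fst z \<and> fst z < xs (snd z)}"

definition interior_plus :: "(real \<times> real) set" where
  "interior_plus = {z. xs (snd z) < fst z \<and> fst z < 1}"

lemma interior_minus: "open interior_minus" "interior_minus \<subseteq> OM"
  unfolding interior_minus_def
  by (auto simp: mem_OM intro!: open_Collect_conj open_Collect_less continuous_intros xs_snd_cont)

lemma interior_plus: "open interior_plus" "interior_plus \<subseteq> OP"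
  unfolding interior_plus_def
  by (auto simp: mem_OP intro!: open_Collect_conj open_Collect_less continuous_intros xs_snd_cont)

lemma en_speed: "en z = (speed n (fst z) (G z))\<^sup>2"
  by (simp add: en_def speed_sq)

lemma en_minus: "z \<in> OM \<Longrightarrow> en z < qm\<^sup>2"
  using supersonic[of z] by (auto simp: en_speed intro!: power_strict_mono speed_nonneg)

lemma en_plus: "z \<in> OP \<Longrightarrow> en z < cs\<^sup>2"
  using subsonic[of z] by (auto simp: en_speed intro!: power_strict_mono speed_nonneg)

text \<open>Both regions are treated at once. The equation is given in the interior through
  unspecified derivatives \<open>d1\<close> and \<open>d2\<close>; there derivatives within
  \<open>A\<close> are full derivatives, so uniqueness identifies them with \<open>F11\<close> and
  \<open>F22\<close>, and \<open>flux_partials\<close> turns their sum into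
  \<open>flow_op\<close>.\<close>

lemma region_flow:
  assumes A: "A = OM \<and> U = interior_minus \<or> A = OP \<and> U = interior_plus"
  obtains P1 P2 Q1 Q2 F11 F12 F21 F22 where
    "continuous_on A P1" "continuous_on A P2" "continuous_on A Q1" "continuous_on A Q2"
    "\<And>z. z \<in> A \<Longrightarrow> grad_within (\<lambda>z. fst (G z)) (P1 z) (P2 z) z A"
    "\<And>z. z \<in> A \<Longrightarrow> grad_within (\<lambda>z. snd (G z)) (Q1 z) (Q2 z) z A"
    "\<And>z. z \<in> U \<Longrightarrow> P2 z = Q1 z"
    "continuous_on A F11" "continuous_on A F12" "continuous_on A F21" "continuous_on A F22"
    "\<And>z. z \<in> A \<Longrightarrow> grad_within (\<lambda>z. n (fst z) * dens (en z) * fst (G z)) (F11 z) (F12 z) z A"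
    "\<And>z. z \<in> A \<Longrightarrow> grad_within (\<lambda>z. dens (en z) / n (fst z) * snd (G z)) (F21 z) (F22 z) z A"
    "\<And>z. z \<in> U \<Longrightarrow> F11 z + F22 z = 0"
    "\<And>z. z \<in> U \<Longrightarrow> flow_op (fst z) (fst (G z)) (snd (G z)) (P1 z) (P2 z) (Q1 z) (Q2 z) = 0"
proof -
  have U: "open U" "U \<subseteq> A" using A interior_minus interior_plus by auto
  have A_Om: "A \<subseteq> Omega" using A OM_Omega OP_Omega by auto
  have C2: "C2_on A \<phi>" using A C2_minus C2_plus by auto
  have dir: "\<exists>d. 0 < \<bar>d\<bar> \<and> \<bar>d\<bar> < e \<and> z + d *\<^sub>R i \<in> A" if "z \<in> A" "i \<in> Basis" "0 < e" for z i e
    using A OM_directions[of z i e] OP_directions[of z i e] that by auto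
  have G: "(\<phi> has_derivative (\<lambda>h. fst (G z) * fst h + snd (G z) * snd h)) (at z within A)" if "z \<in> A" for z
    using A G_minus[of z] G_plus[of z] that by auto
  have e: "en z < qm\<^sup>2" if "z \<in> A" for z
    using A en_minus[of z] en_plus[of z] cs_sq_less_qm_sq that by fastforce
  obtain P1 P2 Q1 Q2 where P: "continuous_on A P1" "continuous_on A P2" "continuous_on A Q1" "continuous_on A Q2"
    and gP: "\<And>z. z \<in> A \<Longrightarrow> grad_within (\<lambda>z. fst (G z)) (P1 z) (P2 z) z A"
    and gQ: "\<And>z. z \<in> A \<Longrightarrow> grad_within (\<lambda>z. snd (G z)) (Q1 z) (Q2 z) z A"
    unfolding grad_within_def by (rule C2_on_partials[OF C2 dir G]) blast+
  obtain F11 F12 F21 F22 where F: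
    "continuous_on A F11" "continuous_on A F12" "continuous_on A F21" "continuous_on A F22"
    and gF1: "\<And>z. z \<in> A \<Longrightarrow> grad_within (\<lambda>z. n (fst z) * dens (en z) * fst (G z)) (F11 z) (F12 z) z A"
    and gF2: "\<And>z. z \<in> A \<Longrightarrow> grad_within (\<lambda>z. dens (en z) / n (fst z) * snd (G z)) (F21 z) (F22 z) z A"
    and sum: "\<And>z. z \<in> A \<Longrightarrow> F11 z + F22 z = n (fst z) * dens (en z) / ssq (en z) * flow_op (fst z) (fst (G z)) (snd (G z)) (P1 z) (P2 z) (Q1 z) (Q2 z)"
    by (rule flux_partials[where p = "\<lambda>z. fst (G z)" and q = "\<lambda>z. snd (G z)", OF A_Om gP gQ P])
      (use e in \<open>auto simp: en_def\<close>)
  have at_U: "at z within A = at z" if "z \<in> U" for z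
    using that U by (intro at_within_open_subset) auto
  have mixed: "P2 z = Q1 z" if z: "z \<in> U" for z
  proof (rule mixed_partials_eq[OF U z])
    show "(\<phi> has_derivative (\<lambda>h. fst (G w) * fst h + snd (G w) * snd h)) (at w)" if "w \<in> U" for w
      using G[of w] that U(2) at_U[OF that] by auto
    show "((\<lambda>z. fst (G z)) has_derivative (\<lambda>h. P1 w * fst h + P2 w * snd h)) (at w)" if "w \<in> U" for w
      using gP[of w] that U(2) at_U[OF that] by (auto simp: grad_within_def)
    show "((\<lambda>z. snd (G z)) has_derivative (\<lambda>h. Q1 w * fst h + Q2 w * snd h)) (at w)" if "w \<in> U" for w
      using gQ[of w] that U(2) at_U[OF that] by (auto simp: grad_within_def)
    show "continuous_on U P2" using P(2) U(2) by (rule continuous_on_subset)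
  qed
  have zero: "F11 z + F22 z = 0" if z: "z \<in> U" for z
  proof -
    have zA: "z \<in> A" using z U by auto
    have z01: "z \<in> OM \<union> OP" "0 < fst z" "fst z < 1"
      using A z xs_bounds[of "snd z"] by (auto simp: interior_minus_def interior_plus_def mem_OM mem_OP)
    obtain d1 d2 where
      d1: "((\<lambda>t. n t * rho \<gamma> c0 (speed n t (G (t, snd z))) * fst (G (t, snd z))) has_real_derivative d1) (at (fst z))"
      and d2: "((\<lambda>s. rho \<gamma> c0 (speed n (fst z) (G (fst z, s))) / n (fst z) * snd (G (fst z, s)))
               has_real_derivative d2) (at (snd z))"
      and d: "(d1 + d2) / n (fst z) = 0"
      using pde[OF z01] by blast
    have "((\<lambda>t. (\<lambda>z. n (fst z) * dens (en z) * fst (G z)) (t, snd z)) has_real_derivative F11 z * 1 + F12 z * 0) (at (fst z))"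
      by (rule grad_within_along[where A = UNIV])
        (use gF1[OF zA] at_U[OF z] in \<open>auto simp: grad_within_def\<close>)
    with d1 have "d1 = F11 z"
      by (intro DERIV_unique[OF d1]) (simp add: rho_speed en_def)
    moreover have "((\<lambda>s. (\<lambda>z. dens (en z) / n (fst z) * snd (G z)) (fst z, s)) has_real_derivative F21 z * 0 + F22 z * 1) (at (snd z))"
      by (rule grad_within_along[where A = UNIV])
        (use gF2[OF zA] at_U[OF z] in \<open>auto simp: grad_within_def\<close>)
    with d2 have "d2 = F22 z"
      by (intro DERIV_unique[OF d2]) (simp add: rho_speed en_def)
    moreover have "n (fst z) \<noteq> 0" using n_pos[of "fst z"] z01 by simp
    ultimately show ?thesis using d by simp
  qed
  show ?thesis
  proof (rule that[OF P gP gQ mixed F gF1 gF2 zero])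
    fix z assume z: "z \<in> U"
    then have zA: "z \<in> A" using U by auto
    then have "0 < n (fst z)" using A_Om n_pos[of "fst z"] by (auto simp: Omega_def mem_Times_iff)
    moreover have "0 < dens (en z)" "0 < ssq (en z)" using e[OF zA] dens_pos ssq_pos_iff by auto
    ultimately have "n (fst z) * dens (en z) / ssq (en z) \<noteq> 0" by simp
    with sum[OF zA] zero[OF z]
    show "flow_op (fst z) (fst (G z)) (snd (G z)) (P1 z) (P2 z) (Q1 z) (Q2 z) = 0"
      by (metis mult_eq_0_iff)
  qed
qed

end

section \<open>The upstream flow and the slope of the shock\<close>

context shock_solution
begin

text \<open>The hypothesis says that the backward cone of the shock point \<open>(xs t, t)\<close>
  does not cross the shock. An apex with \<open>X < xs t\<close> then has its cone inside
  \<open>OM\<close>, where \<open>perturbation_identity\<close> becomes a linear inequality with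
  bounded coefficients and zero data at the entry.\<close>

lemma G_on_cone:
  assumes cone: "\<And>r. char_coord (xs t) - \<bar>r - t\<bar> \<le> char_coord (xs r)" and X: "0 \<le> X" "X < xs t"
  shows "G (X, t) = (usup X, 0)"
proof -
  have X1: "X < 1" using X xs_bounds[of t] by simp
  have sub01: "{0..X} \<subseteq> {0..1}" using X1 by auto
  obtain P1 P2 Q1 Q2 F11 F12 F21 F22 where
    P_cont: "continuous_on OM P1" "continuous_on OM P2" "continuous_on OM Q1" "continuous_on OM Q2"
    and gP: "\<And>z. z \<in> OM \<Longrightarrow> grad_within (\<lambda>z. fst (G z)) (P1 z) (P2 z) z OM"
    and gQ: "\<And>z. z \<in> OM \<Longrightarrow> grad_within (\<lambda>z. snd (G z)) (Q1 z) (Q2 z) z OM"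
    and mixed: "\<And>z. z \<in> interior_minus \<Longrightarrow> P2 z = Q1 z"
    and flow: "\<And>z. z \<in> interior_minus \<Longrightarrow> flow_op (fst z) (fst (G z)) (snd (G z)) (P1 z) (P2 z) (Q1 z) (Q2 z) = 0"
    by (rule region_flow[of OM interior_minus]) auto
  obtain k' where k': "continuous_on {0..1} k'"
    "\<And>x. x \<in> {0..1} \<Longrightarrow> (char_speed has_real_derivative k' x) (at x within {0..1})"
    using char_speed_deriv by blast
  define C where "C = backward_cone char_coord X t"
  have C_fst: "0 \<le> fst z" "fst z \<le> X" "fst z \<in> {0..1}" if "z \<in> C" for z
    using that X1 by (auto simp: C_def backward_cone_def)
  have C_OM: "C \<subseteq> OM"
  proof
    fix z assume z: "z \<in> C"
    have "char_coord (fst z) \<le> char_coord X - \<bar>snd z - t\<bar>" using z by (simp add: C_def backward_cone_def)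
    also have "\<dots> < char_coord (xs t) - \<bar>snd z - t\<bar>"
      using char_coord_strict_mono[of X "xs t"] X xs_bounds[of t] by simp
    also have "\<dots> \<le> char_coord (xs (snd z))" by (rule cone)
    finally have "fst z < xs (snd z)"
      using C_fst[OF z] xs_bounds[of "snd z"] by (subst (asm) char_coord_less_iff) auto
    then show "z \<in> OM" using C_fst[OF z] by (simp add: mem_OM)
  qed
  have fst_OM: "fst ` OM \<subseteq> {0..1}" using OM_Omega by (auto simp: Omega_def)
  have n_OM: "0 < n (fst z)" if "z \<in> OM" for z using fst_OM that n_pos by auto
  have p_cont: "continuous_on OM (\<lambda>z. fst (G z))" and q_cont: "continuous_on OM (\<lambda>z. snd (G z))"
    by (rule grad_within_imp_continuous_on, erule gP gQ)+
  have G_cont: "continuous_on OM G" using continuous_on_Pair[OF p_cont q_cont] by simp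
  have u_cont: "continuous_on OM (\<lambda>z. usup (fst z))"
    and N_cont: "continuous_on OM (\<lambda>z. n (fst z))"
    and N'_cont: "continuous_on OM (\<lambda>z. deriv n (fst z))"
    by (rule continuous_on_compose2[OF usup_cont _ fst_OM] continuous_on_compose2[OF n_cont _ fst_OM]
        continuous_on_compose2[OF deriv_n_cont _ fst_OM], intro continuous_intros)+
  define g where "g = (\<gamma> - 1) / 2"
  \<comment> \<open>\<open>\<alpha>\<close> and \<open>\<beta>\<close> are the coefficients of
    \<open>p - u\<close> and \<open>q\<close> on the right of \<open>perturbation_identity\<close>.
    Second derivatives of \<open>\<phi>\<close> occur in them, but as coefficients of a linear
    inequality they only have to be bounded on the cone.\<close>
  define \<alpha> where "\<alpha> z = (g + 1) * (fst (G z) + usup (fst z)) * P1 z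
      + g * (fst (G z) + usup (fst z)) / (n (fst z))\<^sup>2 * Q2 z
      - deriv n (fst z) / n (fst z) * (ssq (en z) - g * (fst (G z) + usup (fst z)) * usup (fst z))" for z
  define \<beta> where "\<beta> z = g * snd (G z) / (n (fst z))\<^sup>2 * P1 z + fst (G z) / (n (fst z))\<^sup>2 * (Q1 z + P2 z)
      + (g + 1) * snd (G z) / (n (fst z))^4 * Q2 z
      + deriv n (fst z) / n (fst z) * (g * usup (fst z) * snd (G z) / (n (fst z))\<^sup>2 - fst (G z) * snd (G z) / (n (fst z))\<^sup>2)" for z
  define D where "D z = (usup (fst z))\<^sup>2 - ssq ((usup (fst z))\<^sup>2)" for z :: "real \<times> real"
  have D_pos: "0 < D z" if "z \<in> OM" for z
    using fst_OM that usup_sq(2) by (auto simp: D_def)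
  have N_ne: "\<forall>z\<in>OM. n (fst z) \<noteq> 0" "\<forall>z\<in>OM. (n (fst z))\<^sup>2 \<noteq> 0" "\<forall>z\<in>OM. n (fst z) ^ 4 \<noteq> 0"
    using n_OM by (metis less_irrefl power_not_zero)+
  have en_cont: "continuous_on OM (\<lambda>z. en z)"
    unfolding en_def using N_ne by (intro continuous_intros p_cont q_cont N_cont)
  have "continuous_on OM \<alpha>"
    unfolding \<alpha>_def[abs_def] ssq_def
    by (intro continuous_intros G_cont N_cont u_cont N'_cont P_cont en_cont) (use N_ne in blast)+
  moreover have "continuous_on OM \<beta>"
    unfolding \<beta>_def[abs_def]
    by (intro continuous_intros G_cont N_cont u_cont N'_cont P_cont en_cont) (use N_ne in blast)+
  moreover have D_cont: "continuous_on OM D"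
    unfolding D_def[abs_def] ssq_def by (intro continuous_intros u_cont)
  ultimately have bd_cont: "continuous_on OM (\<lambda>z. (\<bar>\<alpha> z\<bar> + \<bar>\<beta> z\<bar>) / D z)"
    using D_pos by (intro continuous_intros) (metis less_irrefl)+
  have "compact C" unfolding C_def
    using X1 by (intro compact_backward_cone DERIV_continuous_on[OF has_field_derivative_subset[OF char_coord_deriv]]) auto
  then have "bounded ((\<lambda>z. (\<bar>\<alpha> z\<bar> + \<bar>\<beta> z\<bar>) / D z) ` C)"
    using compact_imp_bounded compact_continuous_image continuous_on_subset[OF bd_cont C_OM] by blast
  then obtain B where B_all: "\<forall>y \<in> (\<lambda>z. (\<bar>\<alpha> z\<bar> + \<bar>\<beta> z\<bar>) / D z) ` C. norm y \<le> B"
    unfolding bounded_iff by blast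
  have B: "(\<bar>\<alpha> z\<bar> + \<bar>\<beta> z\<bar>) / D z \<le> B" if "z \<in> C" for z
  proof -
    have "norm ((\<bar>\<alpha> z\<bar> + \<bar>\<beta> z\<bar>) / D z) \<le> B" using B_all that by blast
    then show ?thesis unfolding real_norm_def by linarith
  qed
  define V where "V z = fst (G z) - usup (fst z)" for z
  define V1 where "V1 z = P1 z - ode_rhs (fst z) (usup (fst z))" for z
  have gV: "grad_within V (V1 z) (P2 z) z OM" if z: "z \<in> OM" for z
  proof -
    have "grad_within (\<lambda>z. - usup (fst z)) (- ode_rhs (fst z) (usup (fst z))) 0 z OM"
      using fst_OM z
      by (intro grad_within_fst[where S = "{0..1}" and F = "\<lambda>x. - usup x"] DERIV_minus usup(4)) auto
    from grad_within_add[OF gP[OF z] this] show ?thesis by (simp add: V_def[abs_def] V1_def)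
  qed
  have apex: "(X, t) \<in> C" using X by (simp add: C_def backward_cone_def)
  have "V (X, t) = 0 \<and> snd (G (X, t)) = 0"
  proof (rule cone_uniqueness[where V = V and W = "\<lambda>z. snd (G z)" and k = char_speed and k' = k'
        and K = char_coord and X = X and t = t and ?V1.0 = V1 and ?V2.0 = P2 and ?W2.0 = Q2 and B = B,
        folded C_def])
    show "(char_speed has_real_derivative k' x) (at x within {0..X})" "(char_coord has_real_derivative char_speed x) (at x within {0..X})"
      "0 < char_speed x" if "x \<in> {0..X}" for x
      using that sub01 by (auto intro: has_field_derivative_subset[OF k'(2)]
          has_field_derivative_subset[OF char_coord_deriv] char_speed_sq(2))
    show "continuous_on {0..X} k'" using k'(1) sub01 by (rule continuous_on_subset)
    show "continuous_on C V" unfolding V_def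
      by (intro continuous_intros continuous_on_subset[OF p_cont C_OM] continuous_on_subset[OF u_cont C_OM])
    show "continuous_on C (\<lambda>z. snd (G z))" by (rule continuous_on_subset[OF q_cont C_OM])
    show "(X, t) \<in> C" by (rule apex)
  next
    fix z assume z: "z \<in> C" "0 < fst z"
    then have zOM: "z \<in> OM" using C_OM by auto
    then have zi: "z \<in> interior_minus" using z by (auto simp: interior_minus_def mem_OM)
    show "(V has_derivative (\<lambda>h. V1 z * fst h + P2 z * snd h)) (at z within C)"
      using gV[OF zOM] C_OM by (auto simp: grad_within_def intro: has_derivative_subset)
    show "((\<lambda>z. snd (G z)) has_derivative (\<lambda>h. P2 z * fst h + Q2 z * snd h)) (at z within C)"
      using gQ[OF zOM] C_OM mixed[OF zi] by (auto simp: grad_within_def intro: has_derivative_subset)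
    have D: "0 < D z" by (rule D_pos[OF zOM])
    have "D z * V1 z - ssq ((usup (fst z))\<^sup>2) / (n (fst z))\<^sup>2 * Q2 z = - \<alpha> z * V z - \<beta> z * snd (G z)"
      unfolding D_def V1_def V_def \<alpha>_def \<beta>_def en_def g_def
      by (rule perturbation_identity[OF C_fst(3)[OF z(1)] flow[OF zi]])
    moreover have "D z * ((char_speed (fst z))\<^sup>2 * Q2 z) = ssq ((usup (fst z))\<^sup>2) / (n (fst z))\<^sup>2 * Q2 z"
      using D C_fst(3)[OF z(1)] by (simp add: char_speed_sq(1) D_def[symmetric])
    ultimately have "D z * (V1 z - (char_speed (fst z))\<^sup>2 * Q2 z) = - (\<alpha> z * V z + \<beta> z * snd (G z))"
      by (simp add: right_diff_distrib)
    then have "D z * \<bar>V1 z - (char_speed (fst z))\<^sup>2 * Q2 z\<bar> = \<bar>\<alpha> z * V z + \<beta> z * snd (G z)\<bar>"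
      using D by (metis abs_minus_cancel abs_mult abs_of_pos)
    also have "\<dots> \<le> \<bar>\<alpha> z\<bar> * \<bar>V z\<bar> + \<bar>\<beta> z\<bar> * \<bar>snd (G z)\<bar>"
      by (metis abs_mult abs_triangle_ineq)
    also have "\<dots> \<le> (\<bar>\<alpha> z\<bar> + \<bar>\<beta> z\<bar>) * (\<bar>V z\<bar> + \<bar>snd (G z)\<bar>)"
      by (simp add: algebra_simps)
    also have "\<dots> \<le> (D z * B) * (\<bar>V z\<bar> + \<bar>snd (G z)\<bar>)"
      using B[OF z(1)] D by (intro mult_right_mono) (auto simp: divide_le_eq mult.commute)
    finally show "\<bar>V1 z - (char_speed (fst z))\<^sup>2 * Q2 z\<bar> \<le> B * (\<bar>V z\<bar> + \<bar>snd (G z)\<bar>)"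
      using D by (simp add: mult.assoc)
  next
    fix z assume z: "z \<in> C" "fst z = 0"
    then have "z = (0, snd z)" by (metis prod.collapse)
    then have "G z = (u0, 0)" by (metis G_entry)
    then show "V z = 0 \<and> snd (G z) = 0" using z by (simp add: V_def usup_0)
  qed
  then show ?thesis by (simp add: V_def prod_eq_iff)
qed

lemma \<phi>_cont: "continuous_on Omega \<phi>"
  using lipschitz lipschitz_on_continuous_on by blast

lemma path_at_shock:
  assumes "s = -1 \<and> A = OM \<or> s = 1 \<and> A = OP"
  shows "filterlim (\<lambda>d. (xs t + s * d, t)) (at (xs t, t) within A) (at_right 0)"
proof -
  have "((\<lambda>d. (xs t + s * d, t)) \<longlongrightarrow> (xs t, t)) (at_right 0)"
    by (auto intro!: tendsto_eq_intros)
  moreover have "\<forall>\<^sub>F d in at_right 0. (xs t + s * d, t) \<in> A \<and> (xs t + s * d, t) \<noteq> (xs t, t)"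
  proof -
    have "0 < min (xs t) (1 - xs t)" using xs_bounds[of t] by simp
    from eventually_at_right_real[OF this] show ?thesis
      by eventually_elim (use assms in \<open>auto simp: mem_OM mem_OP\<close>)
  qed
  ultimately show ?thesis by (auto simp: filterlim_at)
qed

lemma \<phi>_path_at_shock:
  assumes "s = -1 \<or> s = 1"
  shows "((\<lambda>d. \<phi> (xs t + s * d, t)) \<longlongrightarrow> \<phi> (xs t, t)) (at_right 0)"
proof (rule continuous_on_tendsto_compose[OF \<phi>_cont])
  show "((\<lambda>d. (xs t + s * d, t)) \<longlongrightarrow> (xs t, t)) (at_right 0)"
    by (auto intro!: tendsto_eq_intros)
  show "(xs t, t) \<in> Omega" using xs_bounds[of t] by (auto simp: Omega_def)
  have "0 < min (xs t) (1 - xs t)" using xs_bounds[of t] by simp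
  from eventually_at_right_real[OF this]
  show "\<forall>\<^sub>F d in at_right 0. (xs t + s * d, t) \<in> Omega"
    by eventually_elim (use assms in \<open>auto simp: Omega_def\<close>)
qed

text \<open>The tangential relation comes from the continuity of \<open>\<phi>\<close>: its
  restriction to the shock has one derivative, computed from either side. The sonic bound downstream
  is not strict since it is inherited by a limit.\<close>

lemma shock_relations:
  defines "D t \<equiv> deriv xs t"
  obtains gm gp where
    "(G \<longlongrightarrow> gm) (at (xs t, t) within OM)" "(G \<longlongrightarrow> gp) (at (xs t, t) within OP)"
    "fst gm * D t + snd gm = fst gp * D t + snd gp"
    "dens ((fst gm)\<^sup>2 + (snd gm)\<^sup>2 / (n (xs t))\<^sup>2) * (fst gm - snd gm * D t / (n (xs t))\<^sup>2)
       = dens ((fst gp)\<^sup>2 + (snd gp)\<^sup>2 / (n (xs t))\<^sup>2) * (fst gp - snd gp * D t / (n (xs t))\<^sup>2)"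
    "(fst gp)\<^sup>2 + (snd gp)\<^sup>2 / (n (xs t))\<^sup>2 \<le> cs\<^sup>2"
proof -
  obtain gm gp where gm: "(G \<longlongrightarrow> gm) (at (xs t, t) within OM)" and gp: "(G \<longlongrightarrow> gp) (at (xs t, t) within OP)"
    and RH: "(rho \<gamma> c0 (speed n (xs t) gm) *\<^sub>R gradON n (xs t) gm
            - rho \<gamma> c0 (speed n (xs t) gp) *\<^sub>R gradON n (xs t) gp) \<bullet> shock_normal n xs t = 0"
    using shock by blast
  define N where "N = n (xs t)"
  have N: "0 < N" using n_pos[of "xs t"] xs_bounds[of t] by (simp add: N_def)
  \<comment> \<open>Room to shift the shock curve into either region by any amount below
    \<open>\<delta>\<close>, for all angles near \<open>t\<close> simultaneously.\<close>
  obtain \<delta> where \<delta>: "0 < \<delta>" "\<And>s. \<bar>s - t\<bar> < 1 \<Longrightarrow> \<delta> \<le> xs s \<and> \<delta> \<le> 1 - xs s"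
  proof -
    obtain a where a: "\<And>s. s \<in> {t - 1..t + 1} \<Longrightarrow> xs a \<le> xs s"
      using continuous_attains_inf[OF _ _ xs_cont[of "{t - 1..t + 1}"]] by force
    obtain b where b: "\<And>s. s \<in> {t - 1..t + 1} \<Longrightarrow> xs s \<le> xs b"
      using continuous_attains_sup[OF _ _ xs_cont[of "{t - 1..t + 1}"]] by force
    show ?thesis
    proof (rule that[of "min (xs a) (1 - xs b)"])
      show "0 < min (xs a) (1 - xs b)" using xs_bounds by simp
      show "min (xs a) (1 - xs b) \<le> xs s \<and> min (xs a) (1 - xs b) \<le> 1 - xs s" if "\<bar>s - t\<bar> < 1" for s
        using a[of s] b[of s] that by (auto simp: abs_less_iff)
    qed
  qed
  have D_isCont: "isCont (deriv xs) t"
    using deriv_xs_cont by (simp add: continuous_on_eq_continuous_at)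
  have 1: "((\<lambda>s. \<phi> (xs s, s)) has_real_derivative fst gm * D t + snd gm) (at t)"
    unfolding D_def
  proof (rule curve_derivative_from_side[where A = OM and \<sigma> = "-1" and \<delta> = \<delta>, OF xs_deriv D_isCont \<delta>(1) _ _ G_minus gm])
    show "(xs s + - 1 * d, s) \<in> OM" if "\<bar>s - t\<bar> < 1" "0 < d" "d < \<delta>" for s d
      using \<delta>(2)[OF that(1)] that by (auto simp: mem_OM)
  qed (use \<phi>_path_at_shock[of "-1"] in \<open>auto simp: mem_OM\<close>)
  have 2: "((\<lambda>s. \<phi> (xs s, s)) has_real_derivative fst gp * D t + snd gp) (at t)"
    unfolding D_def
  proof (rule curve_derivative_from_side[where A = OP and \<sigma> = 1 and \<delta> = \<delta>, OF xs_deriv D_isCont \<delta>(1) _ _ G_plus gp])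
    show "(xs s + 1 * d, s) \<in> OP" if "\<bar>s - t\<bar> < 1" "0 < d" "d < \<delta>" for s d
      using \<delta>(2)[OF that(1)] that by (auto simp: mem_OP)
  qed (use \<phi>_path_at_shock[of 1] in \<open>auto simp: mem_OP\<close>)
  have normal: "dens ((fst gm)\<^sup>2 + (snd gm)\<^sup>2 / N\<^sup>2) * (fst gm - snd gm * D t / N\<^sup>2)
       = dens ((fst gp)\<^sup>2 + (snd gp)\<^sup>2 / N\<^sup>2) * (fst gp - snd gp * D t / N\<^sup>2)"
  proof -
    define v where "v = (1::real, - D t / N)"
    have "norm v \<noteq> 0" by (simp add: v_def zero_prod_def)
    define J where "J = dens ((fst gm)\<^sup>2 + (snd gm)\<^sup>2 / N\<^sup>2) *\<^sub>R (fst gm, snd gm / N)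
            - dens ((fst gp)\<^sup>2 + (snd gp)\<^sup>2 / N\<^sup>2) *\<^sub>R (fst gp, snd gp / N)"
    have "J \<bullet> ((1 / norm v) *\<^sub>R v) = 0"
      using RH unfolding shock_normal_def Let_def gradON_def rho_speed v_def D_def N_def J_def .
    then have "J \<bullet> v = 0" using \<open>norm v \<noteq> 0\<close> by simp
    then show ?thesis by (simp add: J_def v_def inner_prod_def algebra_simps power2_eq_square)
  qed
  have "((\<lambda>d. en (xs t + 1 * d, t)) \<longlongrightarrow> (fst gp)\<^sup>2 + (snd gp)\<^sup>2 / N\<^sup>2) (at_right 0)"
  proof -
    have G: "((\<lambda>d. G (xs t + 1 * d, t)) \<longlongrightarrow> gp) (at_right 0)"
      by (rule filterlim_compose[OF gp path_at_shock]) simp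
    have "((\<lambda>d. n (xs t + 1 * d)) \<longlongrightarrow> N) (at_right 0)"
      unfolding N_def using n_deriv[of "xs t"] xs_bounds[of t]
      by (intro isCont_tendsto_compose[of _ n] DERIV_isCont[of n "deriv n (xs t)"])
        (auto intro!: tendsto_eq_intros simp: less_imp_le)
    then show ?thesis unfolding en_def fst_conv snd_conv using N by (intro tendsto_intros G) auto
  qed
  then have "(fst gp)\<^sup>2 + (snd gp)\<^sup>2 / N\<^sup>2 \<le> cs\<^sup>2"
  proof (rule tendsto_upperbound)
    have "0 < 1 - xs t" using xs_bounds[of t] by simp
    from eventually_at_right_real[OF this]
    show "\<forall>\<^sub>F d in at_right 0. en (xs t + 1 * d, t) \<le> cs\<^sup>2"
      by eventually_elim (auto intro!: less_imp_le[OF en_plus] simp: mem_OP)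
  qed simp
  with that[OF gm gp DERIV_unique[OF 1 2]] normal show ?thesis by (simp add: N_def)
qed

lemma left_limit_on_cone:
  assumes cone: "\<And>r. char_coord (xs t) - \<bar>r - t\<bar> \<le> char_coord (xs r)"
    and gm: "(G \<longlongrightarrow> gm) (at (xs t, t) within OM)"
  shows "gm = (usup (xs t), 0)"
proof (rule tendsto_unique)
  show "((\<lambda>d. G (xs t + (-1) * d, t)) \<longlongrightarrow> gm) (at_right 0)"
    by (rule filterlim_compose[OF gm path_at_shock]) simp
  have pos: "0 < xs t" by (rule xs_bounds)
  have "((\<lambda>d. usup (xs t + (-1) * d)) \<longlongrightarrow> usup (xs t)) (at_right 0)"
  proof (rule continuous_on_tendsto_compose[OF usup_cont])
    show "((\<lambda>d. xs t + - 1 * d) \<longlongrightarrow> xs t) (at_right 0)" by (auto intro!: tendsto_eq_intros)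
    show "\<forall>\<^sub>F d in at_right 0. xs t + - 1 * d \<in> {0..1}"
      using eventually_at_right_real[OF pos] by eventually_elim (use xs_bounds(2)[of t] in auto)
  qed (use xs_bounds[of t] in auto)
  then have "((\<lambda>d. (usup (xs t + (-1) * d), 0)) \<longlongrightarrow> (usup (xs t), 0::real)) (at_right 0)"
    by (intro tendsto_intros)
  moreover have "\<forall>\<^sub>F d in at_right 0. (usup (xs t + (-1) * d), 0) = G (xs t + (-1) * d, t)"
    using eventually_at_right_real[OF pos]
    by eventually_elim (auto simp: G_on_cone[OF cone])
  ultimately show "((\<lambda>d. G (xs t + (-1) * d, t)) \<longlongrightarrow> (usup (xs t), 0)) (at_right 0)"
    by (rule Lim_transform_eventually)
qed simp

text \<open>\<open>cone_condition_from_slope\<close> asks for the slope only at points that already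
  satisfy the cone condition. At these the upstream state is the background state, and
  \<open>shock_slope_bound\<close> makes the shock flatter than the characteristics, which have
  slope 1 in \<open>char_coord\<close>.\<close>

lemma shock_in_cone: "char_coord (xs t) - \<bar>r - t\<bar> \<le> char_coord (xs r)"
proof (rule cone_condition_from_slope)
  have der: "((\<lambda>s. char_coord (xs s)) has_real_derivative char_speed (xs s) * deriv xs s) (at s)" for s
  proof (rule DERIV_chain2[where f = char_coord, OF _ xs_deriv])
    show "(char_coord has_real_derivative char_speed (xs s)) (at (xs s))"
      using char_coord_deriv[of "xs s"] xs_bounds[of s] by (auto simp: at_within_Icc_at)
  qed
  then show "continuous_on UNIV (\<lambda>s. char_coord (xs s))"
    using DERIV_isCont by (intro continuous_at_imp_continuous_on) blast
  show "0 \<le> char_coord (xs r)" for r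
    using char_coord_strict_mono[of 0 "xs r"] xs_bounds[of r] by (simp add: char_coord_def)
  fix s assume cone: "\<And>r. char_coord (xs s) - \<bar>r - s\<bar> \<le> char_coord (xs r)"
  define u where "u = usup (xs s)"
  define N where "N = n (xs s)"
  define D where "D = deriv xs s"
  have xs01: "xs s \<in> {0..1}" using xs_bounds[of s] by simp
  have N: "0 < N" using n_pos[OF xs01] by (simp add: N_def)
  obtain gm gp where gm: "(G \<longlongrightarrow> gm) (at (xs s, s) within OM)"
    and t: "fst gm * D + snd gm = fst gp * D + snd gp"
    and nrm: "dens ((fst gm)\<^sup>2 + (snd gm)\<^sup>2 / N\<^sup>2) * (fst gm - snd gm * D / N\<^sup>2)
       = dens ((fst gp)\<^sup>2 + (snd gp)\<^sup>2 / N\<^sup>2) * (fst gp - snd gp * D / N\<^sup>2)"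
    and sub: "(fst gp)\<^sup>2 + (snd gp)\<^sup>2 / N\<^sup>2 \<le> cs\<^sup>2"
    unfolding D_def N_def by (rule shock_relations[of s])
  have gm_eq: "gm = (u, 0)" unfolding u_def by (rule left_limit_on_cone[OF cone gm])
  have "ssq (u\<^sup>2) * (1 + (D / N)\<^sup>2) < u\<^sup>2"
  proof (rule shock_slope_bound[where P = "fst gp" and Q = "snd gp / N"])
    show "cs < u" "u < qm" using usup[OF xs01] by (auto simp: u_def)
    have "(fst gp * D + snd gp) / N = u * D / N" using t by (simp add: gm_eq)
    then show "fst gp * (D / N) + snd gp / N = u * (D / N)" by (simp add: add_divide_distrib)
    show "dens ((fst gp)\<^sup>2 + (snd gp / N)\<^sup>2) * (fst gp - D / N * (snd gp / N)) = dens (u\<^sup>2) * u"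
      using nrm by (simp add: gm_eq power_divide power2_eq_square mult.commute)
    show "(fst gp)\<^sup>2 + (snd gp / N)\<^sup>2 \<le> cs\<^sup>2" using sub by (simp add: power_divide)
  qed
  \<comment> \<open>With the slope \<open>D / N\<close> measured in the orthonormal frame, the bound
    from \<open>shock_slope_bound\<close> rearranges to
    \<open>(char_speed (xs s) * D)\<^sup>2 < 1\<close>.\<close>
  then have "ssq (u\<^sup>2) * D\<^sup>2 / N\<^sup>2 < u\<^sup>2 - ssq (u\<^sup>2)" by (simp add: algebra_simps power_divide)
  moreover have pos: "0 < u\<^sup>2 - ssq (u\<^sup>2)" using usup_sq[OF xs01] by (simp add: u_def)
  ultimately have "ssq (u\<^sup>2) * D\<^sup>2 / N\<^sup>2 / (u\<^sup>2 - ssq (u\<^sup>2)) < 1"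
    by (metis divide_less_eq_1_pos)
  moreover have "(char_speed (xs s) * D)\<^sup>2 = ssq (u\<^sup>2) * D\<^sup>2 / N\<^sup>2 / (u\<^sup>2 - ssq (u\<^sup>2))"
    using xs01 by (simp add: power_mult_distrib char_speed_sq u_def N_def)
  ultimately have "(char_speed (xs s) * D)\<^sup>2 < 1" by (simp only:)
  then have "\<bar>char_speed (xs s) * D\<bar> < 1" by (simp only: abs_square_less_1)
  with der[of s] show "\<exists>d. ((\<lambda>s. char_coord (xs s)) has_real_derivative d) (at s) \<and> \<bar>d\<bar> < 1"
    by (auto simp: D_def)
qed

lemma G_minus_eq: "z \<in> OM \<Longrightarrow> G z = (usup (fst z), 0)"
  using G_on_cone[OF shock_in_cone, of "fst z" "snd z"] by (simp add: mem_OM)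

text \<open>The upstream flux is \<open>(j, 0)\<close>, so the jump condition becomes the vanishing
  of the component of the flux difference along the normal \<open>(1, - deriv xs t)\<close>. In this
  form it cancels the boundary term of \<open>energy\<close>.\<close>

lemma right_limit_flux:
  obtains gp where "(G \<longlongrightarrow> gp) (at (xs t, t) within OP)"
    "n (xs t) * dens ((fst gp)\<^sup>2 + (snd gp)\<^sup>2 / (n (xs t))\<^sup>2) * fst gp - j
       - dens ((fst gp)\<^sup>2 + (snd gp)\<^sup>2 / (n (xs t))\<^sup>2) / n (xs t) * snd gp * deriv xs t = 0"
    "(fst gp)\<^sup>2 + (snd gp)\<^sup>2 / (n (xs t))\<^sup>2 \<le> cs\<^sup>2"
proof -
  obtain gm gp where gm: "(G \<longlongrightarrow> gm) (at (xs t, t) within OM)" and gp: "(G \<longlongrightarrow> gp) (at (xs t, t) within OP)"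
    and nrm: "dens ((fst gm)\<^sup>2 + (snd gm)\<^sup>2 / (n (xs t))\<^sup>2) * (fst gm - snd gm * deriv xs t / (n (xs t))\<^sup>2)
       = dens ((fst gp)\<^sup>2 + (snd gp)\<^sup>2 / (n (xs t))\<^sup>2) * (fst gp - snd gp * deriv xs t / (n (xs t))\<^sup>2)"
    and sub: "(fst gp)\<^sup>2 + (snd gp)\<^sup>2 / (n (xs t))\<^sup>2 \<le> cs\<^sup>2"
    by (rule shock_relations[of t])
  have gm_eq: "gm = (usup (xs t), 0)" by (rule left_limit_on_cone[OF shock_in_cone gm])
  have N: "0 < n (xs t)" using n_pos xs_bounds[of t] by simp
  define d where "d = dens ((fst gp)\<^sup>2 + (snd gp)\<^sup>2 / (n (xs t))\<^sup>2)"
  have "j = n (xs t) * (d * (fst gp - snd gp * deriv xs t / (n (xs t))\<^sup>2))"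
    using usup(3)[of "xs t"] xs_bounds[of t] nrm by (simp add: gm_eq mflux_def d_def)
  moreover have "N * (d * (P - q * D / N\<^sup>2)) = N * d * P - d / N * q * D" if "N \<noteq> 0" for N P q D
    using that by (simp add: field_simps power2_eq_square)
  ultimately have "n (xs t) * d * fst gp - j - d / n (xs t) * snd gp * deriv xs t = 0"
    using N by simp
  then have "n (xs t) * dens ((fst gp)\<^sup>2 + (snd gp)\<^sup>2 / (n (xs t))\<^sup>2) * fst gp - j
       - dens ((fst gp)\<^sup>2 + (snd gp)\<^sup>2 / (n (xs t))\<^sup>2) / n (xs t) * snd gp * deriv xs t = 0"
    unfolding d_def .
  with that gp sub show ?thesis by blast
qed

lemma \<phi>_minus_eq:
  assumes "z \<in> OM" shows "\<phi> z = Psup (fst z) + \<phi> (0, 0)"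
proof -
  have g\<phi>: "grad_within \<phi> (usup (fst z)) 0 z OM" if "z \<in> OM" for z
    using G_minus[OF that] G_minus_eq[OF that] by (simp add: grad_within_def)
  have "((\<lambda>y. \<phi> (0, y)) has_real_derivative 0) (at y within UNIV)" for y
    using grad_within_along[of \<phi> "usup 0" 0 "\<lambda>y. (0, y)" y OM 0 UNIV 1] g\<phi>[of "(0, y)"] xs_bounds
    by (auto simp: mem_OM)
  then have "\<exists>c. \<forall>y\<in>UNIV. \<phi> (0, y) = c" by (intro has_field_derivative_zero_constant) auto
  then have entry: "\<phi> (0, y) = \<phi> (0, 0)" for y by (metis UNIV_I)
  define y where "y = snd z"
  have "((\<lambda>x. \<phi> (x, y) - Psup x) has_real_derivative 0) (at x within {0..<xs y})" if x: "x \<in> {0..<xs y}" for x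
  proof -
    have "((\<lambda>x. \<phi> (x, y)) has_real_derivative usup x * 1 + 0 * 0) (at x within {0..<xs y})"
      using grad_within_along[of \<phi> "usup x" 0 "\<lambda>x. (x, y)" x OM 1 "{0..<xs y}" 0] g\<phi>[of "(x, y)"] x
      by (auto simp: mem_OM)
    moreover have "(Psup has_real_derivative usup x) (at x within {0..<xs y})"
      using x xs_bounds[of y] by (intro has_field_derivative_subset[OF Psup_deriv]) auto
    ultimately show ?thesis by (auto intro!: derivative_eq_intros)
  qed
  then have "\<exists>c. \<forall>x\<in>{0..<xs y}. \<phi> (x, y) - Psup x = c"
    by (intro has_field_derivative_zero_constant) auto
  then obtain c where c: "\<And>x. x \<in> {0..<xs y} \<Longrightarrow> \<phi> (x, y) - Psup x = c" by blast
  have "c = \<phi> (0, 0)" using c[of 0] xs_bounds[of y] entry[of y] by (simp add: Psup_def)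
  then show ?thesis using c[of "fst z"] assms by (simp add: mem_OM y_def)
qed

end

section \<open>The subsonic region\<close>

lemma periodic_int_shift:
  fixes f :: "real \<Rightarrow> 'a"
  assumes "\<And>y. f (y + 2 * pi) = f y" shows "f (y + 2 * pi * of_int k) = f y"
proof -
  have nat: "f (y + 2 * pi * real m) = f y" for y m
  proof (induction m)
    case (Suc m)
    have "f (y + 2 * pi * real (Suc m)) = f ((y + 2 * pi * real m) + 2 * pi)" by (simp add: algebra_simps)
    with assms Suc show ?case by simp
  qed simp
  show ?thesis
  proof (cases "0 \<le> k")
    case True
    then show ?thesis using nat[of y "nat k"] by simp
  next
    case False
    then show ?thesis using nat[of "y + 2 * pi * of_int k" "nat (-k)"] by simp
  qed
qed

lemma periodic_reduction:
  fixes y :: real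
  obtains k :: int where "y + 2 * pi * of_int k \<in> {0..2 * pi}"
proof -
  define m where "m = \<lfloor>y / (2 * pi)\<rfloor>"
  have "of_int m \<le> y / (2 * pi)" "y / (2 * pi) \<le> of_int m + 1" unfolding m_def by linarith+
  then have "of_int m * (2 * pi) \<le> y" "y \<le> (of_int m + 1) * (2 * pi)"
    by (simp_all add: field_simps)
  then show ?thesis using that[of "-m"] by (simp add: algebra_simps)
qed

text \<open>Divergence theorem over one period between the curve and the exit. The substitution
  \<open>x = a y + s * (1 - a y)\<close> fixes the domain of integration, so that the integral of
  \<open>H2\<close> can be differentiated in \<open>y\<close> under the integral sign; integrating
  over a period then removes it, since \<open>a\<close> and \<open>H2\<close> agree at both
  ends.\<close>

lemma divergence_strip:
  fixes H1 H2 H11 H12 H21 H22 :: "real \<times> real \<Rightarrow> real" and a a' :: "real \<Rightarrow> real"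
  assumes a: "\<And>y. (a has_real_derivative a' y) (at y)" "continuous_on UNIV a'" "\<And>y. a y < 1"
    and A: "\<And>x y. a y \<le> x \<Longrightarrow> x \<le> 1 \<Longrightarrow> (x, y) \<in> A"
    and g1: "\<And>z. z \<in> A \<Longrightarrow> grad_within H1 (H11 z) (H12 z) z A"
    and g2: "\<And>z. z \<in> A \<Longrightarrow> grad_within H2 (H21 z) (H22 z) z A"
    and cont: "continuous_on A H11" "continuous_on A H21" "continuous_on A H22"
    and per: "a (2 * pi) = a 0" "\<And>x. a 0 \<le> x \<Longrightarrow> x \<le> 1 \<Longrightarrow> H2 (x, 2 * pi) = H2 (x, 0)"
  defines "E \<equiv> \<lambda>y. integral {a y..1} (\<lambda>x. H11 (x, y) + H22 (x, y))"
  shows "continuous_on UNIV E"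
    and "((\<lambda>y. H1 (1, y) - (H1 (a y, y) - H2 (a y, y) * a' y) - E y) has_integral 0) {0..2 * pi}"
proof -
  define X where "X s y = a y + s * (1 - a y)" for s y
  define Z where "Z w = (X (snd w) (fst w), fst w)" for w
  have X_ge: "a y \<le> X s y" "X s y \<le> 1" if "s \<in> {0..1}" for s y
  proof -
    have "0 \<le> s * (1 - a y)" "0 \<le> (1 - s) * (1 - a y)" using that a(3)[of y] by auto
    then show "a y \<le> X s y" "X s y \<le> 1" by (auto simp: X_def algebra_simps)
  qed
  have XA: "(X s y, y) \<in> A" if "s \<in> {0..1}" for s y using X_ge[OF that] A by auto
  have a_cont: "continuous_on S a" for S
    using DERIV_isCont[OF a(1)] by (intro continuous_at_imp_continuous_on) auto
  let ?Q = "UNIV \<times> cbox (0::real) 1"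
  have a_fst: "continuous_on ?Q (\<lambda>w. a (fst w))" and a'_fst: "continuous_on ?Q (\<lambda>w. a' (fst w))"
    by (rule continuous_on_compose2[OF a_cont[of UNIV]] continuous_on_compose2[OF a(2)],
        auto intro!: continuous_intros)+
  have Z_cont: "continuous_on ?Q Z"
    unfolding Z_def X_def by (intro continuous_intros a_fst)
  have Z_im: "Z ` ?Q \<subseteq> A" using XA by (auto simp: Z_def)
  have comp: "continuous_on ?Q (\<lambda>w. f (Z w))" if "continuous_on A f" for f :: "real \<times> real \<Rightarrow> real"
    by (rule continuous_on_compose2[OF that Z_cont Z_im])
  have H_cont: "continuous_on A H1" "continuous_on A H2"
    by (rule grad_within_imp_continuous_on, erule g1 g2)+
  define d where "d y s = (H11 (X s y, y) + H22 (X s y, y)) * (1 - a y)" for y s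
  have d_cont: "continuous_on ?Q (\<lambda>(y, s). d y s)"
  proof -
    have "continuous_on ?Q (\<lambda>w. (H11 (Z w) + H22 (Z w)) * (1 - a (fst w)))"
      by (intro continuous_intros comp cont a_fst)
    then show ?thesis by (simp add: d_def Z_def split_beta)
  qed
  have E_eq: "E y = integral {0..1} (d y)" for y
  proof -
    have "((\<lambda>s. (1 - a y) *\<^sub>R (H11 (X s y, y) + H22 (X s y, y))) has_integral
        integral {X 0 y..X 1 y} (\<lambda>x. H11 (x, y) + H22 (x, y))) {0..1}"
    proof (rule has_integral_substitution[of 0 1 "\<lambda>s. X s y" "a y" 1])
      show "continuous_on {a y..1} (\<lambda>x. H11 (x, y) + H22 (x, y))"
        using A by (intro continuous_intros continuous_on_compose2[OF cont(1)] continuous_on_compose2[OF cont(3)]) auto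
      show "((\<lambda>s. X s y) has_real_derivative 1 - a y) (at s within {0..1})" for s
        unfolding X_def by (auto intro!: derivative_eq_intros)
      show "(\<lambda>s. X s y) ` {0..1} \<subseteq> {a y..1}" using X_ge by auto
    qed (use X_ge[of 0 y] X_ge[of 1 y] in \<open>auto simp: X_def\<close>)
    then have "((\<lambda>s. d y s) has_integral E y) {0..1}"
      by (simp add: E_def d_def X_def mult.commute)
    then show ?thesis by (simp add: integral_unique)
  qed
  have "continuous_on UNIV (\<lambda>y. integral (cbox 0 1) (d y))"
    by (rule integral_continuous_on_param[OF d_cont])
  then show "continuous_on UNIV E" by (simp add: E_eq[abs_def])
  define I where "I y = integral (cbox 0 1) (\<lambda>s. H2 (X s y, y) * (1 - a y))" for y
  define hy where "hy y s = (H21 (X s y, y) * (a' y * (1 - s)) + H22 (X s y, y)) * (1 - a y) - H2 (X s y, y) * a' y" for y s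
  have hy_int: "(hy y has_integral E y - (H1 (1, y) - (H1 (a y, y) - H2 (a y, y) * a' y))) {0..1}" for y
  proof -
    \<comment> \<open>\<open>hy y s - d y s\<close> is the \<open>s\<close>-derivative of
      \<open>kf\<close>, so the integrals of \<open>hy\<close> and \<open>d\<close> differ only by
      values on the curve and at the exit.\<close>
    define kf where "kf s = H2 (X s y, y) * (a' y * (1 - s)) - H1 (X s y, y)" for s
    have X_der: "((\<lambda>s. X s y) has_real_derivative 1 - a y) (at s within {0..1})" for s
      unfolding X_def by (auto intro!: derivative_eq_intros)
    have "(kf has_real_derivative (hy y s - d y s)) (at s within {0..1})" if s: "s \<in> {0..1}" for s
    proof -
      have "((\<lambda>s. H (X s y, y)) has_real_derivative \<alpha> * (1 - a y) + \<beta> * 0) (at s within {0..1})"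
        if "grad_within H \<alpha> \<beta> (X s y, y) A" for H \<alpha> \<beta>
        using grad_within_along[of H _ _ "\<lambda>s. (X s y, y)" s A "1 - a y" "{0..1}" 0] that X_der XA by simp
      from this[OF g1[OF XA[OF s]]] this[OF g2[OF XA[OF s]]]
      show ?thesis unfolding kf_def
        by (auto intro!: derivative_eq_intros simp: hy_def d_def algebra_simps)
    qed
    then have "((\<lambda>s. hy y s - d y s) has_integral (kf 1 - kf 0)) {0..1}"
      by (intro fundamental_theorem_of_calculus) (auto simp: has_real_derivative_iff_has_vector_derivative[symmetric])
    moreover have "(d y has_integral E y) {0..1}"
    proof -
      have "continuous_on (cbox 0 1) (d y)"
      proof -
        have "continuous_on (cbox 0 1) (\<lambda>s. (\<lambda>(y, s). d y s) (y, s))"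
          by (rule continuous_on_compose2[OF d_cont]) (auto intro!: continuous_intros)
        then show ?thesis by simp
      qed
      then have "d y integrable_on {0..1}" using integrable_continuous by fastforce
      then show ?thesis unfolding E_eq by (rule integrable_integral)
    qed
    ultimately have "((\<lambda>s. (hy y s - d y s) + d y s) has_integral (kf 1 - kf 0) + E y) {0..1}"
      by (rule has_integral_add)
    then show ?thesis by (simp add: kf_def X_def algebra_simps)
  qed
  have I_der: "(I has_real_derivative E y - (H1 (1, y) - (H1 (a y, y) - H2 (a y, y) * a' y))) (at y)" for y
  proof -
    have "((\<lambda>y. integral (cbox 0 1) (\<lambda>s. H2 (X s y, y) * (1 - a y))) has_field_derivative
        integral (cbox 0 1) (hy y)) (at y within UNIV)"
    proof (rule leibniz_rule_field_derivative)
      show "((\<lambda>y. H2 (X s y, y) * (1 - a y)) has_field_derivative hy y s) (at y within UNIV)"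
        if s: "s \<in> cbox 0 1" for y s
      proof -
        have "((\<lambda>y. X s y) has_real_derivative a' y * (1 - s)) (at y)"
          unfolding X_def using a(1)[of y] by (auto intro!: derivative_eq_intros simp: algebra_simps)
        then have "((\<lambda>y. H2 (X s y, y)) has_real_derivative H21 (X s y, y) * (a' y * (1 - s)) + H22 (X s y, y) * 1) (at y)"
          using s XA by (intro grad_within_along[where c = "\<lambda>y. (X s y, y)" and A = A] g2) auto
        then show ?thesis using a(1)[of y] by (auto intro!: derivative_eq_intros simp: hy_def)
      qed
      show "(\<lambda>s. H2 (X s y, y) * (1 - a y)) integrable_on cbox 0 1" for y
      proof (rule integrable_continuous)
        have "continuous_on (cbox 0 1) (\<lambda>s. H2 (X s y, y))"
          using XA by (intro continuous_on_compose2[OF H_cont(2)]) (auto simp: X_def intro!: continuous_intros)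
        then show "continuous_on (cbox 0 1) (\<lambda>s. H2 (X s y, y) * (1 - a y))" by (intro continuous_intros)
      qed
      have "continuous_on ?Q (\<lambda>w. (H21 (Z w) * (a' (fst w) * (1 - snd w)) + H22 (Z w)) * (1 - a (fst w)) - H2 (Z w) * a' (fst w))"
        by (intro continuous_intros comp cont H_cont a_fst a'_fst)
      then show "continuous_on ?Q (\<lambda>(y, s). hy y s)" by (simp add: hy_def Z_def split_beta)
    qed auto
    moreover have "integral (cbox 0 1) (hy y) = E y - (H1 (1, y) - (H1 (a y, y) - H2 (a y, y) * a' y))"
      using hy_int[of y] by (simp add: integral_unique)
    ultimately show ?thesis by (simp add: I_def[abs_def])
  qed
  have "((\<lambda>y. E y - (H1 (1, y) - (H1 (a y, y) - H2 (a y, y) * a' y))) has_integral (I (2 * pi) - I 0)) {0..2 * pi}"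
    using I_der
    by (intro fundamental_theorem_of_calculus)
      (auto simp: has_real_derivative_iff_has_vector_derivative[symmetric] intro: has_field_derivative_at_within)
  moreover have "I (2 * pi) = I 0"
    unfolding I_def
  proof (rule integral_cong)
    fix s :: real assume "s \<in> cbox 0 1"
    then have "H2 (X s 0, 2 * pi) = H2 (X s 0, 0)" using X_ge[of s 0] by (intro per) auto
    then show "H2 (X s (2 * pi), 2 * pi) * (1 - a (2 * pi)) = H2 (X s 0, 0) * (1 - a 0)"
      by (simp add: X_def per(1))
  qed
  ultimately have "((\<lambda>y. - (E y - (H1 (1, y) - (H1 (a y, y) - H2 (a y, y) * a' y)))) has_integral - 0) {0..2 * pi}"
    by (intro has_integral_neg) simp
  then show "((\<lambda>y. H1 (1, y) - (H1 (a y, y) - H2 (a y, y) * a' y) - E y) has_integral 0) {0..2 * pi}"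
    by (simp add: algebra_simps)
qed

text \<open>A nondecreasing test function supported below the level \<open>k\<close>; the square
  makes it continuously differentiable, as \<open>energy\<close> requires. The kink is handled by
  writing the truncation through the differentiable function
  \<open>x * \<bar>x\<bar>\<close>.\<close>

lemma negative_part_square_deriv:
  fixes k :: real
  shows "((\<lambda>x. - ((min (x - k) 0)\<^sup>2)) has_real_derivative - 2 * min (x - k) 0) (at x)"
proof -
  have abs: "((\<lambda>x::real. x * \<bar>x\<bar>) has_real_derivative 2 * \<bar>x\<bar>) (at x)" for x
  proof (cases "x = 0")
    case True
    have "((\<lambda>h::real. \<bar>h\<bar>) \<longlongrightarrow> 0) (at 0)" by (auto intro!: tendsto_eq_intros)
    then have "((\<lambda>h::real. (h * \<bar>h\<bar> - 0) / (h - 0)) \<longlongrightarrow> 0) (at 0)"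
      by (rule Lim_transform_eventually) (auto simp: eventually_at_filter)
    with True show ?thesis by (simp add: has_field_derivative_iff)
  next
    case False
    then consider "x < 0" | "0 < x" by linarith
    then show ?thesis
    proof cases
      case 1
      have "((\<lambda>x. - (x * x)) has_real_derivative 2 * \<bar>x\<bar>) (at x)"
        using 1 by (auto intro!: derivative_eq_intros)
      then show ?thesis
        by (rule has_field_derivative_transform_within_open[of _ _ _ "{..<0}"]) (use 1 in auto)
    next
      case 2
      have "((\<lambda>x. x * x) has_real_derivative 2 * \<bar>x\<bar>) (at x)"
        using 2 by (auto intro!: derivative_eq_intros)
      then show ?thesis
        by (rule has_field_derivative_transform_within_open[of _ _ _ "{0<..}"]) (use 2 in auto)
    qed
  qed
  have "((\<lambda>x. (x - k) * \<bar>x - k\<bar>) has_real_derivative 2 * \<bar>x - k\<bar> * 1) (at x)"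
    by (rule DERIV_chain2[OF abs]) (auto intro!: derivative_eq_intros)
  moreover have "((\<lambda>x. (x - k)\<^sup>2) has_real_derivative 2 * (x - k)) (at x)"
    by (auto intro!: derivative_eq_intros)
  ultimately have "((\<lambda>x. ((x - k) * \<bar>x - k\<bar> - (x - k)\<^sup>2) / 2) has_real_derivative (2 * \<bar>x - k\<bar> * 1 - 2 * (x - k)) / 2) (at x)"
    by (intro DERIV_cdivide DERIV_diff)
  moreover have "((x - k) * \<bar>x - k\<bar> - (x - k)\<^sup>2) / 2 = - ((min (x - k) 0)\<^sup>2)" for x
    by (cases "x \<le> k") (auto simp: min_def power2_eq_square field_simps)
  moreover have "(2 * \<bar>x - k\<bar> * 1 - 2 * (x - k)) / 2 = - 2 * min (x - k) 0"
    by (auto simp: min_def)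
  ultimately show ?thesis by simp
qed

section \<open>The energy identity\<close>

context shock_solution
begin

definition wdiff :: "real \<times> real \<Rightarrow> real" where
  "wdiff z = \<phi> z - Psub (fst z)"

text \<open>\<open>flux1\<close> and \<open>flux2\<close> are the coordinate components, weighted by
  the area element, of the mass flux minus that of the background flow, which is
  \<open>(j, 0)\<close> on both branches.\<close>

definition flux1 :: "real \<times> real \<Rightarrow> real" where
  "flux1 z = n (fst z) * dens (en z) * fst (G z) - j"

definition flux2 :: "real \<times> real \<Rightarrow> real" where
  "flux2 z = dens (en z) / n (fst z) * snd (G z)"

text \<open>The gradient of \<open>wdiff\<close> paired with the flux difference. In the orthonormal
  frame it is \<open>n\<close> times the expression of
  \<open>subsonic_flux_monotone\<close>.\<close>

definition dissip :: "real \<times> real \<Rightarrow> real" where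
  "dissip z = (fst (G z) - usub (fst z)) * flux1 z + snd (G z) * flux2 z"

lemma fst_OP: "z \<in> OP \<Longrightarrow> fst z \<in> {0..1}"
  using OP_Omega by (auto simp: Omega_def mem_Times_iff)

lemma dissip_nonneg:
  assumes z: "z \<in> OP"
  shows "0 \<le> dissip z" "dissip z = 0 \<Longrightarrow> G z = (usub (fst z), 0)"
proof -
  define N p q u where "N = n (fst z)" and "p = fst (G z)" and "q = snd (G z) / n (fst z)" and "u = usub (fst z)"
  note u = usub(1,2)[OF fst_OP[OF z]]
  have N: "0 < N" using n_pos[OF fst_OP[OF z]] by (simp add: N_def)
  have e: "en z = p\<^sup>2 + q\<^sup>2" by (simp add: en_def p_def q_def power_divide)
  define M where "M = (p - u) * (dens (p\<^sup>2 + q\<^sup>2) * p - dens (u\<^sup>2) * u) + dens (p\<^sup>2 + q\<^sup>2) * q\<^sup>2"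
  have "j = N * (dens (u\<^sup>2) * u)"
    using usub(3)[OF fst_OP[OF z]] by (simp add: N_def u_def mflux_def)
  moreover have "snd (G z) = N * q" using N by (simp add: N_def q_def)
  ultimately have eq: "dissip z = N * M"
    using N unfolding dissip_def flux1_def flux2_def e N_def[symmetric] p_def[symmetric] u_def[symmetric] M_def
    by (simp add: algebra_simps power2_eq_square)
  have sub: "p\<^sup>2 + q\<^sup>2 < cs\<^sup>2" using en_plus[OF z] by (simp add: e)
  note mono = subsonic_flux_monotone[OF sub u[folded u_def], folded M_def]
  show "0 \<le> dissip z" using mono(1) N by (simp add: eq)
  assume "dissip z = 0"
  then have "p = u \<and> q = 0" using N mono(2) by (simp add: eq)
  then show "G z = (usub (fst z), 0)" using N by (simp add: p_def q_def u_def N_def prod_eq_iff)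
qed

text \<open>Periodicity is assumed for \<open>\<phi>\<close>; the gradient inherits it by uniqueness
  of the derivative within \<open>OP\<close>.\<close>

lemma G_periodic:
  assumes z: "(x, y) \<in> OP" shows "G (x, y + 2 * pi) = G (x, y)"
proof -
  have z': "(x, y + 2 * pi) \<in> OP" using z by (simp add: mem_OP xs_periodic)
  have im: "(\<lambda>z. z + (0, 2 * pi)) ` OP \<subseteq> OP" by (auto simp: mem_OP xs_periodic)
  have "((\<lambda>z. z + (0, 2 * pi)) has_derivative (\<lambda>h. h)) (at (x, y) within OP)"
    by (auto intro!: derivative_eq_intros)
  moreover have "(\<phi> has_derivative (\<lambda>h. fst (G (x, y + 2 * pi)) * fst h + snd (G (x, y + 2 * pi)) * snd h))
      (at ((x, y) + (0, 2 * pi)) within (\<lambda>z. z + (0, 2 * pi)) ` OP)"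
    using has_derivative_subset[OF G_plus[OF z'] im] by simp
  ultimately have "((\<lambda>z. \<phi> (z + (0, 2 * pi))) has_derivative
      (\<lambda>h. fst (G (x, y + 2 * pi)) * fst h + snd (G (x, y + 2 * pi)) * snd h)) (at (x, y) within OP)"
    by (rule has_derivative_in_compose)
  moreover have "\<phi> (z + (0, 2 * pi)) = \<phi> z" for z using \<phi>_periodic[of "fst z" "snd z"] by (cases z) simp
  ultimately have d: "(\<phi> has_derivative
      (\<lambda>h. fst (G (x, y + 2 * pi)) * fst h + snd (G (x, y + 2 * pi)) * snd h)) (at (x, y) within OP)" by simp
  have "(\<lambda>h. fst (G (x, y + 2 * pi)) * fst h + snd (G (x, y + 2 * pi)) * snd h) =
      (\<lambda>h. fst (G (x, y)) * fst h + snd (G (x, y)) * snd h)"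
    using frechet_derivative_unique_within[OF d G_plus[OF z]] OP_directions[OF z] by blast
  from fun_cong[OF this, of "(1, 0)"] fun_cong[OF this, of "(0, 1)"]
  show ?thesis by (simp add: prod_eq_iff)
qed

lemma wdiff_grad:
  assumes z: "z \<in> OP" shows "grad_within wdiff (fst (G z) - usub (fst z)) (snd (G z)) z OP"
proof -
  have "grad_within (\<lambda>z. - Psub (fst z)) (- usub (fst z)) 0 z OP"
    using fst_OP z by (intro grad_within_fst[where S = "{0..1}" and F = "\<lambda>x. - Psub x"] DERIV_minus Psub_deriv) auto
  from grad_within_add[OF G_plus[OF z, folded grad_within_def] this] show ?thesis
    by (simp add: wdiff_def[abs_def])
qed

text \<open>The velocity has only continuous limits at the shock, so the divergence theorem is applied above
  curves approaching it; this family stays below the exit.\<close>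

definition cutoff :: "nat \<Rightarrow> real \<Rightarrow> real" where
  "cutoff k y = xs y + (1 - xs y) / (real k + 2)"

definition cutoff' :: "nat \<Rightarrow> real \<Rightarrow> real" where
  "cutoff' k y = deriv xs y - deriv xs y / (real k + 2)"

lemma cutoff_bounds: "xs y < cutoff k y" "cutoff k y < 1"
proof -
  have p: "0 < 1 - xs y" using xs_bounds(2)[of y] by simp
  then show "xs y < cutoff k y" by (simp add: cutoff_def)
  have "(1 - xs y) / (real k + 2) < (1 - xs y) / 1" using p by (intro divide_strict_left_mono) auto
  then show "cutoff k y < 1" by (simp add: cutoff_def)
qed

lemma cutoff_antimono: "k \<le> m \<Longrightarrow> cutoff m y \<le> cutoff k y"
  using xs_bounds(2)[of y] by (auto simp: cutoff_def intro!: divide_left_mono)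

lemma cutoff_deriv: "(cutoff k has_real_derivative cutoff' k y) (at y)"
  unfolding cutoff_def[abs_def] cutoff'_def by (auto intro!: derivative_eq_intros xs_deriv)

lemma cutoff_tendsto: "(\<lambda>k. cutoff k y) \<longlonglongrightarrow> xs y" and cutoff'_tendsto: "(\<lambda>k. cutoff' k y) \<longlonglongrightarrow> deriv xs y"
proof -
  have "(\<lambda>k. 1 / (real k + 2)) \<longlonglongrightarrow> 0"
    using LIMSEQ_ignore_initial_segment[OF lim_1_over_n[where 'a = real], of 2] by (simp add: add.commute)
  then have "(\<lambda>k. xs y + (1 - xs y) * (1 / (real k + 2))) \<longlonglongrightarrow> xs y + (1 - xs y) * 0"
    "(\<lambda>k. deriv xs y - deriv xs y * (1 / (real k + 2))) \<longlonglongrightarrow> deriv xs y - deriv xs y * 0"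
    by (intro tendsto_intros; assumption)+
  then show "(\<lambda>k. cutoff k y) \<longlonglongrightarrow> xs y" "(\<lambda>k. cutoff' k y) \<longlonglongrightarrow> deriv xs y"
    by (simp_all add: cutoff_def cutoff'_def)
qed

lemma cutoff_path: "filterlim (\<lambda>k. (cutoff k y, y)) (at (xs y, y) within OP) sequentially"
proof -
  have "(\<lambda>k. (cutoff k y, y)) \<longlonglongrightarrow> (xs y, y)" by (intro tendsto_intros cutoff_tendsto)
  moreover have "(cutoff k y, y) \<in> OP \<and> (cutoff k y, y) \<noteq> (xs y, y)" for k
    using cutoff_bounds(1)[of y k] cutoff_bounds(2)[of k y] by (auto simp: mem_OP)
  ultimately show ?thesis by (simp add: filterlim_at)
qed

text \<open>The boundary term on the shock vanishes in the limit by \<open>right_limit_flux\<close>, and the divergence of the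
  tested flux is \<open>\<eta>' (wdiff z) * dissip z \<ge> 0\<close>.\<close>

lemma energy:
  fixes \<eta> \<eta>' :: "real \<Rightarrow> real"
  assumes \<eta>: "\<And>x. (\<eta> has_real_derivative \<eta>' x) (at x)" and \<eta>'_cont: "continuous_on UNIV \<eta>'"
    and \<eta>'_nonneg: "\<And>x. 0 \<le> \<eta>' x"
  defines "J \<equiv> integral {0..2 * pi} (\<lambda>y. \<eta> (wdiff (1, y)) * flux1 (1, y))"
  shows "0 \<le> J"
    and "J = 0 \<Longrightarrow> z \<in> OP \<Longrightarrow> \<eta>' (wdiff z) * dissip z = 0"
proof -
  obtain P1 P2 Q1 Q2 F11 F12 F21 F22 where
    gP: "\<And>z. z \<in> OP \<Longrightarrow> grad_within (\<lambda>z. fst (G z)) (P1 z) (P2 z) z OP"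
    and gQ: "\<And>z. z \<in> OP \<Longrightarrow> grad_within (\<lambda>z. snd (G z)) (Q1 z) (Q2 z) z OP"
    and gF1: "\<And>z. z \<in> OP \<Longrightarrow> grad_within (\<lambda>z. n (fst z) * dens (en z) * fst (G z)) (F11 z) (F12 z) z OP"
    and gF2: "\<And>z. z \<in> OP \<Longrightarrow> grad_within (\<lambda>z. dens (en z) / n (fst z) * snd (G z)) (F21 z) (F22 z) z OP"
    and flow_int: "\<And>z. z \<in> interior_plus \<Longrightarrow> F11 z + F22 z = 0"
    and F_cont: "continuous_on OP F11" "continuous_on OP F12" "continuous_on OP F21" "continuous_on OP F22"
    by (rule region_flow[of OP interior_plus], simp, rule that) blast+
  \<comment> \<open>The equation is given in the interior only, whereas the strips reach the exit;
    continuity of \<open>F11\<close> and \<open>F22\<close> on \<open>OP\<close> extends it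
    there.\<close>
  have flow: "F11 z + F22 z = 0" if z: "z \<in> OP" for z
  proof (cases "fst z < 1")
    case True
    with z show ?thesis by (intro flow_int) (auto simp: interior_plus_def mem_OP)
  next
    case False
    define y where "y = snd z"
    have zy: "z = (1, y)" using False z by (cases z) (auto simp: mem_OP y_def)
    have "continuous_on OP (\<lambda>z. F11 z + F22 z)" by (intro continuous_intros F_cont)
    then have "((\<lambda>d. (\<lambda>z. F11 z + F22 z) (1 - d, y)) \<longlongrightarrow> F11 (1, y) + F22 (1, y)) (at_right 0)"
    proof (rule continuous_on_tendsto_compose)
      have "((\<lambda>d::real. (1 - d, y)) \<longlongrightarrow> (1 - 0, y)) (at_right 0)" by (intro tendsto_intros)
      then show "((\<lambda>d::real. (1 - d, y)) \<longlongrightarrow> (1, y)) (at_right 0)" by simp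
      show "(1, y) \<in> OP" using z zy by simp
      have "0 < 1 - xs y" using xs_bounds[of y] by simp
      from eventually_at_right_real[OF this]
      show "\<forall>\<^sub>F d in at_right 0. (1 - d, y) \<in> OP" by eventually_elim (auto simp: mem_OP)
    qed
    moreover have "((\<lambda>d. (\<lambda>z. F11 z + F22 z) (1 - d, y)) \<longlongrightarrow> 0) (at_right 0)"
    proof (rule tendsto_eventually)
      have "0 < 1 - xs y" using xs_bounds[of y] by simp
      from eventually_at_right_real[OF this]
      show "\<forall>\<^sub>F d in at_right 0. F11 (1 - d, y) + F22 (1 - d, y) = 0"
        by eventually_elim (auto intro!: flow_int simp: interior_plus_def)
    qed
    ultimately show ?thesis unfolding zy by (rule tendsto_unique[rotated]) simp
  qed
  define H1 where "H1 z = \<eta> (wdiff z) * flux1 z" for z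
  define H2 where "H2 z = \<eta> (wdiff z) * flux2 z" for z
  define w1 where "w1 z = fst (G z) - usub (fst z)" for z
  define H11 where "H11 z = \<eta>' (wdiff z) * w1 z * flux1 z + \<eta> (wdiff z) * F11 z" for z
  define H12 where "H12 z = \<eta>' (wdiff z) * snd (G z) * flux1 z + \<eta> (wdiff z) * F12 z" for z
  define H21 where "H21 z = \<eta>' (wdiff z) * w1 z * flux2 z + \<eta> (wdiff z) * F21 z" for z
  define H22 where "H22 z = \<eta>' (wdiff z) * snd (G z) * flux2 z + \<eta> (wdiff z) * F22 z" for z
  have gf1: "grad_within flux1 (F11 z) (F12 z) z OP" if "z \<in> OP" for z
    using grad_within_add[OF gF1[OF that] grad_within_const[of "- j"]] by (simp add: flux1_def[abs_def])
  have gf2: "grad_within flux2 (F21 z) (F22 z) z OP" if "z \<in> OP" for z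
    using gF2[OF that] by (simp add: flux2_def[abs_def])
  have g\<eta>: "grad_within (\<lambda>z. \<eta> (wdiff z)) (\<eta>' (wdiff z) * w1 z) (\<eta>' (wdiff z) * snd (G z)) z OP" if "z \<in> OP" for z
    unfolding w1_def by (rule grad_within_chain[OF wdiff_grad[OF that], where S = UNIV]) (use \<eta> in auto)
  have gH1: "grad_within H1 (H11 z) (H12 z) z OP" if "z \<in> OP" for z
    unfolding H1_def[abs_def] H11_def H12_def by (rule grad_within_mult[OF g\<eta>[OF that] gf1[OF that]])
  have gH2: "grad_within H2 (H21 z) (H22 z) z OP" if "z \<in> OP" for z
    unfolding H2_def[abs_def] H21_def H22_def by (rule grad_within_mult[OF g\<eta>[OF that] gf2[OF that]])
  have w_cont: "continuous_on OP wdiff" and f1_cont: "continuous_on OP flux1" and f2_cont: "continuous_on OP flux2"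
    and \<eta>w_cont: "continuous_on OP (\<lambda>z. \<eta> (wdiff z))" and H1_cont: "continuous_on OP H1" and H2_cont: "continuous_on OP H2"
    by (rule grad_within_imp_continuous_on, erule wdiff_grad gf1 gf2 g\<eta> gH1 gH2)+
  have p_cont: "continuous_on OP (\<lambda>z. fst (G z))" and q_cont: "continuous_on OP (\<lambda>z. snd (G z))"
    by (rule grad_within_imp_continuous_on, erule gP gQ)+
  have G_cont: "continuous_on OP G" using continuous_on_Pair[OF p_cont q_cont] by simp
  have \<eta>'w_cont: "continuous_on OP (\<lambda>z. \<eta>' (wdiff z))"
    by (rule continuous_on_compose2[OF \<eta>'_cont w_cont]) auto
  have u_cont: "continuous_on OP (\<lambda>z. usub (fst z))"
    by (rule continuous_on_compose2[OF usub_cont]) (use fst_OP in \<open>auto intro!: continuous_intros\<close>)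
  have H_cont: "continuous_on OP H11" "continuous_on OP H21" "continuous_on OP H22"
    unfolding H11_def[abs_def] H21_def[abs_def] H22_def[abs_def] w1_def
    by (intro continuous_intros G_cont \<eta>'w_cont \<eta>w_cont u_cont f1_cont f2_cont F_cont)+
  have div: "H11 z + H22 z = \<eta>' (wdiff z) * dissip z" if "z \<in> OP" for z
  proof -
    have "H11 z + H22 z = \<eta>' (wdiff z) * dissip z + \<eta> (wdiff z) * (F11 z + F22 z)"
      by (simp add: H11_def H22_def dissip_def w1_def algebra_simps)
    then show ?thesis using flow[OF that] by simp
  qed
  have div_nonneg: "0 \<le> H11 z + H22 z" if "z \<in> OP" for z
    using div[OF that] \<eta>'_nonneg[of "wdiff z"] dissip_nonneg(1)[OF that] by simp
  define E where "E k y = integral {cutoff k y..1} (\<lambda>x. H11 (x, y) + H22 (x, y))" for k y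
  define bd where "bd k y = H1 (cutoff k y, y) - H2 (cutoff k y, y) * cutoff' k y" for k y
  have in_OP: "(x, y) \<in> OP" if "cutoff k y \<le> x" "x \<le> 1" for k x y
    using that cutoff_bounds(1)[of y k] cutoff_bounds(2)[of k y] by (simp add: mem_OP)
  have cutoff'_cont: "continuous_on S (cutoff' k)" for S k
    unfolding cutoff'_def[abs_def] by (intro continuous_intros continuous_on_subset[OF deriv_xs_cont]) auto
  have cutoff_cont: "continuous_on S (cutoff k)" for S k
    using DERIV_isCont[OF cutoff_deriv] by (intro continuous_at_imp_continuous_on) auto
  have strip: "continuous_on UNIV (E k)" "((\<lambda>y. H1 (1, y) - bd k y - E k y) has_integral 0) {0..2 * pi}" for k
  proof -
    note ds = divergence_strip[where a = "cutoff k" and a' = "cutoff' k" and A = OP, OF cutoff_deriv cutoff'_cont cutoff_bounds(2) in_OP gH1 gH2 H_cont]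
    have per: "cutoff k (2 * pi) = cutoff k 0" using xs_periodic[of 0] by (simp add: cutoff_def)
    have per2: "H2 (x, 2 * pi) = H2 (x, 0)" if "cutoff k 0 \<le> x" "x \<le> 1" for x
      using G_periodic[OF in_OP[OF that]] \<phi>_periodic[of x 0] by (simp add: H2_def flux2_def wdiff_def en_def)
    show "continuous_on UNIV (E k)" "((\<lambda>y. H1 (1, y) - bd k y - E k y) has_integral 0) {0..2 * pi}"
      unfolding E_def bd_def using ds per per2 by auto
  qed
  let ?P = "{0..2 * pi}"
  have H1_exit: "continuous_on ?P (\<lambda>y. H1 (1, y))"
    by (rule continuous_on_compose2[OF H1_cont]) (auto simp: mem_OP xs_bounds intro!: continuous_intros)
  have bd_cont: "continuous_on ?P (bd k)" for k
  proof -
    have "continuous_on ?P (\<lambda>y. H (cutoff k y, y))" if "continuous_on OP H" for H :: "real \<times> real \<Rightarrow> real"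
      by (rule continuous_on_compose2[OF that])
        (auto simp: mem_OP cutoff_bounds less_imp_le intro!: continuous_intros cutoff_cont)
    from this[OF H1_cont] this[OF H2_cont] show ?thesis
      unfolding bd_def by (intro continuous_intros cutoff'_cont)
  qed
  have E_cont: "continuous_on ?P (E k)" for k by (rule continuous_on_subset[OF strip(1)]) auto
  have int_E: "integral ?P (E k) = J - integral ?P (bd k)" for k
  proof -
    have "integral ?P (\<lambda>y. H1 (1, y) - bd k y - E k y) = J - integral ?P (bd k) - integral ?P (E k)"
      unfolding J_def H1_def[symmetric]
      by (subst integral_diff, auto intro!: integrable_continuous_real continuous_intros H1_exit bd_cont E_cont integral_diff)
    then show ?thesis using integral_unique[OF strip(2)[of k]] by simp
  qed
  have E_nonneg: "0 \<le> E k y" for k y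
    unfolding E_def by (rule integral_nonneg)
      (use in_OP div_nonneg H_cont in \<open>auto intro!: integrable_continuous_real continuous_intros
        continuous_on_compose2[OF H_cont(1)] continuous_on_compose2[OF H_cont(3)]\<close>)
  have E_mono: "E k y \<le> E m y" if "k \<le> m" for k m y
    unfolding E_def
  proof (rule integral_subset_le)
    show "{cutoff k y..1} \<subseteq> {cutoff m y..1}" using cutoff_antimono[OF that, of y] by auto
    have "0 \<le> H11 (x, y) + H22 (x, y)" if "x \<in> {cutoff m y..1}" for x
      using that by (intro div_nonneg in_OP[of m]) auto
    then show "\<forall>x\<in>{cutoff m y..1}. 0 \<le> H11 (x, y) + H22 (x, y)" by blast
    show "(\<lambda>x. H11 (x, y) + H22 (x, y)) integrable_on {cutoff k y..1}" for k
      by (intro integrable_continuous_real continuous_intros continuous_on_compose2[OF H_cont(1)] continuous_on_compose2[OF H_cont(3)])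
        (auto intro: in_OP)
    then show "(\<lambda>x. H11 (x, y) + H22 (x, y)) integrable_on {cutoff m y..1}" .
  qed
  have bd_lim: "(\<lambda>k. bd k y) \<longlonglongrightarrow> 0" for y
  proof -
    obtain gp where gp: "(G \<longlongrightarrow> gp) (at (xs y, y) within OP)"
      and zero: "n (xs y) * dens ((fst gp)\<^sup>2 + (snd gp)\<^sup>2 / (n (xs y))\<^sup>2) * fst gp - j
       - dens ((fst gp)\<^sup>2 + (snd gp)\<^sup>2 / (n (xs y))\<^sup>2) / n (xs y) * snd gp * deriv xs y = 0"
      and sub: "(fst gp)\<^sup>2 + (snd gp)\<^sup>2 / (n (xs y))\<^sup>2 \<le> cs\<^sup>2"
      using right_limit_flux by blast
    define e where "e = (fst gp)\<^sup>2 + (snd gp)\<^sup>2 / (n (xs y))\<^sup>2"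
    have xs01: "xs y \<in> {0..1}" using xs_bounds[of y] by simp
    have N: "n (xs y) \<noteq> 0" using n_pos[OF xs01] by simp
    have Gl: "(\<lambda>k. G (cutoff k y, y)) \<longlonglongrightarrow> gp" by (rule filterlim_compose[OF gp cutoff_path])
    have nl: "(\<lambda>k. n (cutoff k y)) \<longlonglongrightarrow> n (xs y)"
      by (rule isCont_tendsto_compose[OF DERIV_isCont[OF n_deriv[OF xs01]] cutoff_tendsto])
    have el: "(\<lambda>k. en (cutoff k y, y)) \<longlonglongrightarrow> e"
      unfolding en_def e_def fst_conv snd_conv using N by (intro tendsto_intros Gl nl) auto
    have "isCont dens e"
      using sub cs_sq_less_qm_sq by (intro DERIV_isCont[OF dens_deriv]) (simp add: e_def)
    then have dl: "(\<lambda>k. dens (en (cutoff k y, y))) \<longlonglongrightarrow> dens e" using el by (rule isCont_tendsto_compose)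
    have Psub_l: "(\<lambda>k. Psub (cutoff k y)) \<longlonglongrightarrow> Psub (xs y)"
    proof (rule continuous_on_tendsto_compose[OF _ cutoff_tendsto xs01])
      show "continuous_on {0..1} Psub" by (rule DERIV_continuous_on, erule Psub_deriv)
      show "\<forall>\<^sub>F k in sequentially. cutoff k y \<in> {0..1}"
        using fst_OP[OF in_OP[OF order.refl less_imp_le[OF cutoff_bounds(2)]]] by (intro always_eventually) auto
    qed
    have \<phi>l: "(\<lambda>k. \<phi> (cutoff k y, y)) \<longlonglongrightarrow> \<phi> (xs y, y)"
    proof (rule continuous_on_tendsto_compose[OF \<phi>_cont])
      show "(\<lambda>k. (cutoff k y, y)) \<longlonglongrightarrow> (xs y, y)" by (intro tendsto_intros cutoff_tendsto)
      show "(xs y, y) \<in> Omega" using xs01 by (auto simp: Omega_def)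
      show "\<forall>\<^sub>F k in sequentially. (cutoff k y, y) \<in> Omega"
        using subsetD[OF OP_Omega in_OP[OF order.refl less_imp_le[OF cutoff_bounds(2)]]] by (intro always_eventually) auto
    qed
    have \<eta>l: "(\<lambda>k. \<eta> (wdiff (cutoff k y, y))) \<longlonglongrightarrow> \<eta> (\<phi> (xs y, y) - Psub (xs y))"
      unfolding wdiff_def fst_conv
      by (rule isCont_tendsto_compose[OF DERIV_isCont[OF \<eta>]]) (intro tendsto_intros \<phi>l Psub_l)
    have "(\<lambda>k. bd k y) \<longlonglongrightarrow> \<eta> (\<phi> (xs y, y) - Psub (xs y)) * (n (xs y) * dens e * fst gp - j)
        - \<eta> (\<phi> (xs y, y) - Psub (xs y)) * (dens e / n (xs y) * snd gp) * deriv xs y"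
      unfolding bd_def H1_def H2_def flux1_def flux2_def fst_conv
      using N by (intro tendsto_intros Gl nl dl \<eta>l cutoff'_tendsto)
    also have "\<eta> (\<phi> (xs y, y) - Psub (xs y)) * (n (xs y) * dens e * fst gp - j)
        - \<eta> (\<phi> (xs y, y) - Psub (xs y)) * (dens e / n (xs y) * snd gp) * deriv xs y
       = \<eta> (\<phi> (xs y, y) - Psub (xs y)) * (n (xs y) * dens e * fst gp - j - dens e / n (xs y) * snd gp * deriv xs y)"
      by (simp add: algebra_simps)
    also have "\<dots> = 0" using zero by (simp only: e_def mult_zero_right)
    finally show ?thesis .
  qed
  \<comment> \<open>Dominated convergence needs a bound uniform in \<open>k\<close>, but at the
    shock \<open>G\<close> has only pointwise limits. Subsonicity bounds the velocity and the flux,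
    continuity of \<open>\<phi>\<close> on a compact set bounds the test function, and
    \<open>cutoff'\<close> is at most \<open>deriv xs\<close> in modulus.\<close>
  obtain B where B: "\<And>k y. y \<in> ?P \<Longrightarrow> \<bar>bd k y\<bar> \<le> B"
  proof -
    have bounded: "\<exists>b\<ge>0. \<forall>x\<in>S. \<bar>f x\<bar> \<le> b" if "compact S" "continuous_on S f" for f :: "'b::topological_space \<Rightarrow> real" and S
    proof -
      have "bounded (f ` S)" using that by (intro compact_imp_bounded compact_continuous_image)
      then obtain b where "\<forall>y\<in>f ` S. norm y \<le> b" unfolding bounded_iff by blast
      then have "\<forall>x\<in>S. \<bar>f x\<bar> \<le> \<bar>b\<bar>" by (auto intro: order_trans[OF _ abs_ge_self])
      then show ?thesis by (intro exI[of _ "\<bar>b\<bar>"]) auto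
    qed
    obtain b1 where b1: "b1 \<ge> 0" "\<And>z. z \<in> {0..1} \<times> ?P \<Longrightarrow> \<bar>\<eta> (\<phi> z - Psub (fst z))\<bar> \<le> b1"
    proof -
      let ?S = "{0..1::real} \<times> ?P"
      have "continuous_on ?S (\<lambda>z. Psub (fst z))"
        by (rule continuous_on_compose2[OF DERIV_continuous_on[OF Psub_deriv]]) (auto intro!: continuous_intros)
      moreover have "continuous_on ?S \<phi>" by (rule continuous_on_subset[OF \<phi>_cont]) (auto simp: Omega_def)
      moreover have "continuous_on UNIV \<eta>" using DERIV_isCont[OF \<eta>] by (intro continuous_at_imp_continuous_on) auto
      ultimately have "continuous_on ?S (\<lambda>z. \<eta> (\<phi> z - Psub (fst z)))"
        by (intro continuous_on_compose2[of UNIV \<eta> ?S "\<lambda>z. \<phi> z - Psub (fst z)"] continuous_intros) auto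
      then have "\<exists>b\<ge>0. \<forall>z\<in>?S. \<bar>\<eta> (\<phi> z - Psub (fst z))\<bar> \<le> b"
        by (intro bounded compact_Times compact_Icc)
      then show ?thesis using that by blast
    qed
    obtain b2 where b2: "b2 \<ge> 0" "\<And>x. x \<in> {0..1} \<Longrightarrow> \<bar>n x\<bar> \<le> b2"
      using bounded[OF compact_Icc n_cont] by blast
    obtain b3 where b3: "b3 \<ge> 0" "\<And>y. y \<in> ?P \<Longrightarrow> \<bar>deriv xs y\<bar> \<le> b3"
      using bounded[OF compact_Icc continuous_on_subset[OF deriv_xs_cont subset_UNIV]] by blast
    define d0 where "d0 = dens 0"
    have d0: "0 \<le> d0" by (simp add: d0_def dens_nonneg)
    have "\<bar>bd k y\<bar> \<le> b1 * (b2 * d0 * cs + j) + b1 * (d0 * cs) * b3" if y: "y \<in> ?P" for k y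
    proof -
      define z where "z = (cutoff k y, y)"
      have z: "z \<in> OP" unfolding z_def by (rule in_OP[of k]) (auto intro: less_imp_le cutoff_bounds)
      have x01: "fst z \<in> {0..1}" by (rule fst_OP[OF z])
      have N: "0 < n (fst z)" by (rule n_pos[OF x01])
      have e: "0 \<le> en z" "en z < cs\<^sup>2" using en_plus[OF z] by (auto simp: en_def)
      have p: "\<bar>fst (G z)\<bar> \<le> cs"
      proof -
        have "(fst (G z))\<^sup>2 \<le> en z" by (simp add: en_def)
        then have "(fst (G z))\<^sup>2 \<le> cs\<^sup>2" using e by simp
        then show ?thesis using cs_pos by (simp add: abs_le_square_iff[symmetric])
      qed
      have q: "\<bar>snd (G z) / n (fst z)\<bar> \<le> cs"
      proof -
        have "(snd (G z) / n (fst z))\<^sup>2 \<le> en z" by (simp add: en_def power_divide)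
        then have "(snd (G z) / n (fst z))\<^sup>2 \<le> cs\<^sup>2" using e by simp
        then show ?thesis using cs_pos by (simp add: abs_le_square_iff[symmetric] del: abs_divide power_divide)
      qed
      have d: "0 \<le> dens (en z)" "dens (en z) \<le> d0"
        using e cs_sq_less_qm_sq unfolding d0_def by (auto intro!: dens_antimono dens_nonneg)
      have \<eta>z: "\<bar>\<eta> (wdiff z)\<bar> \<le> b1"
        unfolding wdiff_def using x01 y by (intro b1(2)) (auto simp: z_def)
      have "\<bar>n (fst z) * dens (en z) * fst (G z)\<bar> = \<bar>n (fst z)\<bar> * dens (en z) * \<bar>fst (G z)\<bar>"
        using d by (simp add: abs_mult)
      also have "\<dots> \<le> b2 * d0 * cs"
        using b2 x01 d p d0 by (intro mult_mono) auto
      finally have f1: "\<bar>flux1 z\<bar> \<le> b2 * d0 * cs + j" using j_pos unfolding flux1_def by linarith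
      have "\<bar>flux2 z\<bar> = dens (en z) * \<bar>snd (G z) / n (fst z)\<bar>"
        using d by (simp add: flux2_def abs_mult)
      also have "\<dots> \<le> d0 * cs" using d q d0 by (intro mult_mono) auto
      finally have f2: "\<bar>flux2 z\<bar> \<le> d0 * cs" .
      have c: "\<bar>cutoff' k y\<bar> \<le> b3"
      proof -
        have "cutoff' k y = deriv xs y * ((real k + 1) / (real k + 2))" by (simp add: cutoff'_def field_simps)
        then have "\<bar>cutoff' k y\<bar> = \<bar>deriv xs y\<bar> * ((real k + 1) / (real k + 2))" by (simp add: abs_mult)
        also have "\<dots> \<le> \<bar>deriv xs y\<bar> * 1" by (intro mult_left_mono) auto
        finally show ?thesis using b3(2)[OF y] by simp
      qed
      have "\<bar>bd k y\<bar> \<le> \<bar>\<eta> (wdiff z)\<bar> * \<bar>flux1 z\<bar> + \<bar>\<eta> (wdiff z)\<bar> * \<bar>flux2 z\<bar> * \<bar>cutoff' k y\<bar>"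
        unfolding bd_def H1_def H2_def z_def[symmetric] by (metis abs_mult abs_triangle_ineq4)
      also have "\<dots> \<le> b1 * (b2 * d0 * cs + j) + b1 * (d0 * cs) * b3"
        using \<eta>z f1 f2 c b1(1) b2(1) d0 b3(1) cs_pos j_pos by (intro add_mono mult_mono) auto
      finally show ?thesis .
    qed
    with that show ?thesis by blast
  qed
  have bd_int: "(\<lambda>k. integral ?P (bd k)) \<longlonglongrightarrow> 0"
  proof -
    have "(\<lambda>k. integral ?P (bd k)) \<longlonglongrightarrow> integral ?P (\<lambda>y. 0)"
      by (rule dominated_convergence(2)[where h = "\<lambda>y. B"])
        (use B bd_lim in \<open>auto intro!: integrable_continuous_real bd_cont\<close>)
    then show ?thesis by simp
  qed
  have int_E_nonneg: "0 \<le> integral ?P (E k)" for k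
    by (rule integral_nonneg) (auto intro!: integrable_continuous_real E_cont E_nonneg)
  show J_nonneg: "0 \<le> J"
  proof (rule LIMSEQ_le_const2[OF bd_int])
    show "\<exists>N. \<forall>k\<ge>N. integral ?P (bd k) \<le> J"
      using int_E int_E_nonneg by (metis diff_ge_0_iff_ge)
  qed
  assume J: "J = 0" and z: "z \<in> OP"
  \<comment> \<open>The integrals of \<open>E k\<close> are nonnegative and increase with
    \<open>k\<close>, since the strips grow; for \<open>J = 0\<close> they equal
    \<open>- integral ?P (bd k)\<close>, which tends to 0. So each of them vanishes.\<close>
  have "integral ?P (E k) = 0" for k
  proof (rule antisym)
    have lim: "(\<lambda>m. - integral ?P (bd m)) \<longlonglongrightarrow> 0" using tendsto_minus[OF bd_int] by simp
    show "integral ?P (E k) \<le> 0"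
    proof (rule LIMSEQ_le_const[OF lim])
      have "integral ?P (E k) \<le> integral ?P (E m)" if "k \<le> m" for m
        by (rule integral_le) (auto intro!: integrable_continuous_real E_cont E_mono that)
      then show "\<exists>N. \<forall>m\<ge>N. integral ?P (E k) \<le> - integral ?P (bd m)"
        using int_E J by fastforce
    qed
  qed (rule int_E_nonneg)
  then have E0: "E k y = 0" if "y \<in> ?P" for k y
    using integral_eq_0_iff[OF E_cont[of k]] E_nonneg that by auto
  have zero: "H11 (x, y) + H22 (x, y) = 0" if y: "y \<in> ?P" and x: "(x, y) \<in> OP" for x y
  proof -
    have "xs y < x" "x \<le> 1" using x by (auto simp: mem_OP)
    then have "\<forall>\<^sub>F k in sequentially. cutoff k y < x" by (intro order_tendstoD(2)[OF cutoff_tendsto])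
    then obtain k where k: "cutoff k y < x" using eventually_happens by force
    have "continuous_on {cutoff k y..1} (\<lambda>x. H11 (x, y) + H22 (x, y))"
      by (intro continuous_intros continuous_on_compose2[OF H_cont(1)] continuous_on_compose2[OF H_cont(3)])
        (auto intro: in_OP)
    from integral_eq_0_iff[OF this] E0[OF y, of k] div_nonneg in_OP[of k y] cutoff_bounds(2)[of k y]
    have "\<forall>x\<in>{cutoff k y..1}. H11 (x, y) + H22 (x, y) = 0" unfolding E_def by auto
    then show ?thesis using k \<open>x \<le> 1\<close> by auto
  qed
  obtain x y where zxy: "z = (x, y)" by (cases z)
  obtain i where i: "y + 2 * pi * of_int i \<in> ?P" using periodic_reduction by blast
  have per: "(xs y < x \<and> x \<le> 1 \<longrightarrow> G (x, y + 2 * pi * of_int i) = G (x, y)) \<and> \<phi> (x, y + 2 * pi * of_int i) = \<phi> (x, y) \<and> xs (y + 2 * pi * of_int i) = xs y"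
  proof -
    have "xs (y + 2 * pi * of_int i) = xs y" by (rule periodic_int_shift) (rule xs_periodic)
    moreover have "\<phi> (x, y + 2 * pi * of_int i) = \<phi> (x, y)"
      by (rule periodic_int_shift[of "\<lambda>y. \<phi> (x, y)"]) (rule \<phi>_periodic)
    \<comment> \<open>\<open>G\<close> is known to be periodic only inside \<open>OP\<close>.
      Replacing it by 0 elsewhere gives a function periodic on the whole line, as the shift lemma
      demands.\<close>
    moreover have "(if xs (y + 2 * pi * of_int i) < x \<and> x \<le> 1 then G (x, y + 2 * pi * of_int i) else 0)
       = (if xs y < x \<and> x \<le> 1 then G (x, y) else 0)"
      by (rule periodic_int_shift[of "\<lambda>y. if xs y < x \<and> x \<le> 1 then G (x, y) else 0"])
        (auto simp: xs_periodic G_periodic mem_OP)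
    ultimately show ?thesis by auto
  qed
  have "(x, y + 2 * pi * of_int i) \<in> OP" using z per by (simp add: zxy mem_OP)
  from zero[OF i this] div[OF this]
  have "\<eta>' (wdiff (x, y + 2 * pi * of_int i)) * dissip (x, y + 2 * pi * of_int i) = 0" by simp
  moreover have "wdiff (x, y + 2 * pi * of_int i) = wdiff z" using per by (simp add: zxy wdiff_def)
  moreover have "dissip (x, y + 2 * pi * of_int i) = dissip z"
    using per z by (simp add: zxy dissip_def flux1_def flux2_def en_def mem_OP)
  ultimately show "\<eta>' (wdiff z) * dissip z = 0" by simp
qed

end

section \<open>Exit speed and identification of the subsonic flow\<close>

context shock_solution
begin

lemma exit_OP: "(1, y) \<in> OP"
  using xs_bounds[of y] by (simp add: mem_OP)

lemma en_exit: "en (1, y) = c1\<^sup>2"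
  using G_exit(1)[of y] by (simp add: en_speed)

lemma dens_c1_pos: "0 < dens (c1\<^sup>2)"
  using en_plus[OF exit_OP] cs_sq_less_qm_sq by (intro dens_pos) (simp add: en_exit)

lemma G_exit_le: "fst (G (1, y)) \<le> c1"
proof -
  have "(fst (G (1, y)))\<^sup>2 \<le> en (1, y)" by (simp add: en_def)
  then have "(fst (G (1, y)))\<^sup>2 \<le> c1\<^sup>2" by (simp add: en_exit)
  then show ?thesis using c1 by (auto intro: power2_le_imp_le)
qed

lemma flux1_exit: "flux1 (1, y) = n 1 * dens (c1\<^sup>2) * fst (G (1, y)) - j"
  by (simp add: flux1_def en_exit)

lemma flux1_exit_cont: "continuous_on S (\<lambda>y. flux1 (1, y))"
proof -
  obtain P1 P2 Q1 Q2 where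
    gP: "\<And>z. z \<in> OP \<Longrightarrow> grad_within (\<lambda>z. fst (G z)) (P1 z) (P2 z) z OP"
    by (rule C2_on_partials[OF C2_plus OP_directions G_plus, folded grad_within_def]) blast+
  have "continuous_on OP (\<lambda>z. fst (G z))" by (rule grad_within_imp_continuous_on, erule gP)
  then have "continuous_on S (\<lambda>y. fst (G (1, y)))"
    by (rule continuous_on_compose2) (auto intro!: continuous_intros exit_OP)
  then show ?thesis
    unfolding flux1_exit by (intro continuous_on_diff continuous_on_mult continuous_on_const)
qed

text \<open>Conservation of mass: the constants 1 and -1 are both admissible test functions, so the
  integral is at least 0 and at most 0.\<close>

lemma flux1_exit_integral: "integral {0..2 * pi} (\<lambda>y. flux1 (1, y)) = 0"
  using energy(1)[of "\<lambda>_. 1" "\<lambda>_. 0"] energy(1)[of "\<lambda>_. -1" "\<lambda>_. 0"] by simp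

lemma exit_balance: "j = n 1 * mflux (usub 1)"
  using usub(3)[of 1] by simp

lemma flux1_exit_le: "flux1 (1, y) \<le> n 1 * (mflux c1 - mflux (usub 1))"
proof -
  have "n 1 * dens (c1\<^sup>2) * fst (G (1, y)) \<le> n 1 * dens (c1\<^sup>2) * c1"
    using G_exit_le n_pos[of 1] dens_c1_pos by (intro mult_left_mono) auto
  then show ?thesis by (simp add: flux1_exit exit_balance mflux_def algebra_simps)
qed

text \<open>A smaller exit speed cannot carry the flux \<open>j\<close>: even for a purely axial
  exit velocity the flux difference would be negative at every exit point, against its vanishing
  integral.\<close>

lemma usub_exit_le: "usub 1 \<le> c1"
proof (rule ccontr)
  assume "\<not> usub 1 \<le> c1"
  then have "mflux c1 < mflux (usub 1)"
    using c1 usub(2)[of 1] by (intro mflux_strict_mono) auto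
  then have neg: "n 1 * (mflux c1 - mflux (usub 1)) < 0"
    using n_pos[of 1] by (intro mult_pos_neg) auto
  have "integral {0..2 * pi} (\<lambda>y. flux1 (1, y)) \<le> integral {0..2 * pi} (\<lambda>y. n 1 * (mflux c1 - mflux (usub 1)))"
    using flux1_exit_le by (intro integral_le integrable_continuous_real flux1_exit_cont) auto
  also have "\<dots> = 2 * pi * (n 1 * (mflux c1 - mflux (usub 1)))" by simp
  also have "\<dots> < 0" using mult_pos_neg[OF _ neg, of "2 * pi"] by simp
  finally show False by (simp add: flux1_exit_integral)
qed

lemma wdiff_line:
  assumes "(x, y) \<in> OP"
  shows "((\<lambda>x. wdiff (x, y)) has_real_derivative (fst (G (x, y)) - usub x)) (at x within {xs y<..1})"
proof -
  have "((\<lambda>s. wdiff (s, y)) has_real_derivative (fst (G (x, y)) - usub x) * 1 + snd (G (x, y)) * 0) (at x within {xs y<..1})"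
    using wdiff_grad[OF assms] by (intro grad_within_along[where A = OP]) (auto simp: mem_OP)
  then show ?thesis by simp
qed

lemma wdiff_exit: "((\<lambda>y. wdiff (1, y)) has_real_derivative snd (G (1, y))) (at y)"
proof -
  have "((\<lambda>s. wdiff (1, s)) has_real_derivative (fst (G (1, y)) - usub (fst (1::real, y))) * 0 + snd (G (1, y)) * 1) (at y within UNIV)"
    by (intro grad_within_along[where A = OP] wdiff_grad exit_OP) auto
  then show ?thesis by simp
qed

text \<open>Truncating the energy identity below the exit minimum \<open>k\<close> of \<open>wdiff\<close> shows that \<open>k\<close> is a lower
  bound in the whole subsonic region; at the minimum point the velocity is then horizontal and at
  most the background velocity.\<close>
lemma exit_speed: "c1 = usub 1"
proof (rule antisym[OF _ usub_exit_le])
  have "continuous_on {0..2 * pi} (\<lambda>y. wdiff (1, y))"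
    using DERIV_isCont[OF wdiff_exit] by (intro continuous_at_imp_continuous_on) auto
  then obtain y0 where y0: "y0 \<in> {0..2 * pi}" "\<And>y. y \<in> {0..2 * pi} \<Longrightarrow> wdiff (1, y0) \<le> wdiff (1, y)"
    using continuous_attains_inf[of "{0..2 * pi}" "\<lambda>y. wdiff (1, y)"] by auto
  define k where "k = wdiff (1, y0)"
  have k_le: "k \<le> wdiff (1, y)" for y
  proof -
    obtain i where i: "y + 2 * pi * of_int i \<in> {0..2 * pi}" using periodic_reduction by blast
    have "wdiff (1, y + 2 * pi * of_int i) = wdiff (1, y)"
      by (rule periodic_int_shift[of "\<lambda>y. wdiff (1, y)"]) (simp add: wdiff_def \<phi>_periodic)
    with y0(2)[OF i] show ?thesis by (simp add: k_def)
  qed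
  let ?\<eta> = "\<lambda>x. - ((min (x - k) 0)\<^sup>2)" and ?\<eta>' = "\<lambda>x. - 2 * min (x - k) 0"
  have "min (wdiff (1, y) - k) 0 = 0" for y using k_le[of y] by simp
  then have "integral {0..2 * pi} (\<lambda>y. ?\<eta> (wdiff (1, y)) * flux1 (1, y)) = 0" by simp
  note en0 = energy(2)[of ?\<eta> ?\<eta>', OF negative_part_square_deriv _ _ this]
  have zero: "min (wdiff z - k) 0 * dissip z = 0" if "z \<in> OP" for z
  proof -
    have "continuous_on UNIV ?\<eta>'" by (intro continuous_intros)
    from en0[OF this _ that] show ?thesis by simp
  qed
  have k_lower: "k \<le> wdiff (x, y)" if xy: "(x, y) \<in> OP" for x y
  proof -
    \<comment> \<open>At each point either the truncation is inactive or the dissipation vanishes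
      and the velocity is the background one. Both alternatives annihilate the derivative, so the
      truncated difference keeps its exit value 0 along horizontal lines.\<close>
    have "((\<lambda>x. ?\<eta> (wdiff (x, y))) has_real_derivative 0) (at s within {xs y<..1})" if s: "s \<in> {xs y<..1}" for s
    proof -
      have sOP: "(s, y) \<in> OP" using s by (simp add: mem_OP)
      have "((\<lambda>x. ?\<eta> (wdiff (x, y))) has_real_derivative
          - 2 * min (wdiff (s, y) - k) 0 * (fst (G (s, y)) - usub s)) (at s within {xs y<..1})"
        by (rule DERIV_chain2[OF negative_part_square_deriv wdiff_line[OF sOP]])
      moreover have "min (wdiff (s, y) - k) 0 * (fst (G (s, y)) - usub s) = 0"
        using zero[OF sOP] dissip_nonneg(2)[OF sOP] by auto
      ultimately show ?thesis by (simp only: mult.assoc mult_zero_right)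
    qed
    then have "\<exists>c. \<forall>x\<in>{xs y<..1}. ?\<eta> (wdiff (x, y)) = c"
      by (intro has_field_derivative_zero_constant) auto
    then obtain c where c: "\<And>x. x \<in> {xs y<..1} \<Longrightarrow> ?\<eta> (wdiff (x, y)) = c" by blast
    have "c = 0" using c[of 1] k_le[of y] xs_bounds[of y] by simp
    then have "min (wdiff (x, y) - k) 0 = 0" using c[of x] xy by (simp add: mem_OP)
    then show ?thesis by (simp add: min_def split: if_splits)
  qed
  have p_le: "fst (G (1, y0)) \<le> usub 1"
  proof (rule ccontr)
    assume "\<not> ?thesis"
    then have "0 < fst (G (1, y0)) - usub 1" by simp
    from has_real_derivative_pos_inc_left[OF wdiff_line[OF exit_OP] this]
    obtain d where d: "d > 0" "\<And>h. 0 < h \<Longrightarrow> 1 - h \<in> {xs y0<..1} \<Longrightarrow> h < d \<Longrightarrow> wdiff (1 - h, y0) < wdiff (1, y0)"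
      by blast
    define h where "h = min (d / 2) ((1 - xs y0) / 2)"
    have h1: "h \<le> d / 2" unfolding h_def by (rule min.cobounded1)
    have h2: "h \<le> (1 - xs y0) / 2" unfolding h_def by (rule min.cobounded2)
    have h3: "0 < h" using d(1) xs_bounds(2)[of y0] by (simp add: h_def)
    have h4: "xs y0 < 1 - h" using h2 xs_bounds(2)[of y0] by (simp add: field_simps)
    have h: "0 < h" "h < d" "xs y0 < 1 - h" using h1 h3 h4 d(1) by linarith+
    have "wdiff (1 - h, y0) < k" unfolding k_def using h by (intro d(2)) auto
    moreover have "k \<le> wdiff (1 - h, y0)" using h by (intro k_lower) (simp add: mem_OP)
    ultimately show False by simp
  qed
  have "snd (G (1, y0)) = 0"
    by (rule DERIV_local_min[OF wdiff_exit[of y0] zero_less_one]) (use k_le in \<open>auto simp: k_def\<close>)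
  then have "(fst (G (1, y0)))\<^sup>2 = c1\<^sup>2" using en_exit[of y0] by (simp add: en_def)
  \<comment> \<open>At the minimum point the velocity is axial, so its axial component is
    \<open>c1\<close> or \<open>- c1\<close>; the assumed sign of the axial derivative at the exit
    selects \<open>c1\<close>.\<close>
  then have "fst (G (1, y0)) = c1" using G_exit(2)[of y0] c1 by (auto simp: power2_eq_iff_nonneg)
  with p_le show "c1 \<le> usub 1" by simp
qed

text \<open>With \<open>c1 = usub 1\<close> the flux difference at the exit has a sign and zero
  integral, so it vanishes pointwise. Testing with the identity then leaves no boundary term, and
  the dissipation is zero everywhere.\<close>

lemma G_plus_eq:
  assumes z: "z \<in> OP" shows "G z = (usub (fst z), 0)"
proof -
  have nonneg: "0 \<le> - flux1 (1, y)" for y using flux1_exit_le[of y] by (simp add: exit_speed)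
  have "integral {0..2 * pi} (\<lambda>y. - flux1 (1, y)) = 0" using flux1_exit_integral by simp
  moreover have "continuous_on {0..2 * pi} (\<lambda>y. - flux1 (1, y))" by (intro continuous_intros flux1_exit_cont)
  ultimately have "\<forall>y\<in>{0..2 * pi}. - flux1 (1, y) = 0"
    using integral_eq_0_iff[of 0 "2 * pi" "\<lambda>y. - flux1 (1, y)"] nonneg by simp
  then have "integral {0..2 * pi} (\<lambda>y. wdiff (1, y) * flux1 (1, y)) = integral {0..2 * pi} (\<lambda>y. 0)"
    by (intro integral_cong) auto
  then have "integral {0..2 * pi} (\<lambda>y. wdiff (1, y) * flux1 (1, y)) = 0" by simp
  from energy(2)[of "\<lambda>x. x" "\<lambda>_. 1", OF _ _ _ this z] have "dissip z = 0" by simp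
  then show ?thesis by (rule dissip_nonneg(2)[OF z])
qed

lemma \<phi>_plus_eq:
  assumes z: "z \<in> OP" shows "\<phi> z = Psub (fst z) + wdiff (1, 0)"
proof -
  have "((\<lambda>y. wdiff (1, y)) has_real_derivative 0) (at y within UNIV)" for y
    using wdiff_exit[of y] G_plus_eq[OF exit_OP] by simp
  then have "\<exists>c. \<forall>y\<in>UNIV. wdiff (1, y) = c" by (intro has_field_derivative_zero_constant) auto
  then have exit: "wdiff (1, y) = wdiff (1, 0)" for y by (metis UNIV_I)
  obtain x y where zxy: "z = (x, y)" by (cases z)
  have "((\<lambda>x. wdiff (x, y)) has_real_derivative 0) (at s within {xs y<..1})" if "s \<in> {xs y<..1}" for s
    using wdiff_line[of s y] G_plus_eq[of "(s, y)"] that by (simp add: mem_OP)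
  then have "\<exists>c. \<forall>x\<in>{xs y<..1}. wdiff (x, y) = c" by (intro has_field_derivative_zero_constant) auto
  then obtain c where c: "\<And>x. x \<in> {xs y<..1} \<Longrightarrow> wdiff (x, y) = c" by blast
  have "wdiff (x, y) = wdiff (1, y)"
    using c[of x] c[of 1] z xs_bounds[of y] by (simp add: zxy mem_OP)
  with exit[of y] show ?thesis by (simp add: zxy wdiff_def)
qed

lemma Psub_cont: "continuous_on {0..1} Psub" and Psup_cont: "continuous_on {0..1} Psup"
  by (rule DERIV_continuous_on, erule Psub_deriv Psup_deriv)+

lemma \<phi>_shock_value:
  shows "\<phi> (xs t, t) = Psup (xs t) + \<phi> (0, 0)" and "\<phi> (xs t, t) = Psub (xs t) + wdiff (1, 0)"
proof -
  have pos: "0 < min (xs t) (1 - xs t)" using xs_bounds[of t] by simp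
  have lim: "((\<lambda>d. P (xs t + s * d)) \<longlongrightarrow> P (xs t)) (at_right 0)"
    if "continuous_on {0..1} P" "s = -1 \<or> s = 1" for P :: "real \<Rightarrow> real" and s :: real
  proof (rule continuous_on_tendsto_compose[OF that(1)])
    show "((\<lambda>d. xs t + s * d) \<longlongrightarrow> xs t) (at_right 0)" by (auto intro!: tendsto_eq_intros)
    show "\<forall>\<^sub>F d in at_right 0. xs t + s * d \<in> {0..1}"
      using eventually_at_right_real[OF pos] by eventually_elim (use that(2) in auto)
  qed (use xs_bounds[of t] in auto)
  show "\<phi> (xs t, t) = Psup (xs t) + \<phi> (0, 0)"
  proof (rule tendsto_unique[OF _ \<phi>_path_at_shock[of "-1"]])
    have "((\<lambda>d. Psup (xs t + (-1) * d) + \<phi> (0, 0)) \<longlongrightarrow> Psup (xs t) + \<phi> (0, 0)) (at_right 0)"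
      by (intro tendsto_intros lim Psup_cont) simp
    then show "((\<lambda>d. \<phi> (xs t + (-1) * d, t)) \<longlongrightarrow> Psup (xs t) + \<phi> (0, 0)) (at_right 0)"
    proof (rule Lim_transform_eventually)
      show "\<forall>\<^sub>F d in at_right 0. Psup (xs t + (-1) * d) + \<phi> (0, 0) = \<phi> (xs t + (-1) * d, t)"
        using eventually_at_right_real[OF pos]
        by eventually_elim (subst \<phi>_minus_eq, auto simp: mem_OM)
    qed
  qed auto
  show "\<phi> (xs t, t) = Psub (xs t) + wdiff (1, 0)"
  proof (rule tendsto_unique[OF _ \<phi>_path_at_shock[of 1]])
    have "((\<lambda>d. Psub (xs t + 1 * d) + wdiff (1, 0)) \<longlongrightarrow> Psub (xs t) + wdiff (1, 0)) (at_right 0)"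
      by (intro tendsto_intros lim Psub_cont) simp
    then show "((\<lambda>d. \<phi> (xs t + 1 * d, t)) \<longlongrightarrow> Psub (xs t) + wdiff (1, 0)) (at_right 0)"
    proof (rule Lim_transform_eventually)
      show "\<forall>\<^sub>F d in at_right 0. Psub (xs t + 1 * d) + wdiff (1, 0) = \<phi> (xs t + 1 * d, t)"
        using eventually_at_right_real[OF pos]
        by eventually_elim (subst \<phi>_plus_eq, auto simp: mem_OP)
    qed
  qed auto
qed

lemma xs_constant: "xs t = xs 0"
proof -
  have inc: "Psup x - Psub x < Psup y - Psub y" if "0 \<le> x" "x < y" "y \<le> 1" for x y
    by (rule mono_of_positive_derivative[where X = 1 and K = "\<lambda>x. Psup x - Psub x" and k = "\<lambda>x. usup x - usub x"])
      (use that usub_less_usup in \<open>auto intro!: DERIV_diff Psup_deriv Psub_deriv\<close>)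
  have "Psup (xs t) - Psub (xs t) = Psup (xs 0) - Psub (xs 0)"
    using \<phi>_shock_value[of t] \<phi>_shock_value[of 0] by linarith
  then show ?thesis
    using inc[of "xs t" "xs 0"] inc[of "xs 0" "xs t"] xs_bounds[of t] xs_bounds[of 0]
    by (cases "xs t" "xs 0" rule: linorder_cases) auto
qed

end

section \<open>Existence and uniqueness\<close>

context nozzle_flow
begin

definition background :: "real \<Rightarrow> real \<Rightarrow> real" where
  "background xb x = (if x \<le> xb then Psup x else Psub x + (Psup xb - Psub xb))"

definition background_velocity :: "real \<Rightarrow> real \<Rightarrow> real" where
  "background_velocity xb x = (if x < xb then usup x else usub x)"

lemma background_deriv_minus:
  assumes "0 \<le> x" "x < xb" "xb < 1"
  shows "(background xb has_real_derivative usup x) (at x within {0..1})"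
  by (rule has_field_derivative_transform_within[OF Psup_deriv, of x "xb - x"])
    (use assms in \<open>auto simp: background_def dist_real_def\<close>)

lemma background_deriv_plus:
  assumes "0 < xb" "xb < x" "x \<le> 1"
  shows "(background xb has_real_derivative usub x) (at x within {0..1})"
proof -
  have "((\<lambda>x. Psub x + (Psup xb - Psub xb)) has_real_derivative usub x) (at x within {0..1})"
    using assms by (auto intro!: derivative_eq_intros Psub_deriv)
  then show ?thesis
    by (rule has_field_derivative_transform_within[of _ _ _ _ "x - xb"])
      (use assms in \<open>auto simp: background_def dist_real_def\<close>)
qed

lemma usub_le_qm: "x \<in> {0..1} \<Longrightarrow> \<bar>usub x\<bar> \<le> qm" and usup_le_qm: "x \<in> {0..1} \<Longrightarrow> \<bar>usup x\<bar> \<le> qm"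
  using usub(1,2)[of x] usup(1,2)[of x] cs_pos cs_less_qm by auto

lemma background_lipschitz:
  assumes "0 < xb" "xb < 1"
  shows "qm-lipschitz_on {0..1} (background xb)"
  unfolding background_def[abs_def]
proof (rule lipschitz_on_concat)
  have "norm (Psup x - Psup y) \<le> qm * norm (x - y)" if "x \<in> {0..xb}" "y \<in> {0..xb}" for x y
    by (rule field_differentiable_bound[where S = "{0..xb}" and f' = usup])
      (use that assms usup_le_qm in \<open>auto intro: has_field_derivative_subset[OF Psup_deriv]\<close>)
  then show "qm-lipschitz_on {0..xb} Psup"
    using qm_pos by (intro lipschitz_onI) (auto simp: dist_norm)
  have "norm (Psub x - Psub y) \<le> qm * norm (x - y)" if "x \<in> {xb..1}" "y \<in> {xb..1}" for x y
    by (rule field_differentiable_bound[where S = "{xb..1}" and f' = usub])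
      (use that assms usub_le_qm in \<open>auto intro: has_field_derivative_subset[OF Psub_deriv]\<close>)
  then show "qm-lipschitz_on {xb..1} (\<lambda>x. Psub x + (Psup xb - Psub xb))"
    using qm_pos by (intro lipschitz_onI) (auto simp: dist_norm)
qed simp

lemma usup_tendsto_left: "0 < xb \<Longrightarrow> xb < 1 \<Longrightarrow> (usup \<longlongrightarrow> usup xb) (at_left xb)"
  and usub_tendsto_right: "0 < xb \<Longrightarrow> xb < 1 \<Longrightarrow> (usub \<longlongrightarrow> usub xb) (at_right xb)"
proof -
  assume xb: "0 < xb" "xb < 1"
  have "isCont usup xb" "isCont usub xb"
    using continuous_on_interior[OF usup_cont] continuous_on_interior[OF usub_cont] xb by auto
  then show "(usup \<longlongrightarrow> usup xb) (at_left xb)" "(usub \<longlongrightarrow> usub xb) (at_right xb)"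
    by (auto simp: isCont_def intro: filterlim_at_withinI tendsto_within_subset)
qed

lemma shock_jump: "x \<in> {0..1} \<Longrightarrow> mflux (usub x) = mflux (usup x)"
  using usub(3)[of x] usup(3)[of x] n_pos[of x] by (metis less_irrefl mult_left_cancel)

lemma background_is_solution:
  assumes xb: "0 < xb" "xb < 1"
  shows "background_solution \<gamma> c0 u0 n xb (background xb)"
  unfolding background_solution_def
proof (intro conjI exI[of _ "background_velocity xb"];
    (rule exI[of _ "usup xb"], rule exI[of _ "usub xb"], intro conjI)?)
  let ?u = "background_velocity xb"
  have xb01: "xb \<in> {0..1}" using xb by simp
  show "continuous_on {0..1} (background xb)"
    using background_lipschitz[OF xb] by (rule lipschitz_on_continuous_on)
  show "\<forall>x\<in>{0..1} - {xb}. (background xb has_real_derivative ?u x) (at x within {0..1})"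
  proof
    fix x assume "x \<in> {0..1} - {xb}"
    then show "(background xb has_real_derivative ?u x) (at x within {0..1})"
      using background_deriv_minus[of x xb] background_deriv_plus[of xb x] xb
      by (cases "x < xb") (auto simp: background_velocity_def)
  qed
  show "?u 0 = u0" using xb by (simp add: background_velocity_def usup_0)
  show "\<forall>x\<in>{0..<xb}. cs < \<bar>?u x\<bar> \<and> \<bar>?u x\<bar> < qm"
  proof
    fix x assume "x \<in> {0..<xb}"
    then show "cs < \<bar>?u x\<bar> \<and> \<bar>?u x\<bar> < qm"
      using usup(1,2)[of x] cs_pos xb by (auto simp: background_velocity_def)
  qed
  show "\<forall>x\<in>{xb<..1}. \<bar>?u x\<bar> < cs"
  proof
    fix x assume "x \<in> {xb<..1}"
    then show "\<bar>?u x\<bar> < cs" using usub(1,2)[of x] xb by (auto simp: background_velocity_def)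
  qed
  show "\<forall>x\<in>{0<..<xb}. (?u has_real_derivative
          (deriv n x / n x * (csq \<gamma> c0 (?u x) * ?u x / ((?u x)^2 - csq \<gamma> c0 (?u x))))) (at x)"
  proof
    fix x assume x: "x \<in> {0<..<xb}"
    have "(usup has_real_derivative ode_rhs x (usup x)) (at x)"
      using usup(4)[of x] x xb by (simp add: at_within_Icc_at)
    then have "(?u has_real_derivative ode_rhs x (usup x)) (at x)"
      by (rule has_field_derivative_transform_within_open[of _ _ _ "{0<..<xb}"])
        (use x in \<open>auto simp: background_velocity_def\<close>)
    then show "(?u has_real_derivative
          (deriv n x / n x * (csq \<gamma> c0 (?u x) * ?u x / ((?u x)^2 - csq \<gamma> c0 (?u x))))) (at x)"
      using x by (simp add: background_velocity_def ode_rhs_def)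
  qed
  show "\<forall>x\<in>{xb<..1}. (?u has_real_derivative
          (deriv n x / n x * (csq \<gamma> c0 (?u x) * ?u x / ((?u x)^2 - csq \<gamma> c0 (?u x)))))
          (at x within {xb<..1})"
  proof
    fix x assume x: "x \<in> {xb<..1}"
    have "(usub has_real_derivative ode_rhs x (usub x)) (at x within {xb<..1})"
      using x xb by (intro has_field_derivative_subset[OF usub(4)]) auto
    then have "(?u has_real_derivative ode_rhs x (usub x)) (at x within {xb<..1})"
      by (rule has_field_derivative_transform_within[OF _ zero_less_one])
        (use x in \<open>auto simp: background_velocity_def\<close>)
    then show "(?u has_real_derivative
          (deriv n x / n x * (csq \<gamma> c0 (?u x) * ?u x / ((?u x)^2 - csq \<gamma> c0 (?u x)))))
          (at x within {xb<..1})"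
      using x by (simp add: background_velocity_def ode_rhs_def)
  qed
  show "(?u \<longlongrightarrow> usup xb) (at_left xb)"
    by (rule Lim_transform_eventually[OF usup_tendsto_left[OF xb]])
      (auto simp: eventually_at_filter background_velocity_def)
  show "(?u \<longlongrightarrow> usub xb) (at_right xb)"
    by (rule Lim_transform_eventually[OF usub_tendsto_right[OF xb]])
      (auto simp: eventually_at_filter background_velocity_def)
  show "\<bar>usub xb\<bar> < cs" using usub(1,2)[OF xb01] by simp
  show "rho \<gamma> c0 (usub xb) * usub xb = rho \<gamma> c0 (usup xb) * usup xb"
    using shock_jump[OF xb01] by (simp add: mflux_def rho_eq)
qed

end

lemma C2_on_fst:
  fixes f u v :: "real \<Rightarrow> real"
  assumes S: "fst ` S \<subseteq> I"
    and f: "\<And>x. x \<in> I \<Longrightarrow> (f has_real_derivative u x) (at x within I)"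
    and u: "\<And>x. x \<in> I \<Longrightarrow> (u has_real_derivative v x) (at x within I)"
    and v: "continuous_on I v"
  shows "C2_on S (\<lambda>z. f (fst z))"
proof -
  \<comment> \<open>\<open>F\<close> is the differential of the axial coordinate and
    \<open>F2\<close> its tensor square; the first and second derivatives of a function of that
    coordinate alone are scalar multiples of them.\<close>
  define F :: "(real \<times> real) \<Rightarrow>\<^sub>L real" where "F = Blinfun fst"
  define F2 :: "(real \<times> real) \<Rightarrow>\<^sub>L ((real \<times> real) \<Rightarrow>\<^sub>L real)" where "F2 = Blinfun (\<lambda>h. fst h *\<^sub>R F)"
  have F: "blinfun_apply F = fst" unfolding F_def by (rule bounded_linear_Blinfun_apply) (rule bounded_linear_fst)
  have F2: "blinfun_apply F2 = (\<lambda>h. fst h *\<^sub>R F)"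
    unfolding F2_def by (rule bounded_linear_Blinfun_apply)
      (intro bounded_linear_scaleR_left[THEN bounded_linear_compose] bounded_linear_fst)
  have part: "((\<lambda>z. g (fst z)) has_derivative (\<lambda>h. d * fst h)) (at z within S)"
    if "z \<in> S" "(g has_real_derivative d) (at (fst z) within I)" for g d z
  proof -
    have "(g has_derivative (\<lambda>h. d * h)) (at (fst z) within fst ` S)"
      using that(2) S unfolding has_field_derivative_def by (rule has_derivative_subset)
    moreover have "(fst has_derivative fst) (at z within S)" by (rule has_derivative_fst[OF has_derivative_ident])
    ultimately show ?thesis using has_derivative_in_compose by fastforce
  qed
  show ?thesis
    unfolding C2_on_def
  proof (intro exI[of _ "\<lambda>z. u (fst z) *\<^sub>R F"] exI[of _ "\<lambda>z. v (fst z) *\<^sub>R F2"] conjI ballI)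
    fix z assume z: "z \<in> S"
    then have zI: "fst z \<in> I" using S by auto
    show "((\<lambda>z. f (fst z)) has_derivative blinfun_apply (u (fst z) *\<^sub>R F)) (at z within S)"
      using part[OF z f[OF zI]] by (simp add: scaleR_blinfun.rep_eq F)
    have "((\<lambda>z. u (fst z) *\<^sub>R F) has_derivative (\<lambda>h. (v (fst z) * fst h) *\<^sub>R F)) (at z within S)"
      by (rule has_derivative_scaleR_left[OF part[OF z u[OF zI]]])
    then show "((\<lambda>z. u (fst z) *\<^sub>R F) has_derivative blinfun_apply (v (fst z) *\<^sub>R F2)) (at z within S)"
      by (simp add: scaleR_blinfun.rep_eq F2)
  next
    have "continuous_on S (\<lambda>z. v (fst z))"
      by (rule continuous_on_compose2[OF v _ S]) (intro continuous_intros)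
    then show "continuous_on S (\<lambda>z. v (fst z) *\<^sub>R F2)" by (intro continuous_intros)
  qed
qed

context nozzle_flow
begin

text \<open>The coordinate flux is \<open>(j, 0)\<close> on both sides of \<open>xb\<close>. This
  gives the equation in each region and the mass jump condition at any position of the shock, with
  exit speed \<open>usub 1\<close> in every case.\<close>

lemma background_is_transonic_shock:
  assumes xb: "0 < xb" "xb < 1"
  shows "transonic_shock_solution \<gamma> c0 u0 n (usub 1) (\<lambda>z. background xb (fst z)) (\<lambda>_. xb)"
proof -
  define G where "G z = (background_velocity xb (fst z), 0::real)" for z :: "real \<times> real"
  let ?\<phi> = "\<lambda>z::real \<times> real. background xb (fst z)"
  let ?M = "Omega_minus (\<lambda>_. xb)" and ?P = "Omega_plus (\<lambda>_. xb)"
  have xb01: "xb \<in> {0..1}" using xb by simp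
  have memM: "z \<in> ?M \<longleftrightarrow> 0 \<le> fst z \<and> fst z < xb" and memP: "z \<in> ?P \<longleftrightarrow> xb < fst z \<and> fst z \<le> 1" for z
    using xb by (auto simp: Omega_minus_def Omega_plus_def Omega_def mem_Times_iff)
  have GM: "G z = (usup (fst z), 0)" if "z \<in> ?M" for z
    using that by (simp add: G_def memM background_velocity_def)
  have GP: "G z = (usub (fst z), 0)" if "z \<in> ?P" for z
    using that by (simp add: G_def memP background_velocity_def)
  have fM: "(background xb has_real_derivative usup x) (at x within {0..<xb})" if "x \<in> {0..<xb}" for x
    using that xb by (intro has_field_derivative_subset[OF background_deriv_minus]) auto
  have fP: "(background xb has_real_derivative usub x) (at x within {xb<..1})" if "x \<in> {xb<..1}" for x
    using that xb by (intro has_field_derivative_subset[OF background_deriv_plus]) auto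
  have imM: "fst ` ?M \<subseteq> {0..<xb}" and imP: "fst ` ?P \<subseteq> {xb<..1}" by (auto simp: memM memP)
  have speedG: "speed n x (q, 0) = \<bar>q\<bar>" for x q by (simp add: speed_def)
  have lip: "qm-lipschitz_on Omega ?\<phi>"
  proof (rule lipschitz_onI)
    fix z w :: "real \<times> real" assume "z \<in> Omega" "w \<in> Omega"
    then have "dist (?\<phi> z) (?\<phi> w) \<le> qm * dist (fst z) (fst w)"
      by (intro lipschitz_onD[OF background_lipschitz[OF xb]]) (auto simp: Omega_def)
    also have "\<dots> \<le> qm * dist z w" using qm_pos by (intro mult_left_mono dist_fst_le) auto
    finally show "dist (?\<phi> z) (?\<phi> w) \<le> qm * dist z w" .
  qed (use qm_pos in simp)
  have C2M: "C2_on ?M ?\<phi>"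
  proof (rule C2_on_fst[OF imM fM])
    show "(usup has_real_derivative ode_rhs x (usup x)) (at x within {0..<xb})" if "x \<in> {0..<xb}" for x
      using that xb by (intro has_field_derivative_subset[OF usup(4)]) auto
    show "continuous_on {0..<xb} (\<lambda>x. ode_rhs x (usup x))"
      using xb by (intro continuous_on_subset[OF usup_deriv_cont]) auto
  qed
  have C2P: "C2_on ?P ?\<phi>"
  proof (rule C2_on_fst[OF imP fP])
    show "(usub has_real_derivative ode_rhs x (usub x)) (at x within {xb<..1})" if "x \<in> {xb<..1}" for x
      using that xb by (intro has_field_derivative_subset[OF usub(4)]) auto
    show "continuous_on {xb<..1} (\<lambda>x. ode_rhs x (usub x))"
      using xb by (intro continuous_on_subset[OF usub_deriv_cont]) auto
  qed
  have derM: "(?\<phi> has_derivative (\<lambda>h. fst (G z) * fst h + snd (G z) * snd h)) (at z within ?M)" if z: "z \<in> ?M" for z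
    using grad_within_fst[OF fM imM, of z] z by (auto simp: grad_within_def GM memM)
  have derP: "(?\<phi> has_derivative (\<lambda>h. fst (G z) * fst h + snd (G z) * snd h)) (at z within ?P)" if z: "z \<in> ?P" for z
    using grad_within_fst[OF fP imP, of z] z by (auto simp: grad_within_def GP memP)
  have flux: "n x * rho \<gamma> c0 (speed n x (G (x, y))) * fst (G (x, y)) = j" if "x \<in> {0..1}" for x y
    using usup(3)[OF that] usub(3)[OF that]
    by (simp add: G_def background_velocity_def rho_speed mflux_def)
  have limM: "(G \<longlongrightarrow> (usup xb, 0)) (at (xb, y) within ?M)" for y
  proof -
    have "((\<lambda>z. (usup (fst z), 0::real)) \<longlongrightarrow> (usup xb, 0)) (at (xb, y) within ?M)"
    proof (intro tendsto_intros continuous_on_tendsto_compose[OF usup_cont _ xb01])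
      show "(fst \<longlongrightarrow> xb) (at (xb, y) within ?M)" by (auto intro!: tendsto_eq_intros)
      show "\<forall>\<^sub>F z in at (xb, y) within ?M. fst z \<in> {0..1}"
        using xb by (auto simp: eventually_at_filter memM)
    qed
    then show ?thesis
      by (rule Lim_transform_eventually) (auto simp: eventually_at_filter GM)
  qed
  have limP: "(G \<longlongrightarrow> (usub xb, 0)) (at (xb, y) within ?P)" for y
  proof -
    have "((\<lambda>z. (usub (fst z), 0::real)) \<longlongrightarrow> (usub xb, 0)) (at (xb, y) within ?P)"
    proof (intro tendsto_intros continuous_on_tendsto_compose[OF usub_cont _ xb01])
      show "(fst \<longlongrightarrow> xb) (at (xb, y) within ?P)" by (auto intro!: tendsto_eq_intros)
      show "\<forall>\<^sub>F z in at (xb, y) within ?P. fst z \<in> {0..1}"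
        using xb by (auto simp: eventually_at_filter memP)
    qed
    then show ?thesis
      by (rule Lim_transform_eventually) (auto simp: eventually_at_filter GP)
  qed
  have bernoulli: "q\<^sup>2 / 2 + csq \<gamma> c0 q / (\<gamma> - 1) = c0\<^sup>2 / (\<gamma> - 1)" for q
    using gamma by (simp add: csq_def field_simps)
  have u1: "0 < usub 1" "usub 1 < cs" using usub(1,2)[of 1] by auto
  show ?thesis
    unfolding transonic_shock_solution_def
  proof (intro conjI exI[of _ G] exI[of _ qm] lip C2M C2P)
    show "\<forall>z\<in>?M. cs < speed n (fst z) (G z) \<and> speed n (fst z) (G z) < qm"
    proof
      fix z assume z: "z \<in> ?M"
      then have "fst z \<in> {0..1}" using xb by (auto simp: memM)
      with usup(1,2) z show "cs < speed n (fst z) (G z) \<and> speed n (fst z) (G z) < qm"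
        using cs_pos by (fastforce simp: GM speedG)
    qed
    show "\<forall>z\<in>?P. speed n (fst z) (G z) < cs"
    proof
      fix z assume z: "z \<in> ?P"
      then have "fst z \<in> {0..1}" using xb by (auto simp: memP)
      with usub(1,2) z show "speed n (fst z) (G z) < cs" by (fastforce simp: GP speedG)
    qed
    show "\<forall>z\<in>?M \<union> ?P. 0 < fst z \<and> fst z < 1 \<longrightarrow>
         (\<exists>d1 d2.
           ((\<lambda>t. n t * rho \<gamma> c0 (speed n t (G (t, snd z))) * fst (G (t, snd z)))
               has_real_derivative d1) (at (fst z)) \<and>
           ((\<lambda>s. rho \<gamma> c0 (speed n (fst z) (G (fst z, s))) / n (fst z) * snd (G (fst z, s)))
               has_real_derivative d2) (at (snd z)) \<and>
           (d1 + d2) / n (fst z) = 0)"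
    proof (intro ballI impI exI[of _ 0] conjI)
      fix z :: "real \<times> real" assume z: "0 < fst z \<and> fst z < 1"
      show "((\<lambda>t. n t * rho \<gamma> c0 (speed n t (G (t, snd z))) * fst (G (t, snd z)))
               has_real_derivative 0) (at (fst z))"
        by (rule has_field_derivative_transform_within_open[OF DERIV_const[of j], of "{0<..<1}"])
          (use z flux in auto)
      show "((\<lambda>s. rho \<gamma> c0 (speed n (fst z) (G (fst z, s))) / n (fst z) * snd (G (fst z, s)))
               has_real_derivative 0) (at (snd z))"
        by (simp add: G_def)
    qed simp
    show "\<forall>y. G (0, y) = (u0, 0)" using xb by (simp add: G_def background_velocity_def usup_0)
    show "\<forall>y. speed n 1 (G (1, y)) = usub 1"
      using xb u1 by (simp add: G_def background_velocity_def speedG)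
    have "0 < fst (G (0, y))" "0 < fst (G (1, y))" for y
      using xb u1 u0 cs_pos by (auto simp: G_def background_velocity_def usup_0)
    then show "\<forall>y. 0 \<le> fst (G (0, y)) \<and> 0 \<le> fst (G (1, y))" by (simp add: less_imp_le)
    show "\<forall>y. \<exists>gm gp.
         (G \<longlongrightarrow> gm) (at (xb, y) within ?M) \<and>
         (G \<longlongrightarrow> gp) (at (xb, y) within ?P) \<and>
         (rho \<gamma> c0 (speed n xb gm) *\<^sub>R gradON n xb gm
            - rho \<gamma> c0 (speed n xb gp) *\<^sub>R gradON n xb gp) \<bullet> shock_normal n (\<lambda>_. xb) y = 0 \<and>
         (speed n xb gm)^2 / 2 + csq \<gamma> c0 (speed n xb gm) / (\<gamma> - 1)
           = (speed n xb gp)^2 / 2 + csq \<gamma> c0 (speed n xb gp) / (\<gamma> - 1)"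
    proof (rule allI, rule exI[of _ "(usup xb, 0)"], rule exI[of _ "(usub xb, 0)"], intro conjI limM limP)
      fix y
      have "rho \<gamma> c0 (speed n xb (usup xb, 0)) *\<^sub>R gradON n xb (usup xb, 0)
            - rho \<gamma> c0 (speed n xb (usub xb, 0)) *\<^sub>R gradON n xb (usub xb, 0) = 0"
        using shock_jump[OF xb01] by (simp add: rho_speed gradON_def mflux_def zero_prod_def)
      then show "(rho \<gamma> c0 (speed n xb (usup xb, 0)) *\<^sub>R gradON n xb (usup xb, 0)
            - rho \<gamma> c0 (speed n xb (usub xb, 0)) *\<^sub>R gradON n xb (usub xb, 0)) \<bullet> shock_normal n (\<lambda>_. xb) y = 0"
        by (simp only: inner_zero_left)
    qed (simp add: bernoulli)
  qed (use xb derM derP in auto)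
qed

end

lemma (in nozzle_flow) transonic_shock_solution_imp_shock_solution:
  assumes sol: "transonic_shock_solution \<gamma> c0 u0 n c1 \<phi> xs" and c1: "0 < c1" "c1 < cs"
  obtains G where "shock_solution \<gamma> c0 u0 n c1 \<phi> xs G"
  using sol unfolding transonic_shock_solution_def
  apply (elim conjE exE)
  subgoal for L G
    apply (rule that[of G])
    apply unfold_locales
    using c1 by (assumption | blast)+
  done

theorem theorem3p1:
  fixes \<gamma> c0 u0 u1 c1 :: real and n :: "real \<Rightarrow> real"
  assumes gamma: "\<gamma> > 1" and c0: "c0 > 0"
    and u0: "cstar \<gamma> c0 < u0" "u0 < qmax \<gamma> c0"
    and n_pos: "\<forall>x\<in>{0..1}. n x > 0"
    and n_smooth: "smooth_on_01 n"
    and standing: "rho \<gamma> c0 u0 * u0 * n 0 < rho \<gamma> c0 (cstar \<gamma> c0) * cstar \<gamma> c0 * (INF x\<in>{0..1}. n x)"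
    and u1: "0 < u1" "u1 < cstar \<gamma> c0"
    and u1_eq: "rho \<gamma> c0 u1 * u1 * n 1 = rho \<gamma> c0 u0 * u0 * n 0"
    and c1: "0 < c1" "c1 < cstar \<gamma> c0"
  shows "((\<exists>\<phi> xs. transonic_shock_solution \<gamma> c0 u0 n c1 \<phi> xs) \<longleftrightarrow> c1 = u1)
       \<and> (\<forall>\<phi> xs. transonic_shock_solution \<gamma> c0 u0 n c1 \<phi> xs \<longrightarrow>
            (\<exists>xb\<in>{0<..<1}. (\<forall>t. xs t = xb) \<and>
               (\<exists>\<psi> C. background_solution \<gamma> c0 u0 n xb \<psi> \<and>
                       (\<forall>x\<in>Omega. \<phi> x = \<psi> (fst x) + C))))
       \<and> (c1 = u1 \<longrightarrow> (\<forall>xb\<in>{0<..<1}. \<exists>\<psi>. background_solution \<gamma> c0 u0 n xb \<psi> \<and>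
              transonic_shock_solution \<gamma> c0 u0 n c1 (\<lambda>x. \<psi> (fst x)) (\<lambda>_. xb)))"
proof -
  interpret nozzle_flow \<gamma> c0 u0 n
    using gamma c0 u0 n_pos n_smooth standing by unfold_locales auto
  have u1_usub: "u1 = usub 1"
  proof (rule mflux_inj_sub)
    have "n 1 * mflux u1 = n 1 * mflux (usub 1)"
      using u1_eq usub(3)[of 1] by (simp add: j_def mflux_def rho_eq mult_ac)
    then show "mflux u1 = mflux (usub 1)" using n_pos[of 1] by simp
  qed (use u1 usub(1,2)[of 1] in auto)
  have unique: "c1 = u1 \<and> (\<exists>xb\<in>{0<..<1}. (\<forall>t. xs t = xb) \<and>
               (\<exists>\<psi> C. background_solution \<gamma> c0 u0 n xb \<psi> \<and>
                       (\<forall>x\<in>Omega. \<phi> x = \<psi> (fst x) + C)))"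
    if sol: "transonic_shock_solution \<gamma> c0 u0 n c1 \<phi> xs" for \<phi> xs
  proof -
    obtain G where "shock_solution \<gamma> c0 u0 n c1 \<phi> xs G"
      by (rule transonic_shock_solution_imp_shock_solution[OF sol c1])
    then interpret shock_solution \<gamma> c0 u0 n c1 \<phi> xs G .
    define xb where "xb = xs 0"
    have xb: "0 < xb" "xb < 1" using xs_bounds[of 0] by (auto simp: xb_def)
    have xs: "xs t = xb" for t unfolding xb_def by (rule xs_constant)
    have "\<phi> z = background xb (fst z) + \<phi> (0, 0)" if z: "z \<in> Omega" for z
    proof -
      obtain x y where zxy: "z = (x, y)" "0 \<le> x" "x \<le> 1" using z by (cases z) (auto simp: Omega_def)
      \<comment> \<open>The two one-sided values of \<open>\<phi>\<close> on the shock tie together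
        the additive constants of the two regions, so a single constant remains.\<close>
      have jump: "Psup xb + \<phi> (0, 0) = Psub xb + wdiff (1, 0)"
        using \<phi>_shock_value[of y] by (simp add: xs)
      consider "x < xb" | "x = xb" | "xb < x" by linarith
      then show ?thesis
      proof cases
        case 1
        then show ?thesis using \<phi>_minus_eq[of z] zxy by (simp add: mem_OM xs background_def)
      next
        case 2
        then show ?thesis using \<phi>_shock_value(1)[of y] zxy by (simp add: xs background_def)
      next
        case 3
        then show ?thesis using \<phi>_plus_eq[of z] zxy jump by (simp add: mem_OP xs background_def)
      qed
    qed
    with exit_speed u1_usub xb xs background_is_solution[OF xb] show ?thesis by auto
  qed
  have exist: "\<exists>\<psi>. background_solution \<gamma> c0 u0 n xb \<psi> \<and>
              transonic_shock_solution \<gamma> c0 u0 n c1 (\<lambda>x. \<psi> (fst x)) (\<lambda>_. xb)"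
    if "c1 = u1" "xb \<in> {0<..<1}" for xb
    using that background_is_solution[of xb] background_is_transonic_shock[of xb] u1_usub by auto
  have "\<exists>\<phi> xs. transonic_shock_solution \<gamma> c0 u0 n c1 \<phi> xs" if "c1 = u1"
    using exist[OF that, of "1 / 2"] by auto
  with unique exist show ?thesis by blast
qed

end
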